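(* Let $n\geq 14$ be even, let $6\leq r\leq (n-2)/2$, and put $i=n/2-r$ (so $i\geq 1$). Let $V=\{t_1,\dots,t_{i+r+2}\}\sqcup\{s_1,\dots,s_{i+r-2}\}$ (so $|V|=n$) and consider the labelled graph on $V$ with edges: a terminal-1 alternating path on $t_1,\dots,t_{i+4}$; edges $\{t_{i+k+2},t_{i+k+3}\}$ with label $k$ for $2\leq k\leq r-1$; a terminal-1 alternating path on $s_1,\dots,s_i$; edges $\{s_{i+k-2},s_{i+k-1}\}$ with label $k$ for $2\leq k\leq r-1$; and the two edges $\{t_{i+r+1},s_{i+r-3}\}$ and $\{t_{i+r+2},s_{i+r-2}\}$ with label $r-3$. Then $G\cong A_n$ and $(G,(\rho_0,\dots,\rho_{r-1}))$ is a string C-group of rank $r$ with Schläfli type $\{\mathrm{lcm}(i+4,i),6,3^{r-6},6,6,3\}$.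
   Context: A string group generated by involutions (sggi) of rank $r$ is a pair $(G,(\rho_0,\dots,\rho_{r-1}))$ where $\rho_0,\dots,\rho_{r-1}$ are involutions generating the group $G$ such that $(\rho_i\rho_j)^2=1$ whenever $|i-j|\geq 2$. It is a string C-group if in addition it satisfies the intersection property: for all $J,K\subseteq\{0,\dots,r-1\}$, $\langle \rho_j : j\in J\rangle\cap\langle\rho_k : k\in K\rangle=\langle \rho_j : j\in J\cap K\rangle$. The Schläfli type is $\{p_1,\dots,p_{r-1}\}$ where $p_i$ is the order of $\rho_{i-1}\rho_i$; $3^k$ denotes $k$ consecutive entries equal to $3$ (omitted if $k=0$). Labelled-graph convention: the vertex set $V$ is finite, and each edge $\{a,b\}$ ($a\neq b$) carries one or more labels from $\{0,\dots,r-1\}$, the edges carrying any given label being pairwise disjoint; $\rho_k$ denotes the permutation of $V$ equal to the product of the transpositions $(a\,b)$ over all edges $\{a,b\}$ carrying label $k$, and $G=\langle\rho_0,\dots,\rho_{r-1}\rangle\leq \mathrm{Sym}(V)$. A terminal-1 alternating path on vertices $v_1,\dots,v_a$ means the edges $\{v_s,v_{s+1}\}$ ($1\leq s\leq a-1$), where $\{v_s,v_{s+1}\}$ carries label $1$ if $a-s$ is odd and label $0$ if $a-s$ is even (so the last edge carries label 1 and labels alternate; if $a=1$ there are no edges). *)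

theory Defs
  imports "HOL-Algebra.Sym_Groups" "HOL-Algebra.Multiplicative_Group"
begin

text \<open>A labelled graph is given by a set of triples (k, a, b), meaning that the
  edge {a,b} carries label k. The permutation rho_k swaps the two endpoints of
  every edge carrying label k (these edges are pairwise disjoint in the
  construction below) and fixes all other points.\<close>

definition lg_perm :: "(nat \<times> 'a \<times> 'a) set \<Rightarrow> nat \<Rightarrow> 'a \<Rightarrow> 'a" where
  "lg_perm E k v =
     (if \<exists>w. (k, v, w) \<in> E \<or> (k, w, v) \<in> E
      then (THE w. (k, v, w) \<in> E \<or> (k, w, v) \<in> E) else v)"

definition term1_path :: "(nat \<Rightarrow> 'a) \<Rightarrow> nat \<Rightarrow> (nat \<times> 'a \<times> 'a) set" where
  "term1_path v a =
     {(if odd (a - s) then 1 else 0, v s, v (s + 1)) | s. 1 \<le> s \<and> s < a}"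

definition sggi :: "('g, 'b) monoid_scheme \<Rightarrow> (nat \<Rightarrow> 'g) \<Rightarrow> nat \<Rightarrow> bool" where
  "sggi G \<rho> r \<longleftrightarrow>
     group G \<and>
     (\<forall>j<r. \<rho> j \<in> carrier G \<and> \<rho> j \<noteq> \<one>\<^bsub>G\<^esub> \<and> \<rho> j \<otimes>\<^bsub>G\<^esub> \<rho> j = \<one>\<^bsub>G\<^esub>) \<and>
     (\<forall>j<r. \<forall>k<r. j + 2 \<le> k \<longrightarrow> (\<rho> j \<otimes>\<^bsub>G\<^esub> \<rho> k) [^]\<^bsub>G\<^esub> (2::nat) = \<one>\<^bsub>G\<^esub>) \<and>
     carrier G = generate G (\<rho> ` {..<r})"

definition intersection_property :: "('g, 'b) monoid_scheme \<Rightarrow> (nat \<Rightarrow> 'g) \<Rightarrow> nat \<Rightarrow> bool" where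
  "intersection_property G \<rho> r \<longleftrightarrow>
     (\<forall>J K. J \<subseteq> {..<r} \<longrightarrow> K \<subseteq> {..<r} \<longrightarrow>
        generate G (\<rho> ` J) \<inter> generate G (\<rho> ` K) = generate G (\<rho> ` (J \<inter> K)))"

definition string_C_group :: "('g, 'b) monoid_scheme \<Rightarrow> (nat \<Rightarrow> 'g) \<Rightarrow> nat \<Rightarrow> bool" where
  "string_C_group G \<rho> r \<longleftrightarrow> sggi G \<rho> r \<and> intersection_property G \<rho> r"

definition schlafli_type :: "('g, 'b) monoid_scheme \<Rightarrow> (nat \<Rightarrow> 'g) \<Rightarrow> nat \<Rightarrow> nat list" where
  "schlafli_type G \<rho> r = map (\<lambda>j. group.ord G (\<rho> (j - 1) \<otimes>\<^bsub>G\<^esub> \<rho> j)) [1..<r]"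

text \<open>Vertices are encoded in {1..n}: t_j is j (1 <= j <= i+r+2) and s_j is
  i+r+2+j (1 <= j <= i+r-2), where i = n/2 - r.\<close>

definition thm41_edges :: "nat \<Rightarrow> nat \<Rightarrow> (nat \<times> nat \<times> nat) set" where
  "thm41_edges n r =
    (let i = n div 2 - r;
         t = (\<lambda>j. j);
         s = (\<lambda>j. i + r + 2 + j)
     in term1_path t (i + 4)
        \<union> {(k, t (i + k + 2), t (i + k + 3)) | k. 2 \<le> k \<and> k \<le> r - 1}
        \<union> term1_path s i
        \<union> {(k, s (i + k - 2), s (i + k - 1)) | k. 2 \<le> k \<and> k \<le> r - 1}
        \<union> {(r - 3, t (i + r + 1), s (i + r - 3)), (r - 3, t (i + r + 2), s (i + r - 2))})"

definition thm41_rho :: "nat \<Rightarrow> nat \<Rightarrow> nat \<Rightarrow> (nat \<Rightarrow> nat)" where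
  "thm41_rho n r k = lg_perm (thm41_edges n r) k"

definition thm41_group :: "nat \<Rightarrow> nat \<Rightarrow> (nat \<Rightarrow> nat) monoid" where
  "thm41_group n r =
     (sym_group n) \<lparr> carrier := generate (sym_group n) (thm41_rho n r ` {..<r}) \<rparr>"

end

theory Submission
  imports Defs
begin

text \<open>Write a_k and b_k for the t- and s-vertex joined by label k to their successors (P True k and
  P False k below). For k at least 2, the generator with label k acts on the blocks {a_l, b_l} as
  the transposition (k k+1), and the one with label r-3 moreover reverses the last two blocks. Hence
  the parabolic subgroups generated by consecutive labels are essentially groups of signed
  permutations. For the intersection property it suffices that the parabolic subgroups of
  [a, b-1] and [a+1, b] meet in that of [a+1, b-1]: an element of the second that also respects
  what the labels up to b-1 preserve (the last blocks and the two sides) is brought to the identity by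
  sorting with elements of the third one; parity excludes a single reversed block. The group is
  alternating because its generators are even and because the i-th power of the product of the
  generators 0 and 1 acts only on the t-path, so that its commutator with generator 2 is a 3-cycle.\<close>

section \<open>The intersection property from intervals of generators\<close>

text \<open>Sorting needs elements that exchange two neighbouring blocks and do nothing else, but
  label 1 also acts on the rest of both paths, and label \<open>r - 3\<close> reverses two blocks.
  Two situations escape this scheme. For \<open>i = 1\<close> the s-path is a single vertex and
  label 1 moves t-vertices only; below the bridge the two sides are then permuted independently,
  coupled only by a parity that the points 2 and 3 record. In intervals starting at
  \<open>r - 3\<close> the label \<open>r - 4\<close>, needed for the repair, is missing; there the
  two points of block \<open>r - 3\<close> are renamed so that all reversals merge into one global
  reversal. The four additional vertices of the t-path matter twice: they carry two more edges of
  each of the labels 0 and 1, which makes these generators even, and \<open>i + 4\<close> does not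
  divide \<open>i\<close>, so the power mentioned above is not trivial on the t-path.\<close>

context group
begin

lemma generate_commute:
  assumes "A \<subseteq> carrier G" "B \<subseteq> carrier G"
    and comm: "\<And>x y. x \<in> A \<Longrightarrow> y \<in> B \<Longrightarrow> x \<otimes> y = y \<otimes> x"
    and "x \<in> generate G A" "y \<in> generate G B"
  shows "x \<otimes> y = y \<otimes> x"
proof -
  have inv_comm: "inv u \<otimes> v = v \<otimes> inv u"
    if "u \<in> carrier G" "v \<in> carrier G" "u \<otimes> v = v \<otimes> u" for u v
    using that by (metis inv_closed inv_solve_left inv_solve_right m_assoc m_closed)
  have 1: "a \<otimes> y = y \<otimes> a" if "a \<in> A" for a
    using assms(5)
  proof induction
    case one
    then show ?case using that assms(1) by auto
  next
    case (incl h)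
    then show ?case using that comm by auto
  next
    case (inv h)
    then show ?case using that comm assms(1,2) inv_comm by (metis subsetD)
  next
    case (eng h1 h2)
    then have "h1 \<in> carrier G" "h2 \<in> carrier G" "a \<in> carrier G"
      using generate_in_carrier assms(1,2) that by auto
    then show ?case using eng.IH by (metis m_assoc m_closed)
  qed
  have y: "y \<in> carrier G"
    using assms(2,5) generate_in_carrier by auto
  show ?thesis
    using assms(4)
  proof induction
    case one
    then show ?case using y by auto
  next
    case (incl h)
    then show ?case by (rule 1)
  next
    case (inv h)
    then show ?case using 1 y assms(1) inv_comm by (metis subsetD)
  next
    case (eng h1 h2)
    then have "h1 \<in> carrier G" "h2 \<in> carrier G"
      using generate_in_carrier assms(1) by auto
    then show ?case using eng.IH y by (metis m_assoc m_closed)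
  qed
qed

lemma generate_Un_commuting:
  assumes "A \<subseteq> carrier G" "B \<subseteq> carrier G"
    and comm: "\<And>x y. x \<in> A \<Longrightarrow> y \<in> B \<Longrightarrow> x \<otimes> y = y \<otimes> x"
    and "g \<in> generate G (A \<union> B)"
  obtains x y where "x \<in> generate G A" "y \<in> generate G B" "g = x \<otimes> y"
proof -
  have sub: "subgroup (generate G A) G" "subgroup (generate G B) G"
    using assms(1,2) generate_is_subgroup by auto
  have "\<exists>x\<in>generate G A. \<exists>y\<in>generate G B. g = x \<otimes> y"
    using assms(4)
  proof induction
    case one
    then show ?case using generate.one r_one one_closed by metis
  next
    case (incl h)
    then have "h \<in> carrier G" using assms(1,2) by auto
    then show ?case using incl generate.incl generate.one r_one l_one
      by (metis UnE)
  next
    case (inv h)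
    then have "inv h \<in> carrier G" using assms(1,2) by auto
    then show ?case using inv generate.inv generate.one r_one l_one
      by (metis UnE)
  next
    case (eng h1 h2)
    then obtain x y x' y' where x: "x \<in> generate G A" "x' \<in> generate G A"
      and y: "y \<in> generate G B" "y' \<in> generate G B" and h: "h1 = x \<otimes> y" "h2 = x' \<otimes> y'"
      by blast
    have c: "x \<in> carrier G" "y \<in> carrier G" "x' \<in> carrier G" "y' \<in> carrier G"
      using x y sub subgroup.mem_carrier by metis+
    have "x' \<otimes> y = y \<otimes> x'"
      using generate_commute[OF assms(1,2) comm x(2) y(1)] .
    then have "h1 \<otimes> h2 = (x \<otimes> x') \<otimes> (y \<otimes> y')"
      unfolding h using c by (metis m_assoc m_closed)
    then show ?case using x y generate.eng by metis
  qed
  then show thesis using that by blast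
qed

end

locale string_generators = group +
  fixes \<rho> :: "nat \<Rightarrow> 'a" and r :: nat
  assumes rho_closed: "j < r \<Longrightarrow> \<rho> j \<in> carrier G"
    and rho_commute: "j + 2 \<le> k \<Longrightarrow> k < r \<Longrightarrow> \<rho> j \<otimes> \<rho> k = \<rho> k \<otimes> \<rho> j"
begin

abbreviation par :: "nat set \<Rightarrow> 'a set" where "par J \<equiv> generate G (\<rho> ` J)"

lemma par_subgroup: "J \<subseteq> {..<r} \<Longrightarrow> subgroup (par J) G"
  using rho_closed by (intro generate_is_subgroup) auto

lemma par_mono: "J \<subseteq> K \<Longrightarrow> par J \<subseteq> par K"
  by (simp add: mono_generate image_mono)

text \<open>Labels on different sides of a missing label \<open>j\<close> differ by at least 2, so
  their generators commute.\<close>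

lemma par_split:
  assumes "J \<subseteq> {..<r}" "j \<notin> J" "g \<in> par J"
  obtains x y where "x \<in> par (J \<inter> {..<j})" "y \<in> par (J \<inter> {j<..})" "g = x \<otimes> y"
proof (rule generate_Un_commuting)
  show "\<rho> ` (J \<inter> {..<j}) \<subseteq> carrier G" "\<rho> ` (J \<inter> {j<..}) \<subseteq> carrier G"
    using assms(1) rho_closed by auto
  have "J = (J \<inter> {..<j}) \<union> (J \<inter> {j<..})"
    using assms(2) by (metis Int_Un_distrib Int_absorb2 Un_iff greaterThan_iff lessThan_iff linorder_neqE_nat subsetI)
  then have "\<rho> ` J = \<rho> ` (J \<inter> {..<j}) \<union> \<rho> ` (J \<inter> {j<..})"
    by (metis image_Un)
  then show "g \<in> generate G (\<rho> ` (J \<inter> {..<j}) \<union> \<rho> ` (J \<inter> {j<..}))"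
    using assms(3) by simp
  show "x \<otimes> y = y \<otimes> x" if "x \<in> \<rho> ` (J \<inter> {..<j})" "y \<in> \<rho> ` (J \<inter> {j<..})" for x y
    using that assms(1) by (auto intro!: rho_commute)
qed (use that in auto)

text \<open>Both groups lie in groups of intervals that omit one end of \<open>{a..<d}\<close>, so
  \<open>cond\<close> puts the intersection into the group of \<open>{a + 1..<d - 1}\<close>.
  Meeting each of the two groups with this one spans less than before, and so does the meet of the
  two results.\<close>

lemma par_Int_atLeastLessThan:
  assumes cond: "\<And>a b. a + 1 < b \<Longrightarrow> b \<le> r \<Longrightarrow>
      par {a..<b - 1} \<inter> par {a + 1..<b} \<subseteq> par {a + 1..<b - 1}"
  shows "a \<le> c \<Longrightarrow> b \<le> d \<Longrightarrow> d \<le> r \<Longrightarrow> par {a..<b} \<inter> par {c..<d} \<subseteq> par {c..<b}"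
proof (induction "d - a" arbitrary: a b c d rule: less_induct)
  case less
  show ?case
  proof (cases "a = c \<or> b = d \<or> d \<le> c \<or> b \<le> a")
    case True
    then consider "a = c" | "b = d" | "{c..<d} = {}" | "{a..<b} = {}" by force
    then show ?thesis
    proof cases
      case 3
      then have "par {c..<d} \<subseteq> par {c..<b}" by (intro par_mono) auto
      then show ?thesis by auto
    next
      case 4
      then have "par {a..<b} \<subseteq> par {c..<b}" by (intro par_mono) auto
      then show ?thesis by auto
    qed auto
  next
    case False
    have "par {a..<b} \<subseteq> par {a..<d - 1}" "par {c..<d} \<subseteq> par {a + 1..<d}"
      by (intro par_mono; use False less.prems in auto)+
    moreover have "par {a..<d - 1} \<inter> par {a + 1..<d} \<subseteq> par {a + 1..<d - 1}"
      by (rule cond) (use False less.prems in auto)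
    ultimately have "par {a..<b} \<inter> par {c..<d} \<subseteq>
        (par {a..<b} \<inter> par {a + 1..<d - 1}) \<inter> (par {a + 1..<d - 1} \<inter> par {c..<d})"
      by auto
    also have "\<dots> \<subseteq> par {a + 1..<b} \<inter> par {c..<d - 1}"
      by (intro Int_mono less.hyps) (use False less.prems in auto)
    also have "\<dots> \<subseteq> par {c..<b}"
      by (rule less.hyps) (use False less.prems in auto)
    finally show ?thesis .
  qed
qed

text \<open>Each of two proper subsets misses a label. Splitting there yields factors whose labels
  lie in shorter intervals, where the induction applies; \<open>par_Int_atLeastLessThan\<close>
  compares the two splittings.\<close>

lemma par_Int:
  assumes cond: "\<And>a b. a + 1 < b \<Longrightarrow> b \<le> r \<Longrightarrow>
      par {a..<b - 1} \<inter> par {a + 1..<b} \<subseteq> par {a + 1..<b - 1}"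
    and "J \<subseteq> {a..<b}" "K \<subseteq> {a..<b}" "b \<le> r"
  shows "par J \<inter> par K \<subseteq> par (J \<inter> K)"
  using assms(2-4)
proof (induction "b - a" arbitrary: a b J K rule: less_induct)
  case less
  note int = par_Int_atLeastLessThan[OF cond]
  \<comment> \<open>The missing labels are taken in the order \<open>j \<le> k\<close>; the other
    order follows by exchanging \<open>J\<close> and \<open>K\<close>.\<close>
  have main: "g \<in> par (J \<inter> K)"
    if JK: "J \<subseteq> {a..<b}" "K \<subseteq> {a..<b}" and g: "g \<in> par J" "g \<in> par K"
      and j: "j \<in> {a..<b}" "j \<notin> J" and k: "k \<in> {a..<b}" "k \<notin> K" and "j \<le> k" for g J K j k
  proof -
    have r: "J \<subseteq> {..<r}" "K \<subseteq> {..<r}" using JK less.prems by auto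
    obtain g1 g2 where g1: "g1 \<in> par (J \<inter> {..<j})" and g2: "g2 \<in> par (J \<inter> {j<..})"
      and gg: "g = g1 \<otimes> g2" using par_split[OF r(1) j(2) g(1)] .
    obtain h1 h2 where h1: "h1 \<in> par (K \<inter> {..<k})" and h2: "h2 \<in> par (K \<inter> {k<..})"
      and gh: "g = h1 \<otimes> h2" using par_split[OF r(2) k(2) g(2)] .
    have c: "g1 \<in> carrier G" "g2 \<in> carrier G" "h1 \<in> carrier G" "h2 \<in> carrier G"
      using g1 g2 h1 h2 r par_subgroup subgroup.mem_carrier by (metis le_infI1)+
    have inP: "x \<in> par T" if "x \<in> par S" "S \<subseteq> T" for x S T
      using that par_mono by blast
    have mult: "x \<otimes> y \<in> par T" if "x \<in> par T" "y \<in> par T" for x y T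
      using that generate.eng by metis
    have invP: "inv x \<in> par T" if "x \<in> par T" "T \<subseteq> {..<r}" for x T
      using that par_subgroup subgroup.m_inv_closed by metis
    \<comment> \<open>The discrepancy between the two factorisations of \<open>g\<close>. Written
      with the left factors it uses only labels below \<open>k\<close>, written with the right
      factors only labels above \<open>j\<close>, so it is generated strictly between the two
      missing labels.\<close>
    define z where "z = inv h1 \<otimes> g1"
    have z': "z = h2 \<otimes> inv g2"
      unfolding z_def using gg gh c by (metis inv_solve_left inv_solve_right m_assoc m_closed inv_closed)
    have zc: "z \<in> carrier G" unfolding z_def using c by auto
    have "z \<in> par {a..<k}"
      unfolding z_def by (rule mult[OF invP[OF inP[OF h1]] inP[OF g1]])
        (use JK \<open>j \<le> k\<close> k less.prems in auto)
    moreover have "z \<in> par {j + 1..<b}"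
      unfolding z' by (rule mult[OF inP[OF h2] invP[OF inP[OF g2]]])
        (use JK \<open>j \<le> k\<close> k less.prems in auto)
    ultimately have z: "z \<in> par {j + 1..<k}"
      using int[of a "j + 1" k b] j k less.prems by auto
    have iz: "inv z \<in> par {j + 1..<k}"
      by (rule invP[OF z]) (use k less.prems in auto)
    have h1z: "h1 = g1 \<otimes> inv z" and g1z: "g1 = h1 \<otimes> z"
      unfolding z_def using c by (auto simp: inv_mult_group simp flip: m_assoc)
    have h2z: "h2 = z \<otimes> g2" and g2z: "g2 = inv z \<otimes> h2"
      unfolding z' using c by (auto simp: inv_mult_group m_assoc)
    have *: "h1 \<in> par ((J \<inter> {..<j}) \<union> {j + 1..<k})"
      unfolding h1z by (rule mult[OF inP[OF g1] inP[OF iz]]) auto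
    have h1': "h1 \<in> par ((K \<inter> {..<k}) \<inter> ((J \<inter> {..<j}) \<union> {j + 1..<k}))"
      by (rule subsetD[OF less.hyps[of "b - 1" a "K \<inter> {..<k}" "(J \<inter> {..<j}) \<union> {j + 1..<k}"]])
        (use * h1 JK \<open>j \<le> k\<close> k j less.prems in auto)
    then obtain u v where u: "u \<in> par (((K \<inter> {..<k}) \<inter> ((J \<inter> {..<j}) \<union> {j + 1..<k})) \<inter> {..<j})"
      and v: "v \<in> par (((K \<inter> {..<k}) \<inter> ((J \<inter> {..<j}) \<union> {j + 1..<k})) \<inter> {j<..})"
      and h1uv: "h1 = u \<otimes> v"
      by (rule par_split[rotated 2]) (use r in auto)
    have uc: "u \<in> carrier G" "v \<in> carrier G"
      using inP[OF u, of "{..<r}"] inP[OF v, of "{..<r}"] r par_subgroup[of "{..<r}"]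
        subgroup.mem_carrier by (metis inf.coboundedI1 inf.coboundedI2 subset_refl)+
    \<comment> \<open>One element written with labels below \<open>j\<close> and with labels above
      \<open>j\<close>; it lies in the group of an empty interval and is trivial. Hence
      \<open>u\<close> is the left factor of \<open>g\<close>, and \<open>v\<close> is the inverse
      of \<open>z\<close>.\<close>
    have "inv u \<otimes> g1 = v \<otimes> z"
      unfolding g1z h1uv using uc zc by (simp flip: m_assoc)
    moreover have "inv u \<otimes> g1 \<in> par {a..<j}"
      by (rule mult[OF invP[OF inP[OF u]] inP[OF g1]])
        (use JK \<open>j \<le> k\<close> k less.prems in auto)
    moreover have "v \<otimes> z \<in> par {j + 1..<b}"
      by (rule mult[OF inP[OF v] inP[OF z]])
        (use JK \<open>j \<le> k\<close> k less.prems in auto)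
    ultimately have "inv u \<otimes> g1 \<in> par {j + 1..<j}"
      using int[of a "j + 1" j b] j less.prems by auto
    then have e: "inv u \<otimes> g1 = \<one>" using generate_empty by simp
    then have "g1 = u \<otimes> \<one>" using uc c inv_solve_left' by fastforce
    then have ug: "g1 = u" using uc by simp
    have "v \<otimes> z = \<one>" using e \<open>inv u \<otimes> g1 = v \<otimes> z\<close> by simp
    then have vz: "inv z = v" using zc uc(2) by (rule inv_equality)
    \<comment> \<open>Both \<open>v\<close> and \<open>h2\<close> use labels of \<open>K\<close>
      only, so the right factor lies in both groups, within the interval shortened at its lower
      end.\<close>
    have "g2 \<in> par (K \<inter> {j<..})"
      unfolding g2z vz by (rule mult[OF inP[OF v] inP[OF h2]]) (use \<open>j \<le> k\<close> in auto)
    then have "g2 \<in> par ((J \<inter> {j<..}) \<inter> (K \<inter> {j<..}))"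
      by (intro subsetD[OF less.hyps[of b "a + 1"]])
        (use g2 JK \<open>j \<le> k\<close> k j less.prems in auto)
    then have "g2 \<in> par (J \<inter> K)" by (rule inP) auto
    moreover have "u \<in> par (J \<inter> K)" by (rule inP[OF u]) auto
    ultimately show ?thesis unfolding gg ug using mult by blast
  qed
  show ?case
  proof (cases "J = {a..<b} \<or> K = {a..<b}")
    case True
    then show ?thesis using less.prems by (auto simp: Int_absorb1 Int_absorb2)
  next
    case False
    then obtain j k where "j \<in> {a..<b}" "j \<notin> J" "k \<in> {a..<b}" "k \<notin> K"
      using less.prems by blast
    then have "g \<in> par (J \<inter> K)" if "g \<in> par J" "g \<in> par K" for g
      using main[OF less.prems(1,2) that, of j k] main[OF less.prems(2,1) that(2,1), of k j]
      by (cases "j \<le> k") (auto simp: Int_commute)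
    then show ?thesis by blast
  qed
qed

lemma intersection_propertyI:
  assumes "\<And>a b. a + 1 < b \<Longrightarrow> b \<le> r \<Longrightarrow>
      par {a..<b - 1} \<inter> par {a + 1..<b} \<subseteq> par {a + 1..<b - 1}"
  shows "intersection_property G \<rho> r"
  unfolding intersection_property_def
proof (intro allI impI subset_antisym)
  fix J K assume "J \<subseteq> {..<r}" "K \<subseteq> {..<r}"
  then show "par J \<inter> par K \<subseteq> par (J \<inter> K)"
    using par_Int[OF assms, of J 0 r K] by (auto simp: atLeast0LessThan)
  show "par (J \<inter> K) \<subseteq> par J \<inter> par K"
    using par_mono[of "J \<inter> K"] by auto
qed

end

section \<open>Permutations\<close>

text \<open>Bubble sort in abstract form. The image of the last point is carried upwards one swap at
  a time until it is in place, and then the next smaller \<open>m\<close> is treated.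
  \<open>Q\<close> is whatever invariant the application knows of \<open>q\<close>; \<open>H\<close>
  enters only through \<open>cancel\<close> and \<open>base\<close>.\<close>

lemma adjacent_swaps_reduction:
  fixes x :: "nat \<Rightarrow> 'a"
  assumes inj: "inj_on x {c..m}"
    and swap: "\<And>k. c \<le> k \<Longrightarrow> k < m \<Longrightarrow> \<sigma> k (x k) = x (Suc k)"
      "\<And>k. c \<le> k \<Longrightarrow> k < m \<Longrightarrow> \<sigma> k (x (Suc k)) = x k"
      "\<And>k j. c \<le> k \<Longrightarrow> k < m \<Longrightarrow> c \<le> j \<Longrightarrow> j \<le> m \<Longrightarrow> j \<noteq> k \<Longrightarrow> j \<noteq> Suc k \<Longrightarrow>
        \<sigma> k (x j) = x j"
    and step: "\<And>k q. c \<le> k \<Longrightarrow> k < m \<Longrightarrow> Q q \<Longrightarrow> Q (\<sigma> k \<circ> q)"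
    and cancel: "\<And>k q. c \<le> k \<Longrightarrow> k < m \<Longrightarrow> \<sigma> k \<circ> q \<in> H \<Longrightarrow> q \<in> H"
    and base: "\<And>q. Q q \<Longrightarrow> (\<forall>j\<in>{c..m}. q (x j) = x j) \<Longrightarrow> q \<in> H"
    and Q_inj: "\<And>q. Q q \<Longrightarrow> inj q"
    and q: "Q q" "q ` x ` {c..m} \<subseteq> x ` {c..m}"
  shows "q \<in> H"
  using assms
proof (induction m arbitrary: Q q)
  case 0
  then show ?case by (cases "c = 0") auto
next
  case (Suc m)
  show ?case
  proof (cases "c \<le> Suc m")
    case False
    then show ?thesis using Suc.prems(7)[OF Suc.prems(9)] by simp
  next
    case c: True
    \<comment> \<open>Once the last point is fixed, this fact joins the invariant: the swaps with
      smaller index do not move \<open>x (Suc m)\<close>.\<close>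
    have fixed: "q \<in> H" if q: "Q q" "q ` x ` {c..Suc m} \<subseteq> x ` {c..Suc m}" "q (x (Suc m)) = x (Suc m)" for q
    proof (rule Suc.IH[of "\<lambda>q. Q q \<and> q (x (Suc m)) = x (Suc m)"])
      show "inj_on x {c..m}" using Suc.prems(1) by (rule inj_on_subset) auto
      have new: "x (Suc m) \<notin> x ` {c..m}"
        using inj_onD[OF Suc.prems(1), of "Suc m"] c by force
      show "q ` x ` {c..m} \<subseteq> x ` {c..m}"
      proof (intro image_subsetI, elim imageE)
        fix y j assume j: "y = x j" "j \<in> {c..m}"
        then have "x j \<noteq> x (Suc m)" using new by (metis imageI)
        then have "q (x j) \<noteq> x (Suc m)"
          using Suc.prems(8)[OF q(1)] q(3) by (metis injD)
        moreover have "q (x j) \<in> x ` {c..Suc m}" using q(2) j(2) by auto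
        ultimately show "q y \<in> x ` {c..m}" using j(1) c by (auto simp: atLeastAtMostSuc_conv)
      qed
      show "q \<in> H" if "Q q \<and> q (x (Suc m)) = x (Suc m)" "\<forall>j\<in>{c..m}. q (x j) = x j" for q
        using that by (intro Suc.prems(7)) (auto simp: atLeastAtMostSuc_conv c)
      show "Q q \<and> q (x (Suc m)) = x (Suc m)" using q by simp
      show "Q (\<sigma> k \<circ> q) \<and> (\<sigma> k \<circ> q) (x (Suc m)) = x (Suc m)"
        if "c \<le> k" "k < m" "Q q \<and> q (x (Suc m)) = x (Suc m)" for k q
      proof
        show "Q (\<sigma> k \<circ> q)" by (rule Suc.prems(5)) (use that in auto)
        show "(\<sigma> k \<circ> q) (x (Suc m)) = x (Suc m)"
          using that Suc.prems(4)[of k "Suc m"] c by auto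
      qed
      show "\<sigma> k (x j) = x j" if "c \<le> k" "k < m" "c \<le> j" "j \<le> m" "j \<noteq> k" "j \<noteq> Suc k" for k j
        using that Suc.prems(4) by simp
      show "inj q" if "Q q \<and> q (x (Suc m)) = x (Suc m)" for q
        using that Suc.prems(8) by simp
      show "q \<in> H" if "c \<le> k" "k < m" "\<sigma> k \<circ> q \<in> H" for k q
        by (rule Suc.prems(6)[OF _ _ that(3)]) (use that in auto)
    qed (use Suc.prems(2,3) in simp_all)
    \<comment> \<open>Downward induction on the place \<open>j\<close> of the image of the last
      point, which \<open>\<sigma> j\<close> moves to place \<open>Suc j\<close>.\<close>
    have "q \<in> H" if "Q q" "q ` x ` {c..Suc m} \<subseteq> x ` {c..Suc m}" "q (x (Suc m)) = x j"
      "c \<le> j" "j \<le> Suc m" for q j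
      using that(5,1-4)
    proof (induction j arbitrary: q rule: inc_induct)
      case base
      then show ?case using fixed by blast
    next
      case (step j)
      have "\<sigma> j ` x ` {c..Suc m} \<subseteq> x ` {c..Suc m}"
      proof -
        have "\<sigma> j (x k) \<in> x ` {c..Suc m}" if "k \<in> {c..Suc m}" for k
          using Suc.prems(2-4)[of j] that step.hyps step.prems(4)
          by (cases "k = j \<or> k = Suc j") auto
        then show ?thesis by auto
      qed
      then have i: "(\<sigma> j \<circ> q) ` x ` {c..Suc m} \<subseteq> x ` {c..Suc m}"
        using step.prems(2) by (force simp flip: image_comp)
      have Qj: "Q (\<sigma> j \<circ> q)"
        by (rule Suc.prems(5)) (use step.prems step.hyps in auto)
      have e: "(\<sigma> j \<circ> q) (x (Suc m)) = x (Suc j)"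
        using step.prems step.hyps Suc.prems(2)[of j] by auto
      have "\<sigma> j \<circ> q \<in> H"
        by (rule step.IH[OF Qj i e]) (use step.prems in auto)
      then show ?case
        by (rule Suc.prems(6)[rotated 2]) (use step.prems step.hyps in auto)
    qed
    moreover obtain j where "c \<le> j" "j \<le> Suc m" "q (x (Suc m)) = x j"
      using Suc.prems(10) c by (metis (no_types) atLeastAtMost_iff imageE image_subset_iff order_refl)
    ultimately show ?thesis using Suc.prems(9,10) by blast
  qed
qed

abbreviation cycle3 :: "'a \<Rightarrow> 'a \<Rightarrow> 'a \<Rightarrow> 'a \<Rightarrow> 'a" where
  "cycle3 u v w \<equiv> transpose u v \<circ> transpose v w"

lemma conj_transpose:
  assumes "bij f"
  shows "f \<circ> transpose u v \<circ> inv' f = transpose (f u) (f v)"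
proof -
  have "f \<circ> transpose u v = transpose (f u) (f v) \<circ> f"
    using transpose_comp_eq[OF assms, of "f u" "f v"] assms by (simp add: bij_is_inj)
  then have "f \<circ> transpose u v \<circ> inv' f = transpose (f u) (f v) \<circ> (f \<circ> inv' f)"
    by (metis comp_assoc)
  moreover have "f \<circ> inv' f = id"
    using assms by (simp add: bij_is_surj flip: surj_iff)
  ultimately show ?thesis by simp
qed

lemma conj_cycle3:
  assumes "bij f"
  shows "f \<circ> cycle3 u v w \<circ> inv' f = cycle3 (f u) (f v) (f w)"
proof -
  have "f \<circ> cycle3 u v w \<circ> inv' f
      = (f \<circ> transpose u v \<circ> inv' f) \<circ> (f \<circ> transpose v w \<circ> inv' f)"
    using assms by (simp add: fun_eq_iff bij_is_inj)
  then show ?thesis using assms by (simp only: conj_transpose)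
qed

section \<open>Three-cycles and alternating subgroups\<close>

locale permutation_subgroup =
  fixes H :: "(nat \<Rightarrow> nat) set" and n :: nat
  assumes subgroup: "subgroup H (sym_group n)"
begin

lemma permutes: "h \<in> H \<Longrightarrow> h permutes {1..n}"
  using subgroup.mem_carrier[OF subgroup] by (simp add: sym_group_carrier)

lemma id_mem: "id \<in> H"
  using subgroup.one_closed[OF subgroup] by (simp add: sym_group_one)

lemma comp_mem: "f \<in> H \<Longrightarrow> g \<in> H \<Longrightarrow> f \<circ> g \<in> H"
  using subgroup.m_closed[OF subgroup] by (simp add: sym_group_mult)

lemma inv_mem: "f \<in> H \<Longrightarrow> inv' f \<in> H"
  using subgroup.m_inv_closed[OF subgroup, of f] permutes by (simp add: sym_group_carrier)

lemma bij: "f \<in> H \<Longrightarrow> bij f"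
  using permutes permutes_bij by blast

lemma comp_cancel_left:
  assumes "h \<in> H" "h \<circ> g \<in> H"
  shows "g \<in> H"
proof -
  have "inv' h \<circ> (h \<circ> g) = g"
    using bij[OF assms(1)] by (simp add: bij_is_inj flip: comp_assoc)
  then show ?thesis using comp_mem[OF inv_mem[OF assms(1)] assms(2)] by simp
qed

lemma comp_cancel_right:
  assumes "h \<in> H" "g \<circ> h \<in> H"
  shows "g \<in> H"
proof -
  have "h \<circ> inv' h = id"
    using bij[OF assms(1)] by (simp add: bij_is_surj flip: surj_iff)
  then have "(g \<circ> h) \<circ> inv' h = g" by (simp add: comp_assoc)
  then show ?thesis using comp_mem[OF assms(2) inv_mem[OF assms(1)]] by simp
qed

lemma funpow_mem: "f \<in> H \<Longrightarrow> f ^^ m \<in> H"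
  by (induction m) (auto simp: id_mem comp_mem)

lemma conj_mem: "f \<in> H \<Longrightarrow> g \<in> H \<Longrightarrow> f \<circ> g \<circ> inv' f \<in> H"
  by (intro comp_mem inv_mem)

lemma inv_cycle3: "inv' (cycle3 u v w) = cycle3 w v u"
  by (simp add: o_inv_distrib transpose_commute)

lemma cycle3_rotate: "distinct [u, v, w] \<Longrightarrow> cycle3 v w u = cycle3 u v w"
  by (auto simp: fun_eq_iff transpose_def)

text \<open>The third point \<open>w\<close> is left open, so that links can be transported by
  conjugation. With reflexivity built in, this becomes an equivalence relation, and a finite set of
  pairwise linked points carries its full alternating group
  (\<open>even_mem_if_linked\<close>).\<close>

definition linked :: "nat \<Rightarrow> nat \<Rightarrow> bool" where
  "linked u v \<longleftrightarrow> u = v \<or> (\<exists>w. distinct [u, v, w] \<and> cycle3 u v w \<in> H)"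

lemma linked_sym:
  assumes "linked u v"
  shows "linked v u"
proof (cases "u = v")
  case False
  then obtain w where w: "distinct [u, v, w]" "cycle3 u v w \<in> H"
    using assms by (auto simp: linked_def)
  then have "cycle3 w v u \<in> H" using inv_mem[OF w(2)] by (simp only: inv_cycle3)
  then have "cycle3 v u w \<in> H" using w(1) cycle3_rotate[of w v u] by auto
  then show ?thesis using w(1) unfolding linked_def by (auto intro!: exI[of _ w])
qed (simp add: linked_def)

lemma linked_map:
  assumes "f \<in> H" "linked u v"
  shows "linked (f u) (f v)"
proof (cases "u = v")
  case False
  then obtain w where w: "distinct [u, v, w]" "cycle3 u v w \<in> H"
    using assms by (auto simp: linked_def)
  have "f a = f b \<longleftrightarrow> a = b" for a b
    using bij[OF assms(1)] by (simp add: bij_is_inj inj_eq)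
  then have "distinct [f u, f v, f w]" using w(1) by simp
  moreover have "cycle3 (f u) (f v) (f w) \<in> H"
    using conj_mem[OF assms(1) w(2)] conj_cycle3[OF bij[OF assms(1)], of u v w] by simp
  ultimately show ?thesis unfolding linked_def by blast
qed (simp add: linked_def)

text \<open>The 3-cycle through \<open>u\<close> and \<open>v\<close> either contains
  \<open>w\<close>, or its inverse sends \<open>v\<close> to \<open>u\<close> and fixes
  \<open>w\<close>, and thus carries the link of \<open>v\<close> and \<open>w\<close> to
  \<open>u\<close> and \<open>w\<close>.\<close>

lemma linked_trans:
  assumes "linked u v" "linked v w"
  shows "linked u w"
proof (cases "u = v \<or> v = w \<or> u = w")
  case True
  then show ?thesis using assms by (auto simp: linked_def)
next
  case False
  then obtain p where p: "distinct [u, v, p]" "cycle3 u v p \<in> H"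
    using assms(1) by (auto simp: linked_def)
  have i: "cycle3 p v u \<in> H" using inv_mem[OF p(2)] by (simp only: inv_cycle3)
  show ?thesis
  proof (cases "p = w")
    case True
    then have "cycle3 u w v \<in> H" using i p(1) cycle3_rotate[of u w v] cycle3_rotate[of w v u] by auto
    then show ?thesis using False True p(1) unfolding linked_def by (auto intro!: exI[of _ v])
  next
    case F: False
    have "cycle3 p v u v = u" "cycle3 p v u w = w"
      using p(1) F False by (auto simp: transpose_def)
    then show ?thesis using linked_map[OF i assms(2)] by simp
  qed
qed

text \<open>The unknown third points \<open>p\<close> and \<open>q\<close> of the two given cycles
  are eliminated by conjugating one cycle with the other; the cases are the possible coincidences
  among \<open>p\<close>, \<open>q\<close>, \<open>v\<close> and \<open>w\<close>.\<close>

lemma cycle3_mem_if_linked: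
  assumes "linked u v" "linked u w" "distinct [u, v, w]"
  shows "cycle3 u v w \<in> H"
proof -
  have conj: "cycle3 (f a) (f b) (f c) \<in> H" if "f \<in> H" "cycle3 a b c \<in> H" for f a b c
    using conj_mem[OF that] conj_cycle3[OF bij[OF that(1)]] by metis
  have invc: "cycle3 c b a \<in> H" if "cycle3 a b c \<in> H" for a b c
    using inv_mem[OF that] by (simp only: inv_cycle3)
  obtain p where p: "distinct [u, v, p]" "cycle3 u v p \<in> H"
    using assms by (auto simp: linked_def)
  obtain q where q: "distinct [u, w, q]" "cycle3 u w q \<in> H"
    using assms by (auto simp: linked_def)
  consider "p = w" | "q = v" | "p \<noteq> w" "q = p" | "p \<noteq> w" "q \<noteq> v" "q \<noteq> p" by blast
  then show ?thesis
  proof cases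
    case 1
    then show ?thesis using p by simp
  next
    case 2
    then have "cycle3 v w u \<in> H" using invc[OF q(2)] by simp
    then show ?thesis using assms(3) by (simp only: cycle3_rotate)
  next
    case 3
    have "cycle3 (cycle3 u w q u) (cycle3 u w q v) (cycle3 u w q p) \<in> H"
      by (rule conj[OF q(2) p(2)])
    moreover have "cycle3 u w q u = w" "cycle3 u w q v = v" "cycle3 u w q p = u"
      using 3 p q assms(3) by (auto simp: transpose_def)
    ultimately have "cycle3 w v u \<in> H" by simp
    then show ?thesis using invc by blast
  next
    case 4
    have "cycle3 (cycle3 u w q u) (cycle3 u w q v) (cycle3 u w q p) \<in> H"
      by (rule conj[OF q(2) p(2)])
    moreover have "cycle3 u w q u = w" "cycle3 u w q v = v" "cycle3 u w q p = p"
      using 4 p q assms(3) by (auto simp: transpose_def)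
    ultimately have wvp: "cycle3 w v p \<in> H" by simp
    have "cycle3 (cycle3 p v w u) (cycle3 p v w v) (cycle3 p v w p) \<in> H"
      by (rule conj[OF invc[OF wvp] p(2)])
    moreover have "cycle3 p v w u = u" "cycle3 p v w v = w" "cycle3 p v w p = v"
      using 4 p q assms(3) by (auto simp: transpose_def)
    ultimately have "cycle3 u w v \<in> H" by simp
    then have "cycle3 v w u \<in> H" using invc by blast
    then show ?thesis using assms(3) by (simp only: cycle3_rotate)
  qed
qed

text \<open>Criterion for the class of a hub \<open>x\<close> to be stable under a generator
  \<open>f\<close>: \<open>f z\<close> is linked to both \<open>f x\<close> and \<open>f y\<close>,
  and one of these is still \<open>x\<close> or \<open>y\<close>. So it suffices to find a linked
  pair of which each generator fixes at least one point.\<close>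

lemma linked_closed:
  assumes "f \<in> H" "linked x y" "f x = x \<or> f y = y" "linked x z"
  shows "linked x (f z)"
proof (cases "f x = x")
  case True
  then show ?thesis using linked_map[OF assms(1,4)] by simp
next
  case False
  then have "linked y (f z)"
    using linked_map[OF assms(1) linked_trans[OF linked_sym[OF assms(2)] assms(4)]] assms(3) by simp
  then show ?thesis using linked_trans assms(2) by blast
qed

lemma even_mem_if_linked:
  assumes "finite B" "\<And>u v. u \<in> B \<Longrightarrow> v \<in> B \<Longrightarrow> linked u v"
    and "p permutes B" "evenperm p"
  shows "p \<in> H"
  using assms
proof (induction "card B" arbitrary: B p rule: less_induct)
  case less
  have perm: "permutation p" using less.prems permutation_permutes by blast
  show ?case
  proof (cases "p = id")
    case True
    then show ?thesis using id_mem by simp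
  next
    case False
    then obtain b where b: "p b \<noteq> b" by (auto simp: fun_eq_iff)
    have inj: "p x = p y \<longleftrightarrow> x = y" for x y
      using permutes_inj[OF less.prems(3)] by (simp add: inj_eq)
    have B: "b \<in> B" "p b \<in> B"
      using b permutes_not_in[OF less.prems(3)] permutes_in_image[OF less.prems(3)] by auto
    \<comment> \<open>Without a third point \<open>p\<close> would be a single transposition, which
      is odd. The 3-cycle \<open>t\<close> built from it sends \<open>p b\<close> back to
      \<open>b\<close>, so that \<open>t \<circ> p\<close> no longer moves \<open>b\<close>.\<close>
    have "\<exists>d\<in>B. d \<noteq> b \<and> d \<noteq> p b"
    proof (rule ccontr)
      assume "\<not> ?thesis"
      then have "B = {b, p b}" using B by auto
      then have "p permutes {b, p b}" using less.prems(3) by metis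
      then have "p = transpose b (p b)"
        using b permutes_doubleton_iff[of p b "p b"] by auto
      then have "evenperm (transpose b (p b))" using less.prems(4) by metis
      then show False using b evenperm_swap[of b "p b"] by simp
    qed
    then obtain d where d: "d \<in> B" "d \<noteq> b" "d \<noteq> p b" by blast
    define t where "t = cycle3 (p b) b d"
    have tH: "t \<in> H"
      unfolding t_def using d b B by (intro cycle3_mem_if_linked less.prems) auto
    have tp: "t permutes B"
      unfolding t_def using d B by (intro permutes_compose permutes_swap_id) auto
    have "t \<circ> p \<in> H"
    proof (rule less.hyps)
      show "card (B - {b}) < card B" using less.prems(1) B(1) by (rule card_Diff1_less)
      show "finite (B - {b})" using less.prems by simp
      show "linked u v" if "u \<in> B - {b}" "v \<in> B - {b}" for u v using that less.prems by auto
      have "(t \<circ> p) b = b" using b d by (auto simp: t_def transpose_def)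
      then show "(t \<circ> p) permutes (B - {b})"
        by (intro permutes_superset[OF permutes_compose[OF less.prems(3) tp]]) auto
      have "permutation t" "evenperm t"
        using b d by (auto simp: t_def evenperm_comp permutation_swap_id evenperm_swap permutation_compose)
      then show "evenperm (t \<circ> p)" using perm less.prems(4) by (simp add: evenperm_comp)
    qed
    then show ?thesis using comp_cancel_left tH by blast
  qed
qed

end

section \<open>The labelled graph\<close>

text \<open>The right-hand side determines \<open>w\<close> from \<open>v\<close>, so the assumption
  contains the disjointness of the edges with label \<open>k\<close> and makes the
  \<open>THE\<close> in \<open>lg_perm\<close> well defined.\<close>

lemma lg_perm_eqI:
  assumes "\<And>v w. ((k, v, w) \<in> E \<or> (k, w, v) \<in> E) \<longleftrightarrow> v \<noteq> w \<and> f v = w"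
  shows "lg_perm E k = f"
  unfolding lg_perm_def assms by (auto simp: fun_eq_iff)

text \<open>Labels 0 and 1 on a terminal-1 path with vertices 1 to \<open>a\<close>. The edge
  between \<open>x - 1\<close> and \<open>x\<close> has label 1 iff \<open>a - (x - 1)\<close> is
  odd, that is, iff \<open>a - x\<close> is even; hence the test decides whether label
  \<open>k\<close> leads down or up.\<close>

definition path_step :: "nat \<Rightarrow> nat \<Rightarrow> nat \<Rightarrow> nat" where
  "path_step k a x =
     (if even (a - x) \<longleftrightarrow> k = 1 then (if 1 < x then x - 1 else x) else (if x < a then x + 1 else x))"

locale thm41 =
  fixes i r :: nat
  assumes i: "1 \<le> i" and r: "6 \<le> r"
begin

abbreviation n :: nat where "n \<equiv> 2 * (i + r)"

definition rho :: "nat \<Rightarrow> nat \<Rightarrow> nat" ("\<rho>") where "\<rho> = thm41_rho n r"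

lemma mem_edges_iff:
  "(k, v, w) \<in> thm41_edges n r \<longleftrightarrow>
     (w = v + 1 \<and> (1 \<le> v \<and> v < i + 4 \<and> k = (if odd (i + 4 - v) then 1 else 0) \<or>
        i + r + 3 \<le> v \<and> v < 2 * i + r + 2 \<and> k = (if odd (2 * i + r + 2 - v) then 1 else 0) \<or>
        2 \<le> k \<and> k < r \<and> (v = i + k + 2 \<or> v = 2 * i + r + k)) \<or>
      k = r - 3 \<and> (v = i + r + 1 \<and> w = n - 1 \<or> v = i + r + 2 \<and> w = n))"
proof -
  have i_eq: "n div 2 - r = i" by simp
  have A: "(k, v, w) \<in> term1_path (\<lambda>j. j) (i + 4) \<longleftrightarrow>
      w = v + 1 \<and> 1 \<le> v \<and> v < i + 4 \<and> k = (if odd (i + 4 - v) then 1 else 0)"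
    unfolding term1_path_def by blast
  have B: "(k, v, w) \<in> term1_path (\<lambda>j. i + r + 2 + j) i \<longleftrightarrow>
      w = v + 1 \<and> i + r + 3 \<le> v \<and> v < 2 * i + r + 2 \<and>
      k = (if odd (2 * i + r + 2 - v) then 1 else 0)" (is "?L \<longleftrightarrow> ?R")
  proof
    assume ?R
    moreover define s where "s = v - (i + r + 2)"
    ultimately have "v = i + r + 2 + s" "w = i + r + 2 + (s + 1)" "1 \<le> s" "s < i"
      "k = (if odd (i - s) then 1 else 0)" by auto
    then show ?L unfolding term1_path_def by blast
  qed (auto simp: term1_path_def)
  have C: "(k, v, w) \<in> {(k, i + k + 2, i + k + 3) | k. 2 \<le> k \<and> k \<le> r - 1} \<longleftrightarrow>
      w = v + 1 \<and> 2 \<le> k \<and> k < r \<and> v = i + k + 2"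
    using r by auto
  have D: "(k, v, w) \<in> {(k, i + r + 2 + (i + k - 2), i + r + 2 + (i + k - 1)) | k. 2 \<le> k \<and> k \<le> r - 1}
      \<longleftrightarrow> w = v + 1 \<and> 2 \<le> k \<and> k < r \<and> v = 2 * i + r + k"
    using r by auto
  have E: "(k, v, w) \<in> {(r - 3, i + r + 1, i + r + 2 + (i + r - 3)), (r - 3, i + r + 2, i + r + 2 + (i + r - 2))}
      \<longleftrightarrow> k = r - 3 \<and> (v = i + r + 1 \<and> w = n - 1 \<or> v = i + r + 2 \<and> w = n)"
  proof -
    have "i + r + 2 + (i + r - 3) = n - 1" "i + r + 2 + (i + r - 2) = n" using r by auto
    then show ?thesis by (simp only: insert_iff empty_iff prod.inject) blast
  qed
  show ?thesis
    unfolding thm41_edges_def Let_def i_eq Un_iff A B C D E by blast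
qed

lemma rho_path:
  assumes "k < 2"
  shows "\<rho> k x = (if 1 \<le> x \<and> x \<le> i + 4 then path_step k (i + 4) x
    else if i + r + 3 \<le> x \<and> x \<le> 2 * i + r + 2 then i + r + 2 + path_step k i (x - (i + r + 2))
    else x)" (is "_ = ?f x")
proof -
  have E: "(k, v, w) \<in> thm41_edges n r \<longleftrightarrow> w = v + 1 \<and>
      (1 \<le> v \<and> v < i + 4 \<and> (odd (i + 4 - v) \<longleftrightarrow> k = 1) \<or>
       i + r + 3 \<le> v \<and> v < 2 * i + r + 2 \<and> (odd (2 * i + r + 2 - v) \<longleftrightarrow> k = 1))" for v w
    using assms r unfolding mem_edges_iff by auto
  have sub: "i - (v - (i + r + 2)) = 2 * i + r + 2 - v" if "i + r + 3 \<le> v" for v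
    using that by simp
  have "\<rho> k = ?f"
    unfolding rho_def thm41_rho_def
  proof (rule lg_perm_eqI, unfold E)
    fix v w
    have "i + 4 - w = Suc (i + 4 - v)" if "v = w + 1" "w < i + 4" using that by simp
    then have odd1: "odd (i + 4 - w) \<longleftrightarrow> even (i + 4 - v)" if "v = w + 1" "w < i + 4"
      using that by (metis even_Suc)
    have "2 * i + r + 2 - w = Suc (2 * i + r + 2 - v)" if "v = w + 1" "w < 2 * i + r + 2" using that by simp
    then have odd2: "odd (2 * i + r + 2 - w) \<longleftrightarrow> even (2 * i + r + 2 - v)" if "v = w + 1" "w < 2 * i + r + 2"
      using that by (metis even_Suc)
    define p1 p2 where "p1 \<longleftrightarrow> even (i + 4 - v)" and "p2 \<longleftrightarrow> even (2 * i + r + 2 - v)"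
    consider "1 \<le> v \<and> v \<le> i + 4" | "i + r + 3 \<le> v \<and> v \<le> 2 * i + r + 2"
      | "\<not> (1 \<le> v \<and> v \<le> i + 4)" "\<not> (i + r + 3 \<le> v \<and> v \<le> 2 * i + r + 2)" by blast
    then show "(w = v + 1 \<and>
      (1 \<le> v \<and> v < i + 4 \<and> (odd (i + 4 - v) \<longleftrightarrow> k = 1) \<or>
       i + r + 3 \<le> v \<and> v < 2 * i + r + 2 \<and> (odd (2 * i + r + 2 - v) \<longleftrightarrow> k = 1)) \<or>
      v = w + 1 \<and>
      (1 \<le> w \<and> w < i + 4 \<and> (odd (i + 4 - w) \<longleftrightarrow> k = 1) \<or>
       i + r + 3 \<le> w \<and> w < 2 * i + r + 2 \<and> (odd (2 * i + r + 2 - w) \<longleftrightarrow> k = 1)))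
      \<longleftrightarrow> v \<noteq> w \<and> ?f v = w" (is "?L \<longleftrightarrow> _")
    proof cases
      case 1
      have f: "?f v = path_step k (i + 4) v" using 1 by simp
      define b where "b \<longleftrightarrow> (p1 \<longleftrightarrow> k = 1)"
      have "\<not> i + r + 3 \<le> v" "v = w + 1 \<Longrightarrow> \<not> i + r + 3 \<le> w" using 1 r by auto
      then have L: "?L \<longleftrightarrow> (w = v + 1 \<and> 1 \<le> v \<and> v < i + 4 \<and> \<not> b) \<or> (v = w + 1 \<and> 1 \<le> w \<and> w < i + 4 \<and> b)"
        using odd1 unfolding b_def p1_def by blast
      have P: "path_step k (i + 4) v = (if b then (if 1 < v then v - 1 else v) else (if v < i + 4 then v + 1 else v))"
        unfolding path_step_def b_def p1_def ..
      show ?thesis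
        unfolding f L P using 1 by (cases b) (simp, arith)+
    next
      case 2
      have f: "?f v = i + r + 2 + path_step k i (v - (i + r + 2))" using 2 r by simp
      define b where "b \<longleftrightarrow> (p2 \<longleftrightarrow> k = 1)"
      have "\<not> v < i + 4" "v = w + 1 \<Longrightarrow> \<not> w < i + 4" using 2 r by auto
      then have L: "?L \<longleftrightarrow> (w = v + 1 \<and> i + r + 3 \<le> v \<and> v < 2 * i + r + 2 \<and> \<not> b) \<or>
          (v = w + 1 \<and> i + r + 3 \<le> w \<and> w < 2 * i + r + 2 \<and> b)"
        using odd2 unfolding b_def p2_def by blast
      have P: "path_step k i (v - (i + r + 2)) = (if b
          then (if 1 < v - (i + r + 2) then v - (i + r + 2) - 1 else v - (i + r + 2))
          else (if v - (i + r + 2) < i then v - (i + r + 2) + 1 else v - (i + r + 2)))"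
        unfolding path_step_def b_def p2_def using sub 2 by auto
      obtain x where x: "v = i + r + 2 + x" "1 \<le> x" "x \<le> i"
        using 2 by (intro that[of "v - (i + r + 2)"]) auto
      have "v - (i + r + 2) = x" using x by simp
      then show ?thesis
        unfolding f unfolding L P using x(2,3) by (cases b) (auto simp: x(1))
    next
      case 3
      then have f: "?f v = v" by auto
      show ?thesis unfolding f using 3 by auto
    qed
  qed
  then show ?thesis by simp
qed

lemma mem_edges_iff_tail:
  assumes "2 \<le> k" "k < r"
  shows "(k, v, w) \<in> thm41_edges n r \<longleftrightarrow>
    (w = v + 1 \<and> (v = i + k + 2 \<or> v = 2 * i + r + k)) \<or>
      k = r - 3 \<and> (v = i + r + 1 \<and> w = n - 1 \<or> v = i + r + 2 \<and> w = n)"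
proof -
  have "k \<noteq> (if b then 1 else 0)" for b using assms by auto
  then show ?thesis unfolding mem_edges_iff using assms by blast
qed

lemma rho_tail:
  assumes "2 \<le> k" "k < r" "k \<noteq> r - 3"
  shows "\<rho> k = transpose (i + k + 2) (i + k + 3) \<circ> transpose (2 * i + r + k) (2 * i + r + k + 1)"
proof -
  have "(k, v, w) \<in> thm41_edges n r \<longleftrightarrow> w = v + 1 \<and> (v = i + k + 2 \<or> v = 2 * i + r + k)" for v w
    using assms mem_edges_iff_tail by blast
  then show ?thesis
    unfolding rho_def thm41_rho_def using i r by (intro lg_perm_eqI) (simp add: transpose_def, arith)
qed

lemma rho_bridge:
  "\<rho> (r - 3) = transpose (i + r - 1) (i + r) \<circ> transpose (n - 3) (n - 2)
     \<circ> (transpose (i + r + 1) (n - 1) \<circ> transpose (i + r + 2) n)"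
proof -
  \<comment> \<open>With this substitution, possible by \<open>1 \<le> i\<close> and
    \<open>6 \<le> r\<close>, all vertex numbers at the bridge become sums without natural
    subtraction.\<close>
  obtain m where m: "i + r = m + 7"
    using i r by (intro that[of "i + r - 7"]) simp
  have e: "i + (r - 3) + 2 = m + 6" "2 * i + r + (r - 3) = 2 * m + 11" "i + r + 1 = m + 8"
    "i + r + 2 = m + 9"
    using m r by linarith+
  have e': "n - 1 = 2 * m + 13" "n = 2 * m + 14"
    by (simp_all add: m)
  have "2 \<le> r - 3" "r - 3 < r" using r by auto
  then have "(r - 3, v, w) \<in> thm41_edges n r \<longleftrightarrow> (v = m + 6 \<and> w = m + 7) \<or>
      (v = 2 * m + 11 \<and> w = 2 * m + 12) \<or> (v = m + 8 \<and> w = 2 * m + 13) \<or> (v = m + 9 \<and> w = 2 * m + 14)" for v w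
    using mem_edges_iff_tail[of "r - 3" v w] unfolding e e' by auto
  then have "(r - 3, v, w) \<in> thm41_edges n r \<or> (r - 3, w, v) \<in> thm41_edges n r \<longleftrightarrow>
      {v, w} \<in> {{m + 6, m + 7}, {2 * m + 11, 2 * m + 12}, {m + 8, 2 * m + 13}, {m + 9, 2 * m + 14}}" for v w
    unfolding insert_iff empty_iff doubleton_eq_iff by blast
  moreover have "{v, w} \<in> {{m + 6, m + 7}, {2 * m + 11, 2 * m + 12}, {m + 8, 2 * m + 13}, {m + 9, 2 * m + 14}}
      \<longleftrightarrow> v \<noteq> w \<and> (transpose (m + 7 - 1) (m + 7) \<circ> transpose (2 * (m + 7) - 3) (2 * (m + 7) - 2)
     \<circ> (transpose (m + 7 + 1) (2 * (m + 7) - 1) \<circ> transpose (m + 7 + 2) (2 * (m + 7)))) v = w" for v w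
  proof -
    have e: "m + 7 - 1 = m + 6" "m + 7 + 1 = m + 8" "m + 7 + 2 = m + 9" "2 * (m + 7) - 3 = 2 * m + 11"
      "2 * (m + 7) - 2 = 2 * m + 12" "2 * (m + 7) - 1 = 2 * m + 13" "2 * (m + 7) = 2 * m + 14" by auto
    show ?thesis
    proof (cases "v \<in> {m + 6, m + 7, 2 * m + 11, 2 * m + 12, m + 8, 2 * m + 13, m + 9, 2 * m + 14}")
      case True
      then show ?thesis
        unfolding e
        by (elim insertE; simp add: transpose_def doubleton_eq_iff eq_commute[of _ w]; arith)
    next
      case False
      then show ?thesis unfolding e by (auto simp: doubleton_eq_iff)
    qed
  qed
  ultimately show ?thesis
    unfolding rho_def thm41_rho_def m by (intro lg_perm_eqI) simp
qed

lemma rho_bridge':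
  assumes "r = s + 6"
  shows "\<rho> (s + 3) = transpose (i + s + 5) (i + s + 6) \<circ> transpose (2 * i + 2 * s + 9) (2 * i + 2 * s + 10)
    \<circ> (transpose (i + s + 7) (2 * i + 2 * s + 11) \<circ> transpose (i + s + 8) (2 * i + 2 * s + 12))"
  using rho_bridge by (simp add: assms algebra_simps eval_nat_numeral)

text \<open>For \<open>k\<close> at least 2, label \<open>k\<close> joins \<open>A k\<close> to
  \<open>A (Suc k)\<close> on the t-side and \<open>B k\<close> to \<open>B (Suc k)\<close> on the
  s-side: \<open>A j\<close> encodes the t-vertex with index \<open>i + j + 2\<close>, and
  \<open>B j\<close> the s-vertex with index \<open>i + j - 2\<close>.\<close>

abbreviation A :: "nat \<Rightarrow> nat" where "A j \<equiv> i + j + 2"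
abbreviation B :: "nat \<Rightarrow> nat" where "B j \<equiv> 2 * i + r + j"

lemma rho_A:
  assumes "2 \<le> k" "k < r" "2 \<le> j" "j \<le> r"
  shows "\<rho> k (A j) = (if k = r - 3 \<and> r - 1 \<le> j then B j else A (transpose k (Suc k) j))"
proof (cases "k = r - 3")
  case True
  obtain s where s: "r = s + 6" using r by (metis add.commute le_Suc_ex)
  then have k: "k = s + 3" using True by simp
  have "j = s + 3 \<or> j = s + 4 \<or> j = s + 5 \<or> j = s + 6 \<or> j < s + 3" using assms s by linarith
  then show ?thesis
    unfolding k rho_bridge'[OF s] using i assms(3) by (elim disjE; simp add: transpose_def s)
next
  case False
  then show ?thesis unfolding rho_tail[OF assms(1,2) False] using i assms by (auto simp: transpose_def)
qed

lemma rho_B: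
  assumes "2 \<le> k" "k < r" "2 \<le> j" "j \<le> r"
  shows "\<rho> k (B j) = (if k = r - 3 \<and> r - 1 \<le> j then A j else B (transpose k (Suc k) j))"
proof (cases "k = r - 3")
  case True
  obtain s where s: "r = s + 6" using r by (metis add.commute le_Suc_ex)
  then have k: "k = s + 3" using True by simp
  have "j = s + 3 \<or> j = s + 4 \<or> j = s + 5 \<or> j = s + 6 \<or> j < s + 3" using assms s by linarith
  then show ?thesis
    unfolding k rho_bridge'[OF s] using i assms(3) by (elim disjE; simp add: transpose_def s)
next
  case False
  then show ?thesis unfolding rho_tail[OF assms(1,2) False] using i assms by (auto simp: transpose_def)
qed

lemma rho_outside:
  assumes "2 \<le> k" "k < r" "x \<notin> A ` {k..r}" "x \<notin> B ` {k..r}"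
  shows "\<rho> k x = x"
proof -
  have x: "x \<noteq> A j" "x \<noteq> B j" if "k \<le> j" "j \<le> r" for j using assms(3,4) that by auto
  show ?thesis
  proof (cases "k = r - 3")
    case True
    obtain s where s: "r = s + 6" using r by (metis add.commute le_Suc_ex)
    then have k: "k = s + 3" using True by simp
    have "x \<noteq> i + s + 5" "x \<noteq> 2 * i + 2 * s + 9" using x[of "s + 3"] by (simp_all add: s k)
    moreover have "x \<noteq> i + s + 6" "x \<noteq> 2 * i + 2 * s + 10" using x[of "s + 4"] by (simp_all add: s k)
    moreover have "x \<noteq> i + s + 7" "x \<noteq> 2 * i + 2 * s + 11" using x[of "s + 5"] by (simp_all add: s k)
    moreover have "x \<noteq> i + s + 8" "x \<noteq> 2 * i + 2 * s + 12" using x[of "s + 6"] by (simp_all add: s k)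
    ultimately show ?thesis unfolding k rho_bridge'[OF s] by (simp only: o_apply transpose_apply_other simp_thms)
  next
    case False
    have "x \<noteq> i + k + 2" "x \<noteq> i + k + 3" "x \<noteq> 2 * i + r + k" "x \<noteq> 2 * i + r + k + 1"
      using x[of k] x[of "Suc k"] assms(2) by simp_all
    then show ?thesis unfolding rho_tail[OF assms(1,2) False]
      by (simp only: o_apply transpose_apply_other simp_thms)
  qed
qed

lemma rho_1_A:
  assumes "1 \<le> j" "j \<le> r"
  shows "\<rho> (Suc 0) (A j) = A (transpose (Suc 0) 2 j)"
proof -
  have "j = Suc 0 \<or> j = 2 \<or> 2 < j" using assms by linarith
  then show ?thesis using i r assms
    by (elim disjE; simp add: rho_path[of 1, simplified] path_step_def)
qed

text \<open>The last assumption excludes \<open>i = 1\<close> with \<open>j \<le> 2\<close>: there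
  the s-path is the single vertex \<open>B 2\<close>, which label 1 fixes.\<close>

lemma rho_1_B:
  assumes "1 \<le> j" "j \<le> r" "2 \<le> i \<or> 3 \<le> j"
  shows "\<rho> (Suc 0) (B j) = B (transpose (Suc 0) 2 j)"
proof -
  have "j = Suc 0 \<or> j = 2 \<or> 2 < j" using assms by linarith
  then show ?thesis using i r assms
    by (elim disjE; simp add: rho_path[of 1, simplified] path_step_def)
qed

lemma rho_0_A: "2 \<le> j \<Longrightarrow> j \<le> r \<Longrightarrow> \<rho> 0 (A j) = A j"
  using i r by (simp add: rho_path[of 0, simplified] path_step_def)

lemma rho_0_B: "2 \<le> j \<Longrightarrow> j \<le> r \<Longrightarrow> \<rho> 0 (B j) = B j"
  using i r by (simp add: rho_path[of 0, simplified] path_step_def)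

end

section \<open>Parity of the generators on the two paths\<close>

primrec zigzag :: "(nat \<Rightarrow> nat) \<Rightarrow> nat \<Rightarrow> nat \<Rightarrow> nat \<Rightarrow> nat" where
  "zigzag v k 0 = id"
| "zigzag v k (Suc m) =
     (if 1 \<le> m \<and> (odd m \<longleftrightarrow> k = 1) then transpose (v (m - 1)) (v m) else id) \<circ> zigzag v k m"

lemma zigzag_outside: "x \<notin> v ` {..<m} \<Longrightarrow> zigzag v k m x = x"
proof (induction m)
  case (Suc m)
  then have "x \<noteq> v m" "1 \<le> m \<Longrightarrow> x \<noteq> v (m - 1)" by auto
  then show ?case using Suc by (auto simp: lessThan_Suc)
qed simp

text \<open>\<open>v 0\<close> is the terminal end of the path. Counted from this end the labels are
  1, 0, 1, ... whatever the length, so the generator grows by at most one transposition per vertex,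
  a form in which its parity can be followed.\<close>

lemma zigzag_apply:
  assumes "inj_on v {..<m}" "y < m"
  shows "zigzag v k m (v y) =
    v (if even y \<longleftrightarrow> k = 1 then (if Suc y < m then Suc y else y) else y - 1)"
  using assms
proof (induction m arbitrary: y)
  case (Suc m)
  have inj: "inj_on v {..<m}" using Suc.prems(1) by (rule inj_on_subset) auto
  have eq: "v a = v b \<longleftrightarrow> a = b" if "a < Suc m" "b < Suc m" for a b
    using inj_onD[OF Suc.prems(1)] that by auto
  show ?case
  proof (cases "y = m")
    case True
    have "v m \<notin> v ` {..<m}" using eq by auto
    then have "zigzag v k m (v y) = v m" unfolding True by (rule zigzag_outside)
    then show ?thesis using True by (cases m) auto
  next
    case False
    then have y: "y < m" using Suc.prems(2) by simp
    define z where "z = (if even y \<longleftrightarrow> k = 1 then (if Suc y < m then Suc y else y) else y - 1)"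
    have z: "zigzag v k m (v y) = v z" "z < m" using Suc.IH[OF inj y] y by (auto simp: z_def)
    have e: "v z \<noteq> v m" using eq[of z m] z by simp
    show ?thesis
    proof (cases "Suc y = m \<and> (even y \<longleftrightarrow> k = 1)")
      case True
      then have "z = m - 1" "odd m \<longleftrightarrow> k = 1" "1 \<le> m" by (auto simp: z_def)
      then show ?thesis using z True by auto
    next
      case F: False
      have "v z \<noteq> v (m - 1)" if "1 \<le> m" "odd m \<longleftrightarrow> k = 1"
      proof
        assume "v z = v (m - 1)"
        then have "z = m - 1" using eq[of z "m - 1"] z(2) by simp
        then show False using F y that unfolding z_def by (cases m) (auto split: if_splits)
      qed
      then have "zigzag v k (Suc m) (v y) = v z" using z e by auto
      moreover have "z = (if even y \<longleftrightarrow> k = 1 then (if Suc y < Suc m then Suc y else y) else y - 1)"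
        using F y unfolding z_def by auto
      ultimately show ?thesis by simp
    qed
  qed
qed simp

lemma permutation_zigzag: "permutation (zigzag v k m)"
proof (induction m)
  case (Suc m)
  then show ?case
    unfolding zigzag.simps by (intro permutation_compose) (simp_all add: permutation_swap_id)
qed simp

lemma evenperm_zigzag_Suc:
  assumes "inj_on v {..<Suc m}"
  shows "evenperm (zigzag v k (Suc m)) \<longleftrightarrow>
    ((1 \<le> m \<and> (odd m \<longleftrightarrow> k = 1)) \<longleftrightarrow> \<not> evenperm (zigzag v k m))"
proof -
  have "1 \<le> m \<Longrightarrow> v (m - 1) \<noteq> v m" using inj_onD[OF assms, of "m - 1" m] by force
  moreover define C where "C \<longleftrightarrow> 1 \<le> m \<and> (odd m \<longleftrightarrow> k = 1)"
  ultimately have "C \<Longrightarrow> v (m - 1) \<noteq> v m" by blast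
  moreover have "zigzag v k (Suc m) = (if C then transpose (v (m - 1)) (v m) else id) \<circ> zigzag v k m"
    unfolding C_def zigzag.simps ..
  ultimately show ?thesis
    unfolding C_def[symmetric]
    by (cases C) (simp_all add: evenperm_comp permutation_zigzag permutation_swap_id evenperm_swap del: zigzag.simps)
qed

lemma evenperm_zigzag_inj:
  "inj_on v {..<m} \<Longrightarrow> inj_on w {..<m} \<Longrightarrow> evenperm (zigzag v k m) \<longleftrightarrow> evenperm (zigzag w k m)"
proof (induction m)
  case (Suc m)
  have "{..<m} \<subseteq> {..<Suc m}" by auto
  then have "evenperm (zigzag v k m) \<longleftrightarrow> evenperm (zigzag w k m)"
    by (rule Suc.IH[OF inj_on_subset[OF Suc.prems(1)] inj_on_subset[OF Suc.prems(2)]]) simp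
  then show ?case
    by (simp only: evenperm_zigzag_Suc[OF Suc.prems(1)] evenperm_zigzag_Suc[OF Suc.prems(2)])
qed simp

text \<open>Four more vertices bring two more edges of each label; from the empty path there would
  be only three edges, hence \<open>1 \<le> m\<close>. This compares the paths with
  \<open>i + 4\<close> and \<open>i\<close> vertices.\<close>

lemma evenperm_zigzag_add_4:
  assumes "inj_on v {..<m + 4}" "1 \<le> m"
  shows "evenperm (zigzag v k (m + 4)) \<longleftrightarrow> evenperm (zigzag v k m)"
proof -
  have "inj_on v {..<Suc m}" "inj_on v {..<Suc (Suc m)}" "inj_on v {..<Suc (Suc (Suc m))}"
    "inj_on v {..<Suc (Suc (Suc (Suc m)))}"
    using assms(1) by (auto intro: inj_on_subset)
  note e = this[THEN evenperm_zigzag_Suc]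
  have "m + 4 = Suc (Suc (Suc (Suc m)))" by simp
  then show ?thesis using assms(2) by (simp only: e) auto
qed

lemma path_step_range:
  assumes "1 \<le> x" "x \<le> a"
  shows "1 \<le> path_step k a x \<and> path_step k a x \<le> a"
proof -
  have "1 \<le> (if b then (if 1 < x then x - 1 else x) else (if x < a then x + 1 else x)) \<and>
      (if b then (if 1 < x then x - 1 else x) else (if x < a then x + 1 else x)) \<le> a" for b
    using assms by (cases b) auto
  then show ?thesis unfolding path_step_def by blast
qed

lemma path_step_diff:
  assumes "y < a"
  shows "path_step k a (a - y) =
    a - (if even y \<longleftrightarrow> k = 1 then (if Suc y < a then Suc y else y) else y - 1)"
proof -
  have "(if b then (if 1 < a - y then a - y - 1 else a - y) else (if a - y < a then a - y + 1 else a - y))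
      = a - (if b then (if Suc y < a then Suc y else y) else y - 1)" for b
    using assms by (cases b) auto
  moreover have "a - (a - y) = y" using assms by simp
  ultimately show ?thesis unfolding path_step_def by simp
qed

lemma path_step_involution:
  assumes "1 \<le> x" "x \<le> a"
  shows "path_step k a (path_step k a x) = x"
proof (cases "even (a - x) \<longleftrightarrow> k = 1")
  case True
  show ?thesis
  proof (cases "x = 1")
    case False
    then have "a - (x - 1) = Suc (a - x)" "1 < x" using assms by auto
    then show ?thesis using True assms by (simp add: path_step_def)
  qed (use True in \<open>simp add: path_step_def\<close>)
next
  case False
  show ?thesis
  proof (cases "x = a")
    case x: False
    then have "a - x = Suc (a - (x + 1))" using assms by auto
    then show ?thesis using False x assms by (simp add: path_step_def)
  qed (use False in \<open>simp add: path_step_def\<close>)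
qed

lemma involution_permutes:
  assumes "\<And>x. f (f x) = x" "\<And>x. x \<notin> S \<Longrightarrow> f x = x"
  shows "f permutes S"
  unfolding permutes_def using assms by metis

section \<open>Coordinates by block and side\<close>

context thm41
begin

text \<open>The block is \<open>l\<close> and the side is \<open>b\<close>, with \<open>True\<close>
  for the t-side, so that reversing a block is negating \<open>b\<close>.\<close>

definition P :: "bool \<Rightarrow> nat \<Rightarrow> nat" where "P b l = (if b then i + l + 2 else 2 * i + r + l)"

text \<open>Block 1 has an s-point only for \<open>2 \<le> i\<close>; for \<open>i = 1\<close> the
  formula for \<open>P False 1\<close> would give the point \<open>P True r\<close>.\<close>

definition vert :: "bool \<Rightarrow> nat \<Rightarrow> bool" where "vert b l \<longleftrightarrow> 1 \<le> l \<and> l \<le> r \<and> (b \<or> 2 \<le> i \<or> 2 \<le> l)"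

lemma vertI: "2 \<le> l \<Longrightarrow> l \<le> r \<Longrightarrow> vert b l"
  by (simp add: vert_def)

lemma P_eq_iff:
  assumes "vert b l" "vert b' l'"
  shows "P b l = P b' l' \<longleftrightarrow> b = b' \<and> l = l'"
  using assms i r unfolding P_def vert_def by (cases b; cases b'; simp; linarith)

lemma P_bounds: "vert b l \<Longrightarrow> 1 \<le> P b l \<and> P b l \<le> n"
  using i unfolding P_def vert_def by auto

lemma transpose_Suc_range:
  assumes "2 \<le> l" "l \<le> r" "2 \<le> k" "k < r"
  shows "vert b (transpose k (Suc k) l)"
proof -
  consider "l = k" | "l = Suc k" | "l \<noteq> k" "l \<noteq> Suc k" by blast
  then show ?thesis using assms by cases (simp_all add: vert_def)
qed

text \<open>The inequality of truth values is exclusive or, so reversals add up under composition.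
  The reversal occurs only for the bridge label \<open>r - 3\<close> and the last two
  blocks.\<close>

lemma rho_P:
  assumes "2 \<le> k" "k < r" "vert b l"
  shows "\<rho> k (P b l) = P (b \<noteq> (k = r - 3 \<and> r - 1 \<le> l)) (transpose k (Suc k) l)"
proof (cases "2 \<le> l")
  case True
  then have l: "l \<le> r" using assms by (simp add: vert_def)
  have "k = r - 3 \<and> r - 1 \<le> l \<Longrightarrow> transpose k (Suc k) l = l" using r True by auto
  then show ?thesis
    using rho_A[OF assms(1,2) True l] rho_B[OF assms(1,2) True l] unfolding P_def by (cases b) auto
next
  case False
  then have l: "l = 1" "b \<or> 2 \<le> i" using assms by (auto simp: vert_def)
  have v: "vert b l" using assms by simp
  have "P b l \<noteq> P True j" "P b l \<noteq> P False j" if "k \<le> j" "j \<le> r" for j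
    using P_eq_iff[OF v vertI[of j]] that assms(1) l by auto
  then have "P b l \<noteq> A j" "P b l \<noteq> B j" if "k \<le> j" "j \<le> r" for j
    using that by (simp_all add: P_def[of True] P_def[of False])
  then have "P b l \<notin> A ` {k..r}" "P b l \<notin> B ` {k..r}" unfolding image_iff Bex_def atLeastAtMost_iff by blast+
  then have "\<rho> k (P b l) = P b l" by (rule rho_outside[OF assms(1,2)])
  moreover have "transpose k (Suc k) l = l" "\<not> r - 1 \<le> l" using l assms r by auto
  ultimately show ?thesis by simp
qed

lemma rho_1_P:
  assumes "vert b l" "b \<or> 2 \<le> i \<or> 3 \<le> l"
  shows "\<rho> (Suc 0) (P b l) = P b (transpose (Suc 0) 2 l)"
  using rho_1_A[of l] rho_1_B[of l] assms unfolding P_def vert_def by (cases b) auto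

lemma rho_0_P: "2 \<le> l \<Longrightarrow> l \<le> r \<Longrightarrow> \<rho> 0 (P b l) = P b l"
  using rho_0_A rho_0_B by (simp add: P_def)

lemma rho_fixes:
  assumes "2 \<le> k" "k < r" "\<And>b l. k \<le> l \<Longrightarrow> l \<le> r \<Longrightarrow> x \<noteq> P b l"
  shows "\<rho> k x = x"
proof (rule rho_outside[OF assms(1,2)])
  have "x \<noteq> A l" "x \<noteq> B l" if "k \<le> l" "l \<le> r" for l
    using assms(3)[OF that, of True] assms(3)[OF that, of False] by (simp_all add: P_def)
  then show "x \<notin> A ` {k..r}" "x \<notin> B ` {k..r}" unfolding image_iff Bex_def atLeastAtMost_iff by blast+
qed

lemma rho_involution:
  assumes "k < r"
  shows "\<rho> k (\<rho> k x) = x"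
proof (cases "k < 2")
  case True
  consider "1 \<le> x \<and> x \<le> i + 4" | "i + r + 3 \<le> x \<and> x \<le> 2 * i + r + 2"
    | "\<not> (1 \<le> x \<and> x \<le> i + 4)" "\<not> (i + r + 3 \<le> x \<and> x \<le> 2 * i + r + 2)" by blast
  then show ?thesis
  proof cases
    case 1
    then show ?thesis
      using path_step_range[of x "i + 4" k] path_step_involution[of x "i + 4" k] by (simp add: rho_path[OF True])
  next
    case 2
    define y where "y = x - (i + r + 2)"
    have y: "x = i + r + 2 + y" "1 \<le> y" "y \<le> i" using 2 by (auto simp: y_def)
    then show ?thesis
      using path_step_range[of y i k] path_step_involution[of y i k] r by (simp add: rho_path[OF True])
  next
    case 3
    then have "\<rho> k x = x" by (simp only: rho_path[OF True] if_False)
    then show ?thesis by simp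
  qed
next
  case False
  then have k: "2 \<le> k" by simp
  show ?thesis
  proof (cases "\<exists>b l. 2 \<le> l \<and> l \<le> r \<and> x = P b l")
    case True
    then obtain b l where l: "2 \<le> l" "l \<le> r" "x = P b l" by blast
    have "k = r - 3 \<Longrightarrow> r - 1 \<le> transpose k (Suc k) l \<longleftrightarrow> r - 1 \<le> l"
      using r l by (auto simp: transpose_def)
    moreover define c where "c \<longleftrightarrow> k = r - 3 \<and> r - 1 \<le> l"
    ultimately have c: "(k = r - 3 \<and> r - 1 \<le> transpose k (Suc k) l) = c" by blast
    have "\<rho> k x = P (b \<noteq> c) (transpose k (Suc k) l)"
      unfolding l(3) c_def by (rule rho_P[OF k assms vertI[OF l(1,2)]])
    moreover have "\<rho> k (P (b \<noteq> c) (transpose k (Suc k) l)) = P ((b \<noteq> c) \<noteq> c) l"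
      using rho_P[OF k assms transpose_Suc_range[OF l(1,2) k assms], of "b \<noteq> c"] unfolding c by simp
    ultimately show ?thesis using l(3) by (cases c) simp_all
  next
    case False
    then have "\<rho> k x = x" by (intro rho_fixes[OF k assms]) (use k in auto)
    then show ?thesis by simp
  qed
qed

lemma rho_outside_range:
  assumes "k < r" "x \<notin> {1..n}"
  shows "\<rho> k x = x"
proof (cases "k < 2")
  case True
  have "\<not> (1 \<le> x \<and> x \<le> i + 4)" "\<not> (i + r + 3 \<le> x \<and> x \<le> 2 * i + r + 2)" using assms r by auto
  then show ?thesis by (simp only: rho_path[OF True] if_False)
next
  case False
  show ?thesis
    by (rule rho_fixes) (use False assms P_bounds vertI in \<open>auto dest!: P_bounds[OF vertI]\<close>)
qed

lemma rho_permutes: "k < r \<Longrightarrow> \<rho> k permutes {1..n}"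
  by (rule involution_permutes) (simp_all add: rho_involution rho_outside_range)

lemma rho_eq_iff: "k < r \<Longrightarrow> \<rho> k x = \<rho> k y \<longleftrightarrow> x = y"
  by (metis rho_involution)

lemma rho_comp_self: "k < r \<Longrightarrow> \<rho> k \<circ> \<rho> k = id"
  by (simp add: fun_eq_iff rho_involution)

lemma rho_path_zigzag:
  assumes "k < 2"
  shows "\<rho> k = zigzag (\<lambda>y. i + 4 - y) k (i + 4) \<circ> zigzag (\<lambda>y. 2 * i + r + 2 - y) k i" (is "_ = ?f \<circ> ?g")
proof
  fix x
  have injf: "inj_on (\<lambda>y. i + 4 - y) {..<i + 4}" and injg: "inj_on (\<lambda>y. 2 * i + r + 2 - y) {..<i}"
    by (auto intro!: inj_onI)
  have imf: "z \<notin> (\<lambda>y. i + 4 - y) ` {..<i + 4}" if "\<not> (1 \<le> z \<and> z \<le> i + 4)" for z using that by auto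
  have img: "z \<notin> (\<lambda>y. 2 * i + r + 2 - y) ` {..<i}" if "\<not> (i + r + 3 \<le> z \<and> z \<le> 2 * i + r + 2)" for z using that by auto
  consider "1 \<le> x \<and> x \<le> i + 4" | "i + r + 3 \<le> x \<and> x \<le> 2 * i + r + 2"
    | "\<not> (1 \<le> x \<and> x \<le> i + 4)" "\<not> (i + r + 3 \<le> x \<and> x \<le> 2 * i + r + 2)" by blast
  then show "\<rho> k x = (?f \<circ> ?g) x"
  proof cases
    case 1
    then have "\<not> (i + r + 3 \<le> x \<and> x \<le> 2 * i + r + 2)" using r by auto
    then have g: "?g x = x" by (intro zigzag_outside img)
    define y where "y = i + 4 - x"
    have y: "x = i + 4 - y" "y < i + 4" using 1 by (auto simp: y_def)
    have "?f x = i + 4 - (if even y \<longleftrightarrow> k = 1 then (if Suc y < i + 4 then Suc y else y) else y - 1)"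
      unfolding y(1) using zigzag_apply[OF injf y(2), of k] .
    also have "\<dots> = path_step k (i + 4) x"
      unfolding y(1) using path_step_diff[OF y(2)] by simp
    finally show ?thesis using g 1 by (simp add: rho_path[OF assms])
  next
    case 2
    define y where "y = 2 * i + r + 2 - x"
    have y: "x = 2 * i + r + 2 - y" "y < i" "x - (i + r + 2) = i - y" using 2 by (auto simp: y_def)
    define z where "z = (if even y \<longleftrightarrow> k = 1 then (if Suc y < i then Suc y else y) else y - 1)"
    have z: "z < i" using y(2) unfolding z_def by auto
    have "?g x = 2 * i + r + 2 - z"
      unfolding y(1) z_def using zigzag_apply[OF injg y(2), of k] .
    moreover have "path_step k i (x - (i + r + 2)) = i - z"
      unfolding y(3) z_def by (rule path_step_diff[OF y(2)])
    ultimately have g: "?g x = i + r + 2 + path_step k i (x - (i + r + 2))" using z by simp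
    have "1 \<le> path_step k i (x - (i + r + 2))" using path_step_range[of "x - (i + r + 2)" i k] 2 by auto
    then have "?f (?g x) = ?g x" unfolding g using r by (intro zigzag_outside imf) auto
    then show ?thesis using g 2 r by (simp add: rho_path[OF assms])
  next
    case 3
    then have "?g x = x" "?f x = x" by (auto intro!: zigzag_outside imf img simp del: One_nat_def)
    then show ?thesis using 3 by (simp only: rho_path[OF assms] if_False o_apply)
  qed
qed

text \<open>Labels from 2 on are products of two or four disjoint transpositions; for labels 0 and 1
  the two paths contribute equal parities.\<close>

lemma evenperm_rho:
  assumes "k < r"
  shows "evenperm (\<rho> k)"
proof (cases "k < 2")
  case True
  have injf: "inj_on (\<lambda>y. i + 4 - y) {..<i + 4}" and injg: "inj_on (\<lambda>y. 2 * i + r + 2 - y) {..<i}"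
    by (auto intro!: inj_onI)
  have "inj_on (\<lambda>y. i + 4 - y) {..<i}" using injf by (rule inj_on_subset) auto
  then show ?thesis
    unfolding rho_path_zigzag[OF True] evenperm_comp[OF permutation_zigzag permutation_zigzag]
      evenperm_zigzag_add_4[OF injf i] by (rule evenperm_zigzag_inj[OF _ injg])
next
  case False
  then have k: "2 \<le> k" by simp
  show ?thesis
  proof (cases "k = r - 3")
    case True
    obtain s where s: "r = s + 6" using r by (metis add.commute le_Suc_ex)
    then have k: "k = s + 3" using True by simp
    show ?thesis unfolding k rho_bridge'[OF s]
      by (simp add: evenperm_comp permutation_compose permutation_swap_id evenperm_swap)
  next
    case False
    show ?thesis unfolding rho_tail[OF k assms False]
      by (simp add: evenperm_comp permutation_swap_id evenperm_swap)
  qed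
qed

lemma rho_moves:
  assumes "1 \<le> k" "k < r"
  shows "\<rho> k (P True k) = P True (Suc k)"
proof (cases "k = 1")
  case True
  then show ?thesis using rho_1_P[of True 1] r by (simp add: vert_def numeral_2_eq_2)
next
  case False
  have "\<not> (k = r - 3 \<and> r - 1 \<le> k)" using r by auto
  then show ?thesis using False assms by (subst rho_P) (simp_all add: vert_def)
qed

lemma rho_0_moves: "\<rho> 0 (P True 1) \<noteq> P True 1"
  using i by (simp add: P_def rho_path[of 0, simplified] path_step_def)

text \<open>For \<open>j < 2\<close> the supports are disjoint. Otherwise they meet only for the
  labels \<open>r - 3\<close> and \<open>r - 1\<close>, where the second exchanges the two blocks
  that the first reverses.\<close>

lemma rho_commute:
  assumes "j + 2 \<le> k" "k < r"
  shows "\<rho> j \<circ> \<rho> k = \<rho> k \<circ> \<rho> j"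
proof -
  have jr: "j < r" using assms by simp
  have disj: "\<rho> j \<circ> \<rho> k = \<rho> k \<circ> \<rho> j" if *: "\<And>x. \<rho> k x \<noteq> x \<Longrightarrow> \<rho> j x = x"
  proof
    fix x
    show "(\<rho> j \<circ> \<rho> k) x = (\<rho> k \<circ> \<rho> j) x"
    proof (cases "\<rho> k x = x")
      case True
      then show ?thesis using *[of "\<rho> j x"] rho_involution[OF jr, of x] by (metis o_apply)
    next
      case False
      then have "\<rho> k (\<rho> k x) \<noteq> \<rho> k x" using rho_eq_iff[OF assms(2)] by simp
      then show ?thesis using *[OF False] *[of "\<rho> k x"] by simp
    qed
  qed
  have k: "2 \<le> k" using assms by simp
  show ?thesis
  proof (cases "j < 2")
    case True
    show ?thesis
    proof (rule disj)
      fix x assume "\<rho> k x \<noteq> x"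
      then obtain b l where l: "k \<le> l" "l \<le> r" "x = P b l" using rho_fixes[OF k assms(2)] by blast
      show "\<rho> j x = x"
      proof (cases "j = 0")
        case True
        then show ?thesis using l assms rho_0_P by simp
      next
        case False
        then have "j = Suc 0" "3 \<le> l" using \<open>j < 2\<close> assms l by auto
        then show ?thesis using l rho_1_P[of b l] by (simp add: vertI)
      qed
    qed
  next
    case False
    then have j: "2 \<le> j" by simp
    show ?thesis
    proof
      fix x
      show "(\<rho> j \<circ> \<rho> k) x = (\<rho> k \<circ> \<rho> j) x"
      proof (cases "\<exists>b l. 2 \<le> l \<and> l \<le> r \<and> x = P b l")
        case True
        then obtain b l where l: "2 \<le> l" "l \<le> r" "x = P b l" by blast
        have "transpose j (Suc j) (transpose k (Suc k) l) = transpose k (Suc k) (transpose j (Suc j) l)"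
          using assms(1) by (auto simp: transpose_def)
        moreover have "k = r - 3 \<Longrightarrow> r - 1 \<le> transpose j (Suc j) l \<longleftrightarrow> r - 1 \<le> l"
          using r l assms(1) by (auto simp: transpose_def)
        moreover have "j = r - 3 \<Longrightarrow> r - 1 \<le> transpose k (Suc k) l \<longleftrightarrow> r - 1 \<le> l"
          using r l assms by (auto simp: transpose_def)
        moreover define c d where "c \<longleftrightarrow> k = r - 3 \<and> r - 1 \<le> l" and "d \<longleftrightarrow> j = r - 3 \<and> r - 1 \<le> l"
        ultimately have c: "(k = r - 3 \<and> r - 1 \<le> transpose j (Suc j) l) = c"
            "(j = r - 3 \<and> r - 1 \<le> transpose k (Suc k) l) = d"
          and t: "transpose j (Suc j) (transpose k (Suc k) l) = transpose k (Suc k) (transpose j (Suc j) l)"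
          by blast+
        have "\<rho> j (\<rho> k x) = P ((b \<noteq> c) \<noteq> d) (transpose j (Suc j) (transpose k (Suc k) l))"
          using rho_P[OF k assms(2) vertI[OF l(1,2)], of b]
            rho_P[OF j jr transpose_Suc_range[OF l(1,2) k assms(2)], of "b \<noteq> c"]
          unfolding l(3) c c_def[symmetric] by simp
        moreover have "\<rho> k (\<rho> j x) = P ((b \<noteq> d) \<noteq> c) (transpose k (Suc k) (transpose j (Suc j) l))"
          using rho_P[OF j jr vertI[OF l(1,2)], of b]
            rho_P[OF k assms(2) transpose_Suc_range[OF l(1,2) j jr], of "b \<noteq> d"]
          unfolding l(3) c d_def[symmetric] by simp
        ultimately show ?thesis unfolding t by (cases c; cases d) simp_all
      next
        case False
        then have "\<rho> j x = x" "\<rho> k x = x"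
          by (intro rho_fixes[OF j jr] rho_fixes[OF k assms(2)]; use j k in auto)+
        then show ?thesis by simp
      qed
    qed
  qed
qed

end

section \<open>Parabolic subgroups\<close>

text \<open>Block permutations that act in the same way on both sides. The coordinates
  \<open>p\<close> are a parameter because the last four blocks will also be used with renamed
  points.\<close>

definition diagonal :: "(bool \<Rightarrow> nat \<Rightarrow> nat) \<Rightarrow> nat \<Rightarrow> nat \<Rightarrow> (nat \<Rightarrow> nat) \<Rightarrow> bool" where
  "diagonal p c m q \<longleftrightarrow> inj q \<and> (\<forall>l\<in>{c..m}. \<exists>l'\<in>{c..m}. \<forall>b. q (p b l) = p b l') \<and>
     (\<forall>x. (\<forall>b. \<forall>l\<in>{c..m}. x \<noteq> p b l) \<longrightarrow> q x = x)"

lemma diagonalI: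
  assumes "inj q" "\<And>l. l \<in> {c..m} \<Longrightarrow> \<exists>l'\<in>{c..m}. \<forall>b. q (p b l) = p b l'"
    "\<And>x. (\<And>b l. l \<in> {c..m} \<Longrightarrow> x \<noteq> p b l) \<Longrightarrow> q x = x"
  shows "diagonal p c m q"
  unfolding diagonal_def
proof (intro conjI ballI allI impI)
  show "q x = x" if "\<forall>b. \<forall>l\<in>{c..m}. x \<noteq> p b l" for x by (rule assms(3)) (use that in blast)
qed (use assms in auto)

lemma diagonal_inj: "diagonal p c m q \<Longrightarrow> inj q"
  unfolding diagonal_def by (elim conjE)

lemma diagonal_obtain:
  assumes "diagonal p c m q" "l \<in> {c..m}"
  obtains l' where "l' \<in> {c..m}" "\<forall>b. q (p b l) = p b l'"
proof -
  have "\<forall>l\<in>{c..m}. \<exists>l'\<in>{c..m}. \<forall>b. q (p b l) = p b l'"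
    using assms(1) unfolding diagonal_def by (elim conjE)
  then show thesis using assms(2) that by (elim ballE[of _ _ l] bexE) simp_all
qed

lemma diagonal_outside:
  assumes "diagonal p c m q" "\<And>b l. l \<in> {c..m} \<Longrightarrow> x \<noteq> p b l"
  shows "q x = x"
  using assms unfolding diagonal_def by simp

lemma diagonal_comp:
  assumes "diagonal p c m f" "diagonal p c m g"
  shows "diagonal p c m (f \<circ> g)"
proof (rule diagonalI)
  show "inj (f \<circ> g)" using assms[THEN diagonal_inj] by (rule inj_compose)
  show "\<exists>l'\<in>{c..m}. \<forall>b. (f \<circ> g) (p b l) = p b l'" if l: "l \<in> {c..m}" for l
  proof -
    obtain l' where l': "l' \<in> {c..m}" "\<forall>b. g (p b l) = p b l'" using diagonal_obtain[OF assms(2) l] .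
    obtain l'' where l'': "l'' \<in> {c..m}" "\<forall>b. f (p b l') = p b l''" using diagonal_obtain[OF assms(1) l'(1)] .
    show ?thesis using l'' by (intro bexI[of _ l'']) (simp_all add: l'(2))
  qed
  show "(f \<circ> g) x = x" if "\<And>b l. l \<in> {c..m} \<Longrightarrow> x \<noteq> p b l" for x
    using diagonal_outside[OF assms(1), of x] diagonal_outside[OF assms(2), of x] that by simp
qed

text \<open>It is enough to sort the points \<open>p True l\<close>: \<open>q\<close> uses the same
  target block for both sides, and \<open>inj_p\<close> recovers this block from a single
  point.\<close>

lemma (in permutation_subgroup) diagonal_mem:
  assumes inj_p: "\<And>b b' l l'. l \<in> {c..m} \<Longrightarrow> l' \<in> {c..m} \<Longrightarrow> p b l = p b' l' \<Longrightarrow> b = b' \<and> l = l'"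
    and \<sigma>: "\<And>k. c \<le> k \<Longrightarrow> k < m \<Longrightarrow> \<sigma> k \<in> H"
      "\<And>k b l. c \<le> k \<Longrightarrow> k < m \<Longrightarrow> l \<in> {c..m} \<Longrightarrow> \<sigma> k (p b l) = p b (transpose k (Suc k) l)"
      "\<And>k x. c \<le> k \<Longrightarrow> k < m \<Longrightarrow> \<forall>b. \<forall>l\<in>{c..m}. x \<noteq> p b l \<Longrightarrow> \<sigma> k x = x"
    and q: "diagonal p c m q"
  shows "q \<in> H"
proof (rule adjacent_swaps_reduction[where x = "p True" and c = c and m = m and Q = "diagonal p c m" and \<sigma> = \<sigma>])
  show "inj_on (p True) {c..m}" using inj_p by (intro inj_onI) blast
  show "diagonal p c m (\<sigma> k \<circ> q)" if k: "c \<le> k" "k < m" and "diagonal p c m q" for k q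
  proof (rule diagonal_comp)
    have "inj (\<sigma> k)" using bij[OF \<sigma>(1)[OF k]] by (rule bij_is_inj)
    moreover have "transpose k (Suc k) l \<in> {c..m}" if "l \<in> {c..m}" for l
      using that k by (cases "l = k"; cases "l = Suc k") auto
    ultimately show "diagonal p c m (\<sigma> k)"
      using \<sigma>(2,3)[OF k] by (intro diagonalI) (auto intro!: bexI[of _ "transpose k (Suc k) _"])
  qed fact
  show "q \<in> H" if "c \<le> k" "k < m" "\<sigma> k \<circ> q \<in> H" for k q
    using comp_cancel_left[OF \<sigma>(1)] that by blast
  show "q \<in> H" if d: "diagonal p c m q" and fx: "\<forall>j\<in>{c..m}. q (p True j) = p True j" for q
  proof -
    have "q x = x" for x
    proof (cases "\<exists>b. \<exists>l\<in>{c..m}. x = p b l")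
      case True
      then obtain b l where l: "l \<in> {c..m}" "x = p b l" by blast
      obtain l' where l': "l' \<in> {c..m}" "\<forall>b. q (p b l) = p b l'" using diagonal_obtain[OF d l(1)] .
      have "q (p True l) = p True l" "q (p True l) = p True l'" using fx l(1) l'(2) by blast+
      then have "p True l = p True l'" by (rule trans[OF sym])
      then have "l' = l" using inj_p[OF l(1) l'(1)] by blast
      then show ?thesis using l l' by simp
    next
      case False
      then show ?thesis using diagonal_outside[OF d] by blast
    qed
    then have "q = id" by auto
    then show ?thesis using id_mem by simp
  qed
  show "q ` p True ` {c..m} \<subseteq> p True ` {c..m}"
  proof (intro image_subsetI, elim imageE)
    fix y l assume l: "y = p True l" "l \<in> {c..m}"
    obtain l' where "l' \<in> {c..m}" "\<forall>b. q (p b l) = p b l'" using diagonal_obtain[OF q l(2)] .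
    then show "q y \<in> p True ` {c..m}" using l(1) by simp
  qed
qed (use \<sigma>(2) q in \<open>simp_all add: diagonal_def\<close>)

context thm41
begin

sublocale sym: group "sym_group n"
  by (rule sym_group_is_group)

sublocale string_generators "sym_group n" \<rho> r
proof
  show "\<rho> j \<in> carrier (sym_group n)" if "j < r" for j
    using rho_permutes[OF that] by (simp add: sym_group_carrier)
  show "\<rho> j \<otimes>\<^bsub>sym_group n\<^esub> \<rho> k = \<rho> k \<otimes>\<^bsub>sym_group n\<^esub> \<rho> j" if "j + 2 \<le> k" "k < r" for j k
    using rho_commute[OF that] by (simp add: sym_group_mult)
qed

lemma permutation_subgroup_par: "J \<subseteq> {..<r} \<Longrightarrow> permutation_subgroup (par J) n"
  unfolding permutation_subgroup_def by (rule par_subgroup)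

lemma rho_mem_par: "k \<in> J \<Longrightarrow> \<rho> k \<in> par J"
  by (intro generate.incl imageI)

text \<open>The generators are involutions, so inverses of generators are generators and need no
  case of their own.\<close>

lemma par_induct [consumes 2, case_names id rho comp]:
  assumes "g \<in> par J" "J \<subseteq> {..<r}" "\<Phi> id" "\<And>k. k \<in> J \<Longrightarrow> \<Phi> (\<rho> k)"
    "\<And>f g. \<Phi> f \<Longrightarrow> \<Phi> g \<Longrightarrow> \<Phi> (f \<circ> g)"
  shows "\<Phi> g"
  using assms(1)
proof induction
  case (inv h)
  then obtain k where k: "k \<in> J" "h = \<rho> k" by blast
  then have "k < r" using assms(2) by auto
  then have "inv\<^bsub>sym_group n\<^esub> h = h"
    unfolding k(2) using rho_closed[of k]
    by (intro sym.inv_equality) (simp_all only: sym_group_mult sym_group_one rho_comp_self)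
  then show ?case using k assms(4) by simp
next
  case one
  then show ?case using assms(3) by (simp only: sym_group_one)
next
  case (incl h)
  then show ?case using assms(4) by (elim imageE) (simp only:)
next
  case (eng f g)
  then show ?case using assms(5) by (simp only: sym_group_mult)
qed

lemma par_permutes:
  assumes "g \<in> par J" "J \<subseteq> {..<r}"
  shows "g permutes {1..n}" 
  using permutation_subgroup.permutes[OF permutation_subgroup_par[OF assms(2)] assms(1)] .

lemma par_inj: "g \<in> par J \<Longrightarrow> J \<subseteq> {..<r} \<Longrightarrow> inj g"
  using par_permutes permutes_inj by blast

lemma par_even:
  assumes "g \<in> par J" "J \<subseteq> {..<r}"
  shows "evenperm g"
proof -
  have "evenperm g \<and> permutation g"
    using assms
  proof (induction rule: par_induct)
    case (rho k)
    then have "k < r" using assms(2) by auto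
    then show ?case using evenperm_rho rho_permutes permutation_permutes by blast
  next
    case (comp f g)
    then show ?case using evenperm_comp permutation_compose by metis
  qed auto
  then show ?thesis by simp
qed

lemma P_le_iff: "vert b l \<Longrightarrow> P b l \<le> i + r + 2 \<longleftrightarrow> b"
  using i by (auto simp: P_def vert_def)

lemma rho_side:
  assumes "k < r - 3" "x \<le> i + r + 2"
  shows "\<rho> k x \<le> i + r + 2"
proof (cases "k < 2")
  case True
  show ?thesis
  proof (cases "1 \<le> x \<and> x \<le> i + 4")
    case c: True
    then have "\<rho> k x = path_step k (i + 4) x" by (simp add: rho_path[OF True])
    then show ?thesis using path_step_range[of x "i + 4" k] c r by simp
  next
    case False
    moreover have "\<not> (i + r + 3 \<le> x \<and> x \<le> 2 * i + r + 2)" using assms by simp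
    ultimately have "\<rho> k x = x" by (simp only: rho_path[OF True] if_False)
    then show ?thesis using assms by simp
  qed
next
  case False
  then have k: "2 \<le> k" "k < r" using assms by auto
  show ?thesis
  proof (cases "\<exists>b l. 2 \<le> l \<and> l \<le> r \<and> x = P b l")
    case True
    then obtain b l where l: "2 \<le> l" "l \<le> r" "x = P b l" by blast
    then have "\<rho> k x = P b (transpose k (Suc k) l)" using rho_P[OF k vertI[OF l(1,2)], of b] assms(1) by auto
    moreover have "b" using l assms(2) P_le_iff vertI by blast
    ultimately show ?thesis using P_le_iff[OF transpose_Suc_range[OF l(1,2) k]] by simp
  next
    case False
    then have "\<rho> k x = x" by (intro rho_fixes[OF k]) (use k in auto)
    then show ?thesis using assms by simp
  qed
qed

lemma par_fixes_P:
  assumes "g \<in> par {..d}" "1 \<le> d" "d \<le> r - 4" "d + 2 \<le> l" "l \<le> r"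
  shows "g (P b l) = P b l"
proof -
  have J: "{..d} \<subseteq> {..<r}" using assms by auto
  show ?thesis
    using assms(1) J
  proof (induction rule: par_induct)
    case (rho k)
    then consider "k = 0" | "k = 1" | "2 \<le> k" "k \<le> d" by fastforce
    then show ?case
    proof cases
      case 1
      then show ?thesis using rho_0_P assms by simp
    next
      case 2
      then show ?thesis using rho_1_P[of b l] assms by (simp add: vert_def)
    next
      case 3
      then have "k < r" "k \<noteq> r - 3" using assms r by auto
      moreover have "vert b l" using assms by (simp add: vert_def)
      ultimately show ?thesis using rho_P[of k b l] 3 assms by simp
    qed
  qed auto
qed

lemma par_side:
  assumes "g \<in> par {..d}" "d \<le> r - 4" "x \<le> i + r + 2"
  shows "g x \<le> i + r + 2"
proof -
  have J: "{..d} \<subseteq> {..<r}" using assms r by auto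
  have "\<forall>x. x \<le> i + r + 2 \<longrightarrow> g x \<le> i + r + 2"
    using assms(1) J
  proof (induction rule: par_induct)
    case (rho k)
    then have "k < r - 3" using assms(2) r by auto
    then show ?case using rho_side by blast
  qed auto
  then show ?thesis using assms by blast
qed

text \<open>Among the labels up to \<open>r - 3\<close> only the bridge moves the last two blocks,
  and it reverses both together. The bound \<open>i + r\<close> is \<open>P True (r - 2)\<close>,
  the last t-vertex that is not an end of a connecting edge.\<close>

lemma par_link:
  assumes "g \<in> par {..r - 3}"
  shows "(\<exists>\<beta>. \<forall>b. \<forall>l\<in>{r - 1, r}. g (P b l) = P (b \<noteq> \<beta>) l) \<and> (\<forall>x. x \<le> i + r \<longrightarrow> g x \<le> i + r)"
proof -
  have J: "{..r - 3} \<subseteq> {..<r}" using r by auto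
  show ?thesis
    using assms J
  proof (induction rule: par_induct)
    case id
    then show ?case by (auto intro!: exI[of _ False])
  next
    case (rho k)
    have v: "vert b (r - 1)" "vert b r" for b using r by (auto simp: vert_def)
    show ?case
    proof (cases "k = r - 3")
      case False
      then have k: "k \<le> r - 4" "k < r - 3" using rho r by auto
      have "\<rho> k \<in> par {..r - 4}" using k by (intro rho_mem_par) simp
      then have fx: "\<rho> k (P b l) = P b l" if "l \<in> {r - 1, r}" for b l
        using par_fixes_P[of "\<rho> k" "r - 4" l b] that r by auto
      have "\<rho> k x \<le> i + r" if "x \<le> i + r" for x
      proof -
        have le: "\<rho> k x \<le> i + r + 2" using rho_side[OF k(2), of x] that by simp
        have "\<rho> k x \<noteq> P True l" if l: "l \<in> {r - 1, r}" for l
        proof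
          assume "\<rho> k x = P True l"
          then have "x = P True l" using fx[OF l] rho_eq_iff[of k x "P True l"] k by simp
          moreover have "l = r - 1 \<or> l = r" using l by simp
          ultimately show False using \<open>x \<le> i + r\<close> r unfolding P_def by (elim disjE) simp_all
        qed
        from this[of r] this[of "r - 1"] have "\<rho> k x \<noteq> i + r + 2" "\<rho> k x \<noteq> i + r + 1"
          using r by (simp_all add: P_def)
        with le show ?thesis by linarith
      qed
      then show ?thesis using fx by (auto intro!: exI[of _ False])
    next
      case True
      have k: "2 \<le> r - 3" "r - 3 < r" using r by auto
      have P: "\<rho> (r - 3) (P b l) = P (b \<noteq> (r - 1 \<le> l)) (transpose (r - 3) (Suc (r - 3)) l)" if "vert b l" for b l
        using rho_P[OF k that] by simp
      have "\<rho> (r - 3) (P b l) = P (b \<noteq> True) l" if "l \<in> {r - 1, r}" for b l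
      proof -
        have "transpose (r - 3) (Suc (r - 3)) l = l" "r - 1 \<le> l" using that r by auto
        moreover have "vert b l" using that v by auto
        ultimately show ?thesis using P[of b l] by simp
      qed
      moreover have "\<rho> (r - 3) x \<le> i + r" if x: "x \<le> i + r" for x
      proof (cases "\<exists>b l. 2 \<le> l \<and> l \<le> r \<and> x = P b l")
        case True
        then obtain b l where l: "2 \<le> l" "l \<le> r" "x = P b l" by blast
        then have "b" using P_le_iff[OF vertI[OF l(1,2)], of b] x by simp
        then have "x = i + l + 2" using l(3) by (simp add: P_def)
        then have "l \<le> r - 2" using x by linarith
        moreover have "l = r - 3 \<Longrightarrow> Suc (r - 3) \<le> r - 2" "l = Suc (r - 3) \<Longrightarrow> r - 3 \<le> r - 2" using r by linarith+
        ultimately have t: "transpose (r - 3) (Suc (r - 3)) l \<le> r - 2"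
          unfolding transpose_def by presburger
        have t': "\<not> r - 1 \<le> l" using \<open>l \<le> r - 2\<close> r by linarith
        have "\<rho> (r - 3) x = P True (transpose (r - 3) (Suc (r - 3)) l)"
          using P[OF vertI[OF l(1,2)], of b] l(3) \<open>b\<close> t' by simp
        also have "\<dots> \<le> i + r" unfolding P_def using t r by (simp only: if_True)
        finally show ?thesis .
      next
        case False
        then have "\<rho> (r - 3) x = x" by (intro rho_fixes[OF k]) (use k in auto)
        then show ?thesis using x by simp
      qed
      ultimately show ?thesis unfolding True by blast
    qed
  next
    case (comp f g)
    then obtain \<beta> \<gamma> where "\<forall>b. \<forall>l\<in>{r - 1, r}. f (P b l) = P (b \<noteq> \<beta>) l"
      "\<forall>b. \<forall>l\<in>{r - 1, r}. g (P b l) = P (b \<noteq> \<gamma>) l" by blast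
    then have "\<forall>b. \<forall>l\<in>{r - 1, r}. (f \<circ> g) (P b l) = P ((b \<noteq> \<gamma>) \<noteq> \<beta>) l" by simp
    then have "\<forall>b. \<forall>l\<in>{r - 1, r}. (f \<circ> g) (P b l) = P (b \<noteq> (\<gamma> \<noteq> \<beta>)) l"
      by (cases \<beta>; cases \<gamma>) simp_all
    then show ?case using comp by (intro conjI exI[of _ "\<gamma> \<noteq> \<beta>"]) auto
  qed
qed

text \<open>Only label \<open>r - 1\<close> moves block \<open>r\<close> to another place, and the
  bridge can merely reverse it.\<close>

lemma par_last_block:
  assumes "g \<in> par {..r - 2}"
  shows "\<exists>\<beta>. \<forall>b. g (P b r) = P (b \<noteq> \<beta>) r"
proof -
  have J: "{..r - 2} \<subseteq> {..<r}" using r by auto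
  show ?thesis
    using assms J
  proof (induction rule: par_induct)
    case id
    then show ?case by (auto intro!: exI[of _ False])
  next
    case (rho k)
    have v: "vert b r" for b using r by (auto simp: vert_def)
    show ?case
    proof (cases "k = r - 2")
      case True
      moreover have "r - 2 \<noteq> r - 3" "2 \<le> r - 2" "r - 2 < r" using r by auto
      ultimately have "\<rho> k (P b r) = P b r" for b using rho_P[of k b r] v r by simp
      then show ?thesis by (auto intro!: exI[of _ False])
    next
      case False
      then have "\<rho> k \<in> par {..r - 3}" using rho by (intro rho_mem_par) auto
      then show ?thesis using par_link by blast
    qed
  next
    case (comp f g)
    then obtain \<beta> \<gamma> where "\<forall>b. f (P b r) = P (b \<noteq> \<beta>) r" "\<forall>b. g (P b r) = P (b \<noteq> \<gamma>) r" by blast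
    then have "\<forall>b. (f \<circ> g) (P b r) = P ((b \<noteq> \<gamma>) \<noteq> \<beta>) r" by simp
    then have "\<forall>b. (f \<circ> g) (P b r) = P (b \<noteq> (\<gamma> \<noteq> \<beta>)) r"
      by (cases \<beta>; cases \<gamma>) simp_all
    then show ?case by blast
  qed
qed

definition flip :: "nat \<Rightarrow> nat \<Rightarrow> nat" where
  "flip l = transpose (P True l) (P False l) \<circ> transpose (P True r) (P False r)"

lemma transpose_block:
  assumes "vert True l" "vert False l" "vert b j"
  shows "transpose (P True l) (P False l) (P b j) = P (b \<noteq> (j = l)) j"
proof (cases "j = l")
  case True
  then show ?thesis by (cases b) simp_all
next
  case False
  then have "P b j \<noteq> P True l" "P b j \<noteq> P False l"
    using P_eq_iff[OF assms(3,1)] P_eq_iff[OF assms(3,2)] by simp_all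
  then show ?thesis using False by simp
qed

lemma flip_P:
  assumes "vert True l" "vert False l" "l < r" "vert b j"
  shows "flip l (P b j) = P (b \<noteq> (j = l \<or> j = r)) j"
proof -
  have "vert True r" "vert False r" using r by (auto simp: vert_def)
  then have "flip l (P b j) = P ((b \<noteq> (j = r)) \<noteq> (j = l)) j"
    unfolding flip_def using assms
    by (cases b; cases "j = r"; simp add: transpose_block)
  then show ?thesis using assms(3) by (cases "j = r"; cases "j = l") auto
qed

lemma flip_fixes:
  assumes "vert True l" "vert False l" "\<And>b j. vert b j \<Longrightarrow> x \<noteq> P b j"
  shows "flip l x = x"
proof -
  have "vert True r" "vert False r" using r by (auto simp: vert_def)
  then show ?thesis unfolding flip_def using assms by (metis o_apply transpose_apply_other)
qed

text \<open>On the blocks r-4, r-3, r-2 both generators act as adjacent transpositions, whose product has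
  order 3.\<close>

lemma flip_eq: "(\<rho> (r - 4) \<circ> \<rho> (r - 3)) ^^ 3 = flip (r - 1)"
proof
  fix x
  have v: "vert b (r - 1)" for b using r by (auto simp: vert_def)
  show "((\<rho> (r - 4) \<circ> \<rho> (r - 3)) ^^ 3) x = flip (r - 1) x"
  proof (cases "\<exists>b j. vert b j \<and> x = P b j")
    case True
    then obtain b j where j: "vert b j" "x = P b j" by blast
    define k0 k1 k2 k3 where k_def: "k0 = r - 4" "k1 = r - 3" "k2 = r - 2" "k3 = r - 1"
    have suc: "Suc k0 = k1" "Suc k1 = k2" and k: "2 \<le> k0" "k0 < r" "2 \<le> k1" "k1 < r" "k0 \<noteq> k1"
      using r unfolding k_def by auto
    have le: "\<not> k3 \<le> k0" "\<not> k3 \<le> k1" "\<not> k3 \<le> k2" "k3 \<le> r"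
      and ne: "k0 \<noteq> k1" "k0 \<noteq> k2" "k0 \<noteq> k3" "k0 \<noteq> r" "k1 \<noteq> k2" "k1 \<noteq> k3" "k1 \<noteq> r" "k2 \<noteq> k3"
        "k2 \<noteq> r" "k3 \<noteq> r"
      using r unfolding k_def by auto
    have w: "vert b k0" "vert b k1" "vert b k2" "vert b k3" "vert b r" for b
      using r unfolding k_def vert_def by auto
    have 1: "\<rho> k0 (P b l) = P b (transpose k0 k1 l)" if "vert b l" for b l
      using rho_P[OF k(1,2) that] k(5) unfolding suc k_def(2)[symmetric] by simp
    have 2: "\<rho> k1 (P b l) = P (b \<noteq> (k3 \<le> l)) (transpose k1 k2 l)" if "vert b l" for b l
      using rho_P[OF k(3,4) that] unfolding suc k_def(2,4)[symmetric] by simp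
    consider "j = k0" | "j = k1" | "j = k2" | "j = k3" | "j = r" | "j < k0"
      using j(1) unfolding k_def vert_def by linarith
    then have "((\<rho> k0 \<circ> \<rho> k1) ^^ 3) x = P (b \<noteq> (j = k3 \<or> j = r)) j"
    proof cases
      case 6
      then have "j \<noteq> k0" "j \<noteq> k1" "j \<noteq> k2" "j \<noteq> k3" "j \<noteq> r" "\<not> k3 \<le> j"
        using suc le k by auto
      then show ?thesis using j by (simp add: numeral_3_eq_3 1 2)
    qed (use w ne ne[symmetric] le in \<open>simp_all add: j(2) numeral_3_eq_3 1 2\<close>)
    moreover have "k3 < r" using r unfolding k_def by simp
    ultimately show ?thesis
      using flip_P[OF w(4) w(4) _ j(1)] j(2) unfolding k_def(1,2,4)[symmetric] by simp
  next
    case False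
    then have ne: "x \<noteq> P b l" if "2 \<le> l" "l \<le> r" for b l using vertI[OF that] by blast
    have "\<rho> k x = x" if "2 \<le> k" "k < r" for k
      by (rule rho_fixes[OF that]) (rule ne, use that in simp_all)
    then have "\<rho> (r - 4) x = x" "\<rho> (r - 3) x = x" using r by auto
    then show ?thesis using flip_fixes[OF v v] False by (simp add: numeral_3_eq_3)
  qed
qed

lemma flip_involution: "flip l (flip l x) = x" if "vert True l" "vert False l" "l < r"
proof (cases "\<exists>b j. vert b j \<and> x = P b j")
  case True
  then obtain b j where j: "vert b j" "x = P b j" by blast
  then have "vert (\<not> b) j \<or> j \<noteq> l \<and> j \<noteq> r" using that r by (cases b) (auto simp: vert_def)
  then show ?thesis using j that by (cases "j = l \<or> j = r") (auto simp: flip_P)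
next
  case False
  then show ?thesis using flip_fixes[OF that(1,2)] by metis
qed

lemma flip_mem:
  assumes "c \<le> r - 4" "r - 3 \<le> d" "d < r"
  shows "flip (r - 1) \<in> par {c..d}"
proof -
  interpret H: permutation_subgroup "par {c..d}" n
    using assms by (intro permutation_subgroup_par) auto
  have "\<rho> (r - 4) \<in> par {c..d}" "\<rho> (r - 3) \<in> par {c..d}"
    by (rule rho_mem_par, use assms in simp)+
  then show ?thesis unfolding flip_eq[symmetric] by (intro H.funpow_mem H.comp_mem)
qed

end

lemma funpow_3: "(f ^^ 3) x = f (f (f x))"
  by (simp add: numeral_3_eq_3)

section \<open>Signed block permutations and pure block exchanges\<close>

context thm41
begin

lemma par_comp: "f \<in> par J \<Longrightarrow> g \<in> par J \<Longrightarrow> f \<circ> g \<in> par J"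
  using generate.eng[of f "sym_group n" "\<rho> ` J" g] by (simp only: sym_group_mult)

text \<open>Signed permutations of the blocks from \<open>c\<close> on; the sign
  \<open>\<beta>\<close> may depend on the block.\<close>

definition blocks :: "nat \<Rightarrow> (nat \<Rightarrow> nat) \<Rightarrow> bool" where
  "blocks c g \<longleftrightarrow> (\<forall>l\<in>{c..r}. \<exists>l'\<in>{c..r}. \<exists>\<beta>. \<forall>b. g (P b l) = P (b \<noteq> \<beta>) l')"

lemma blocks_obtain:
  assumes "blocks c g" "l \<in> {c..r}"
  obtains l' \<beta> where "l' \<in> {c..r}" "\<forall>b. g (P b l) = P (b \<noteq> \<beta>) l'"
proof -
  have "\<exists>l'\<in>{c..r}. \<exists>\<beta>. \<forall>b. g (P b l) = P (b \<noteq> \<beta>) l'"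
    using assms unfolding blocks_def by (rule bspec)
  then show thesis using that by (elim bexE exE) 
qed

lemma vert_from:
  assumes "1 \<le> c" "2 \<le> c \<or> 2 \<le> i" "l \<in> {c..r}"
  shows "vert b l"
  using assms by (auto simp: vert_def)

lemma transpose_range:
  fixes k :: nat
  assumes "c \<le> k" "Suc k \<le> m" "l \<in> {c..m}"
  shows "transpose k (Suc k) l \<in> {c..m}"
  using assms by (cases "l = k"; cases "l = Suc k") simp_all

text \<open>If \<open>c = 1\<close> and \<open>i = 1\<close>, block 1 has no s-point of its own and
  this description breaks down; the last assumption excludes it.\<close>

lemma blocks_par:
  assumes "g \<in> par {c..<r}" "1 \<le> c" "2 \<le> c \<or> 2 \<le> i"
  shows "blocks c g"
proof -
  have J: "{c..<r} \<subseteq> {..<r}" by auto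
  show ?thesis
    using assms(1) J
  proof (induction rule: par_induct)
    case id
    show ?case unfolding blocks_def by (intro ballI bexI exI[of _ False]) simp_all
  next
    case (rho k)
    then have k: "c \<le> k" "k < r" by auto
    show ?case unfolding blocks_def
    proof
      fix l assume l: "l \<in> {c..r}"
      note v = vert_from[OF assms(2,3) l]
      have t: "transpose k (Suc k) l \<in> {c..r}" using transpose_range[OF k(1) _ l] k(2) by simp
      show "\<exists>l'\<in>{c..r}. \<exists>\<beta>. \<forall>b. \<rho> k (P b l) = P (b \<noteq> \<beta>) l'"
      proof (cases "2 \<le> k")
        case True
        show ?thesis
          by (rule bexI[OF _ t], rule exI, rule allI, rule rho_P[OF True k(2) v])
      next
        case False
        then have "k = Suc 0" "2 \<le> i" using k assms by auto
        then have "\<forall>b. \<rho> k (P b l) = P (b \<noteq> False) (transpose k (Suc k) l)"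
          using rho_1_P[OF v] by (simp add: numeral_2_eq_2)
        then show ?thesis using t by blast
      qed
    qed
  next
    case (comp f g)
    show ?case unfolding blocks_def
    proof
      fix l assume l: "l \<in> {c..r}"
      obtain l' \<beta> where g: "l' \<in> {c..r}" "\<forall>b. g (P b l) = P (b \<noteq> \<beta>) l'" using blocks_obtain[OF comp(2) l] .
      obtain l'' \<gamma> where f: "l'' \<in> {c..r}" "\<forall>b. f (P b l') = P (b \<noteq> \<gamma>) l''" using blocks_obtain[OF comp(1) g(1)] .
      have "(f \<circ> g) (P b l) = P (b \<noteq> (\<beta> \<noteq> \<gamma>)) l''" for b
        using f(2) g(2) by (cases \<beta>; cases \<gamma>) simp_all
      then show "\<exists>l'\<in>{c..r}. \<exists>\<beta>. \<forall>b. (f \<circ> g) (P b l) = P (b \<noteq> \<beta>) l'" using f(1) by blast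
    qed
  qed
qed

lemma par_outside:
  assumes "g \<in> par {c..<r}" "2 \<le> c" "\<And>b l. l \<in> {c..r} \<Longrightarrow> x \<noteq> P b l"
  shows "g x = x"
proof -
  have J: "{c..<r} \<subseteq> {..<r}" by auto
  show ?thesis
    using assms(1) J
  proof (induction rule: par_induct)
    case (rho k)
    then show ?case using assms(2,3) by (intro rho_fixes) auto
  qed simp_all
qed

text \<open>The generator of label \<open>k\<close> freed from its side effects. For label 1 the
  cube cancels the action on the rest of the paths, for the bridge label \<open>flip (r - 1)\<close>
  cancels the reversals.\<close>

definition swap_block :: "nat \<Rightarrow> nat \<Rightarrow> nat" where
  "swap_block k = (if k = 1 then \<rho> 1 \<circ> (\<rho> 1 \<circ> \<rho> 2) ^^ 3
     else if k = r - 3 then \<rho> k \<circ> flip (r - 1) else \<rho> k)"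

text \<open>Labels 1 and 2 act on the blocks 1, 2, 3 as adjacent transpositions without reversal, so
  their product has order 3 there and fixes the other blocks.\<close>

lemma cube_1_2_P:
  assumes "2 \<le> i" "vert b l"
  shows "((\<rho> 1 \<circ> \<rho> 2) ^^ 3) (P b l) = P b l"
proof -
  have 1: "\<rho> (Suc 0) (P b l) = P b (transpose (Suc 0) 2 l)" if "vert b l" for b l
    using rho_1_P[OF that] assms(1) by simp
  have "(2::nat) \<noteq> r - 3" "2 < r" using r by auto
  then have 2: "\<rho> 2 (P b l) = P b (transpose 2 3 l)" if "vert b l" for b l
    using rho_P[OF _ _ that, of 2] by (simp add: eval_nat_numeral)
  have v: "vert b (Suc 0)" "vert b 2" "vert b 3" using assms r by (auto simp: vert_def)
  consider "l = Suc 0" | "l = 2" | "l = 3" | "l \<noteq> Suc 0" "l \<noteq> 2" "l \<noteq> 3" by blast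
  then show ?thesis
    using assms v by cases (simp_all add: funpow_3 1 2)
qed

text \<open>Outside the blocks label 2 is trivial, so the cube reduces to the third power of the
  involution \<open>\<rho> 1\<close>.\<close>

lemma cube_1_2_outside:
  assumes "2 \<le> i" "\<And>b l. l \<in> {1..r} \<Longrightarrow> x \<noteq> P b l"
  shows "((\<rho> 1 \<circ> \<rho> 2) ^^ 3) x = \<rho> 1 x" "\<And>b l. l \<in> {1..r} \<Longrightarrow> \<rho> 1 x \<noteq> P b l"
proof -
  show o: "\<rho> 1 x \<noteq> P b l" if "l \<in> {1..r}" for b l
  proof
    assume e: "\<rho> 1 x = P b l"
    have "vert b l" using that assms(1) by (auto simp: vert_def)
    then have "\<rho> 1 (P b l) = P b (transpose (Suc 0) 2 l)" using rho_1_P assms(1) by simp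
    then have "x = P b (transpose (Suc 0) 2 l)" using e rho_involution[of 1 x] r by simp
    moreover have "transpose (Suc 0) 2 l \<in> {1..r}"
      using transpose_range[of 1 1 r l] that r by (simp add: numeral_2_eq_2)
    ultimately show False using assms(2) by blast
  qed
  have 2: "2 < r" using r by simp
  have "\<rho> 2 x = x" by (rule rho_fixes[OF _ 2]) (use assms(2) in simp_all)
  moreover have "\<rho> 2 (\<rho> 1 x) = \<rho> 1 x" by (rule rho_fixes[OF _ 2]) (use o in simp_all)
  ultimately show "((\<rho> 1 \<circ> \<rho> 2) ^^ 3) x = \<rho> 1 x"
    using rho_involution[of 1] r by (simp add: numeral_3_eq_3)
qed

lemma swap_block_P:
  assumes "1 \<le> k" "k < r - 1" "2 \<le> k \<or> 2 \<le> i" "vert b l"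
  shows "swap_block k (P b l) = P b (transpose k (Suc k) l)"
proof (cases "k = 1")
  case True
  then have "2 \<le> i" using assms by simp
  then show ?thesis
    using True cube_1_2_P[OF _ assms(4)] rho_1_P[OF assms(4)] by (simp add: swap_block_def numeral_2_eq_2)
next
  case False
  then have k: "2 \<le> k" "k < r" using assms by auto
  show ?thesis
  proof (cases "k = r - 3")
    case True
    have v: "vert True (r - 1)" "vert False (r - 1)" using r by (auto simp: vert_def)
    have "l \<le> r" using assms(4) by (simp add: vert_def)
    then have l: "l = r - 1 \<or> l = r \<longleftrightarrow> r - 1 \<le> l" by auto
    have "flip (r - 1) (P b l) = P (b \<noteq> (r - 1 \<le> l)) l"
      using flip_P[OF v _ assms(4)] r unfolding l by simp
    moreover have "vert (b \<noteq> (r - 1 \<le> l)) l"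
      using assms(4) r by (auto simp: vert_def)
    ultimately have "swap_block k (P b l) = P ((b \<noteq> (r - 1 \<le> l)) \<noteq> (r - 1 \<le> l)) (transpose k (Suc k) l)"
      using rho_P[OF k, of "b \<noteq> (r - 1 \<le> l)" l] True False by (simp add: swap_block_def)
    then show ?thesis by (cases "r - 1 \<le> l") simp_all
  next
    case F: False
    then show ?thesis using rho_P[OF k assms(4)] False by (simp add: swap_block_def)
  qed
qed

lemma swap_block_fixes:
  assumes "1 \<le> c" "2 \<le> c \<or> 2 \<le> i" "c \<le> k" "k < r" "\<And>b l. l \<in> {c..r} \<Longrightarrow> x \<noteq> P b l"
  shows "swap_block k x = x"
proof (cases "k = 1")
  case True
  then have "2 \<le> i" "c = 1" using assms by auto
  then have "((\<rho> 1 \<circ> \<rho> 2) ^^ 3) x = \<rho> 1 x" using cube_1_2_outside(1) assms(5) by blast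
  then show ?thesis using True rho_involution[of 1 x] r by (simp add: swap_block_def)
next
  case False
  then have k: "2 \<le> k" using assms by simp
  have "\<rho> k x = x" by (rule rho_fixes[OF k assms(4)]) (use assms in simp_all)
  moreover have "flip (r - 1) x = x" if "k = r - 3"
  proof -
    have "x \<noteq> P True (r - 1)" "x \<noteq> P False (r - 1)" "x \<noteq> P True r" "x \<noteq> P False r"
      by (rule assms(5); use assms that in simp)+
    then show ?thesis unfolding flip_def by (simp only: o_apply transpose_apply_other simp_thms)
  qed
  ultimately show ?thesis using False by (cases "k = r - 3") (simp_all add: swap_block_def)
qed

text \<open>For \<open>k = 1\<close> label 2 must be available for the cube; for the bridge label,
  \<open>c \<le> r - 4\<close> provides the label \<open>r - 4\<close> from which the flip is
  built.\<close>

lemma swap_block_mem: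
  assumes "c \<le> k" "k \<le> d" "d < r" "c \<le> r - 4" "k = 1 \<Longrightarrow> 2 \<le> d"
  shows "swap_block k \<in> par {c..d}"
proof -
  interpret H: permutation_subgroup "par {c..d}" n
    using assms by (intro permutation_subgroup_par) auto
  have k: "\<rho> k \<in> par {c..d}" by (rule rho_mem_par) (use assms in simp)
  show ?thesis
  proof (cases "k = 1")
    case True
    then have "\<rho> 2 \<in> par {c..d}" by (intro rho_mem_par) (use assms in simp)
    then have "\<rho> 1 \<circ> (\<rho> 1 \<circ> \<rho> 2) ^^ 3 \<in> par {c..d}"
      using k unfolding True by (intro H.comp_mem H.funpow_mem)
    then show ?thesis using True by (simp only: swap_block_def if_True simp_thms)
  next
    case False
    show ?thesis
    proof (cases "k = r - 3")
      case True
      then have "\<rho> k \<circ> flip (r - 1) \<in> par {c..d}"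
        using assms by (intro H.comp_mem k flip_mem) simp_all
      then show ?thesis using True False by (simp only: swap_block_def if_True if_False simp_thms)
    next
      case F: False
      then show ?thesis using k False by (simp only: swap_block_def if_True if_False simp_thms)
    qed
  qed
qed

lemma diagonal_P_mem:
  assumes "permutation_subgroup H n" "1 \<le> c" "2 \<le> c \<or> 2 \<le> i" "m \<le> r - 1"
    and "\<And>k. c \<le> k \<Longrightarrow> k < m \<Longrightarrow> swap_block k \<in> H" "diagonal P c m q"
  shows "q \<in> H"
proof (rule permutation_subgroup.diagonal_mem[OF assms(1) _ _ _ _ assms(6)])
  have mr: "l \<in> {c..r}" if "l \<in> {c..m}" for l using that assms(4) by auto
  note v = vert_from[OF assms(2,3) mr]
  show "b = b' \<and> l = l'" if "l \<in> {c..m}" "l' \<in> {c..m}" "P b l = P b' l'" for b b' l l'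
    using P_eq_iff[OF v[OF that(1)] v[OF that(2)]] that(3) by blast
  show "swap_block k (P b l) = P b (transpose k (Suc k) l)" if "c \<le> k" "k < m" "l \<in> {c..m}" for k b l
    by (rule swap_block_P) (use assms that v in auto)
  show "swap_block k x = x" if k: "c \<le> k" "k < m" and x: "\<forall>b. \<forall>l\<in>{c..m}. x \<noteq> P b l" for k x
  proof (cases "\<exists>b. \<exists>l\<in>{c..r}. x = P b l")
    case True
    then obtain b l where l: "l \<in> {c..r}" "x = P b l" by blast
    then have "l \<notin> {c..m}" using x by blast
    then have "l \<noteq> k" "l \<noteq> Suc k" using k l by auto
    moreover have "1 \<le> k" "k < r - 1" "2 \<le> k \<or> 2 \<le> i" using k assms(2,3,4) by auto
    ultimately show ?thesis
      using swap_block_P[of k b l] vert_from[OF assms(2,3) l(1)] l(2) by simp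
  next
    case False
    then show ?thesis by (intro swap_block_fixes[OF assms(2,3) k(1)]) (use k assms(4) in auto)
  qed
qed (fact assms(5))

text \<open>By injectivity no block up to \<open>m\<close> can go to one of the fixed blocks above
  \<open>m\<close>, and the condition \<open>side\<close> forces every sign to be trivial.\<close>

lemma diagonal_if_blocks:
  assumes c: "1 \<le> c" "2 \<le> c \<or> 2 \<le> i" and "m \<le> r" and g: "inj g" "blocks c g"
    and fixed: "\<And>b l. l \<in> {c..r} \<Longrightarrow> m < l \<Longrightarrow> g (P b l) = P b l"
    and side: "\<And>l. l \<in> {c..m} \<Longrightarrow> g (P True l) \<le> i + r + 2"
    and outside: "\<And>x. (\<And>b l. l \<in> {c..r} \<Longrightarrow> x \<noteq> P b l) \<Longrightarrow> g x = x"
  shows "diagonal P c m g"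
proof (rule diagonalI)
  show "\<exists>l'\<in>{c..m}. \<forall>b. g (P b l) = P b l'" if l: "l \<in> {c..m}" for l
  proof -
    have lr: "l \<in> {c..r}" using l assms(3) by auto
    obtain l' \<beta> where g': "l' \<in> {c..r}" "\<forall>b. g (P b l) = P (b \<noteq> \<beta>) l'" using blocks_obtain[OF g(2) lr] .
    have "l' \<le> m"
    proof (rule ccontr)
      assume "\<not> l' \<le> m"
      then have "g (P (True \<noteq> \<beta>) l') = g (P True l)" using fixed[OF g'(1)] g'(2) by simp
      then have "P (True \<noteq> \<beta>) l' = P True l" using g(1) by (rule injD[rotated])
      then have "l' = l" using P_eq_iff[OF vert_from[OF c g'(1)] vert_from[OF c lr]] by blast
      then show False using l \<open>\<not> l' \<le> m\<close> by simp
    qed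
    moreover have "\<not> \<beta>"
    proof -
      have "P (True \<noteq> \<beta>) l' \<le> i + r + 2" using side[OF l] g'(2) by simp
      then show ?thesis using P_le_iff[OF vert_from[OF c g'(1)], of "True \<noteq> \<beta>"] by simp
    qed
    ultimately show ?thesis using g' by (intro bexI[of _ l']) simp_all
  qed
  show "g x = x" if x: "\<And>b l. l \<in> {c..m} \<Longrightarrow> x \<noteq> P b l" for x
  proof (cases "\<exists>b. \<exists>l\<in>{c..r}. x = P b l")
    case True
    then obtain b l where l: "l \<in> {c..r}" "x = P b l" by blast
    then have "m < l" using x[of l b] by (meson atLeastAtMost_iff leI)
    then show ?thesis using fixed[OF l(1)] l(2) by simp
  next
    case False
    then show ?thesis by (intro outside) blast
  qed
qed fact

lemma vert_r: "vert b r" "vert b (r - 1)"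
  using r by (auto simp: vert_def)

text \<open>Conjugation carries the reversed pair of blocks \<open>Suc l\<close>, \<open>r\<close>
  to \<open>l\<close>, \<open>r\<close>; since \<open>l < r - 1\<close>, the exchange leaves block
  \<open>r\<close> in place.\<close>

lemma flip_conj:
  assumes "1 \<le> l" "l < r - 1" "2 \<le> l \<or> 2 \<le> i"
  shows "swap_block l \<circ> flip (Suc l) \<circ> swap_block l = flip l"
proof
  fix x
  have v: "vert b l" "vert b (Suc l)" for b using assms by (auto simp: vert_def)
  show "(swap_block l \<circ> flip (Suc l) \<circ> swap_block l) x = flip l x"
  proof (cases "\<exists>b j. j \<in> {l..r} \<and> x = P b j")
    case True
    then obtain b j where j: "j \<in> {l..r}" "x = P b j" by blast
    have vj: "vert b j" for b using vert_from[OF assms(1,3) j(1)] .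
    have t: "transpose l (Suc l) j \<in> {l..r}" using transpose_range[of l l r j] j(1) assms by simp
    have vt: "vert b (transpose l (Suc l) j)" for b using vert_from[OF assms(1,3) t] .
    have e: "transpose l (Suc l) j = Suc l \<or> transpose l (Suc l) j = r \<longleftrightarrow> j = l \<or> j = r"
      using assms(2) by (auto simp: transpose_def)
    have "Suc l < r" "l < r" using assms(2) by auto
    then show ?thesis
      using assms by (simp add: j(2) swap_block_P vj vt flip_P v e)
  next
    case False
    then have x: "x \<noteq> P b j" if "j \<in> {l..r}" for b j using that by blast
    have "swap_block l x = x" by (rule swap_block_fixes[of l]) (use assms x in auto)
    moreover have "flip (Suc l) x = x" "flip l x = x"
      unfolding flip_def using x[of l] x[of "Suc l"] x[of r] assms(2)
      by (simp_all only: o_apply transpose_apply_other simp_thms atLeastAtMost_iff)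
        (simp_all add: transpose_def)
    ultimately show ?thesis by simp
  qed
qed

lemma flip_mem_all:
  assumes "1 \<le> c" "2 \<le> c \<or> 2 \<le> i" "c \<le> r - 4" "c \<le> l" "l \<le> r - 1"
  shows "flip l \<in> par {c..r - 2}"
  using assms(5,4)
proof (induction rule: inc_induct)
  case base
  show ?case by (rule flip_mem) (use assms r in auto)
next
  case (step l)
  interpret H: permutation_subgroup "par {c..r - 2}" n
    using r by (intro permutation_subgroup_par) auto
  have "swap_block l \<in> par {c..r - 2}" by (rule swap_block_mem) (use assms step r in auto)
  then have "swap_block l \<circ> flip (Suc l) \<circ> swap_block l \<in> par {c..r - 2}"
    using step by (intro H.comp_mem) auto
  moreover have "1 \<le> l" "2 \<le> l \<or> 2 \<le> i" using assms step by auto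
  ultimately show ?case using flip_conj[of l] step(2) by metis
qed

lemma permutation_subgroup_alt: "permutation_subgroup (carrier (alt_group n)) n"
  unfolding permutation_subgroup_def by (rule alt_group_is_subgroup)

text \<open>Diagonal elements are products of block exchanges. The membership lemma is applied here
  to the alternating group instead of a parabolic subgroup.\<close>

lemma even_if_diagonal:
  assumes "1 \<le> c" "2 \<le> c \<or> 2 \<le> i" "c \<le> r - 4" "m \<le> r - 1" "diagonal P c m q"
  shows "evenperm q"
proof -
  have "swap_block k \<in> carrier (alt_group n)" if "c \<le> k" "k < m" for k
  proof -
    have k: "swap_block k \<in> par {c..r - 1}" by (rule swap_block_mem) (use that assms r in auto)
    have J: "{c..r - 1} \<subseteq> {..<r}" using r by auto
    show ?thesis using par_permutes[OF k J] par_even[OF k J] by (simp only: alt_group_carrier simp_thms)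
  qed
  then have "q \<in> carrier (alt_group n)"
    by (rule diagonal_P_mem[OF permutation_subgroup_alt assms(1,2,4) _ assms(5)])
  then show ?thesis by (simp only: alt_group_carrier)
qed

text \<open>Signed permutations that are even have an even number of sign changes.\<close>

lemma no_reversal_if_even:
  assumes c: "1 \<le> c" "2 \<le> c \<or> 2 \<le> i" "c \<le> r - 4" and g: "g permutes {1..n}" "evenperm g" "blocks c g"
    and last: "\<forall>b. g (P b r) = P (b \<noteq> \<beta>) r"
    and side: "\<And>l. l \<in> {c..r - 1} \<Longrightarrow> g (P True l) \<le> i + r + 2"
    and outside: "\<And>x. (\<And>b l. l \<in> {c..r} \<Longrightarrow> x \<noteq> P b l) \<Longrightarrow> g x = x"
  shows "\<not> \<beta>"
proof
  assume \<beta>: \<beta>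
  \<comment> \<open>Composing with \<open>s\<close> removes the supposed reversal of block
    \<open>r\<close>. The result is diagonal, hence even, although \<open>s\<close> is odd.\<close>
  define s where "s = transpose (P True r) (P False r)"
  have s: "s (P b j) = P (b \<noteq> (j = r)) j" if "vert b j" for b j
    unfolding s_def by (rule transpose_block[OF vert_r(1) vert_r(1) that])
  have s': "s (P b r) = P (\<not> b) r" for b using s[OF vert_r(1)] by simp
  have v: "vert b j" if "j \<in> {c..r}" for b j using vert_from[OF c(1,2) that] .
  have s'': "s (P b j) = P b j" if "j \<in> {c..r}" "j \<noteq> r" for b j using s[OF v[OF that(1)]] that(2) by simp
  have inj: "inj (g \<circ> s)"
    unfolding s_def using permutes_inj[OF g(1)] inj_transpose by (rule inj_compose)
  have "diagonal P c (r - 1) (g \<circ> s)"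
  proof (rule diagonal_if_blocks[OF c(1,2) _ inj])
    show "blocks c (g \<circ> s)"
      unfolding blocks_def
    proof
      fix l assume l: "l \<in> {c..r}"
      show "\<exists>l'\<in>{c..r}. \<exists>\<beta>. \<forall>b. (g \<circ> s) (P b l) = P (b \<noteq> \<beta>) l'"
      proof (cases "l = r")
        case True
        have "\<forall>b. (g \<circ> s) (P b l) = P (b \<noteq> False) r"
          using last \<beta> True s' by simp
        then show ?thesis using l True by blast
      next
        case False
        obtain l' \<gamma> where "l' \<in> {c..r}" "\<forall>b. g (P b l) = P (b \<noteq> \<gamma>) l'" using blocks_obtain[OF g(3) l] .
        moreover have "\<forall>b. (g \<circ> s) (P b l) = g (P b l)" using s''[OF l False] by simp
        ultimately show ?thesis by (intro bexI[of _ l'] exI[of _ \<gamma>]) simp_all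
      qed
    qed
    show "(g \<circ> s) (P b l) = P b l" if "l \<in> {c..r}" "r - 1 < l" for b l
    proof -
      have "l = r" using that by auto
      then show ?thesis using last \<beta> s' by simp
    qed
    show "(g \<circ> s) (P True l) \<le> i + r + 2" if "l \<in> {c..r - 1}" for l
    proof -
      have "l \<in> {c..r}" "l \<noteq> r" using that r by auto
      then show ?thesis using s'' side[OF that] by simp
    qed
    show "(g \<circ> s) x = x" if "\<And>b l. l \<in> {c..r} \<Longrightarrow> x \<noteq> P b l" for x
    proof -
      have "r \<in> {c..r}" using c r by auto
      then have "x \<noteq> P True r" "x \<noteq> P False r" using that by blast+
      then have "s x = x" unfolding s_def by (rule transpose_apply_other)
      then show ?thesis using outside that by simp
    qed
  qed simp
  then have "evenperm (g \<circ> s)" using c by (intro even_if_diagonal[of c "r - 1"]) simp_all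
  moreover have "permutation g" using g(1) permutation_permutes by blast
  moreover have "P True r \<noteq> P False r" using P_eq_iff[OF vert_r(1) vert_r(1)] by simp
  ultimately show False
    using g(2) unfolding s_def by (simp add: evenperm_comp permutation_swap_id evenperm_swap)
qed

section \<open>Intervals of labels for which pure block exchanges are available\<close>

lemma parabolic_low:
  assumes c: "1 \<le> c" "2 \<le> c \<or> 2 \<le> i" "c \<le> d" "c = 1 \<Longrightarrow> 2 \<le> d" and d: "d \<le> r - 4"
    and g: "g \<in> par {c..Suc d}" "g \<in> par {..d}"
    and outside: "\<And>x. (\<And>b l. l \<in> {c..r} \<Longrightarrow> x \<noteq> P b l) \<Longrightarrow> g x = x"
  shows "g \<in> par {c..d}"
proof -
  have "{c..Suc d} \<subseteq> {c..<r}" using d r by auto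
  then have gr: "g \<in> par {c..<r}" using g(1) par_mono by blast
  \<comment> \<open>The group of \<open>{c..Suc d}\<close> yields a signed block permutation, and
    the labels up to \<open>d\<close> contribute that the blocks beyond \<open>Suc d\<close> are
    fixed and no sign occurs. Exchanges within \<open>c\<close> to \<open>Suc d\<close> need only
    the labels \<open>c\<close> to \<open>d\<close>.\<close>
  have diag: "diagonal P c (Suc d) g"
  proof (rule diagonal_if_blocks[OF c(1,2)])
    show "inj g" by (rule par_inj[OF gr]) auto
    show "blocks c g" using blocks_par[OF gr c(1,2)] .
    show "g (P b l) = P b l" if "l \<in> {c..r}" "Suc d < l" for b l
      by (rule par_fixes_P[OF g(2) _ d]) (use that c in auto)
    show "g (P True l) \<le> i + r + 2" if "l \<in> {c..Suc d}" for l
    proof (rule par_side[OF g(2) d])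
      show "P True l \<le> i + r + 2" unfolding P_def using that d r by auto
    qed
  qed (use d r outside in auto)
  have sw: "swap_block k \<in> par {c..d}" if "c \<le> k" "k < Suc d" for k
    by (rule swap_block_mem) (use that c d r in auto)
  have H: "permutation_subgroup (par {c..d}) n" using d r by (intro permutation_subgroup_par) auto
  have "Suc d \<le> r - 1" using d r by simp
  then show ?thesis by (rule diagonal_P_mem[OF H c(1,2) _ sw diag])
qed

lemma par_link_side:
  assumes "g \<in> par {..r - 3}" "x \<le> i + r"
  shows "g x \<le> i + r"
  using spec[OF conjunct2[OF par_link[OF assms(1)]], of x] assms(2) by (rule mp)

lemma par_link_obtain:
  assumes "g \<in> par {..r - 3}"
  obtains \<beta> where "\<forall>b. \<forall>l\<in>{r - 1, r}. g (P b l) = P (b \<noteq> \<beta>) l"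
  using conjunct1[OF par_link[OF assms]] that by (elim exE)

text \<open>The bridge allows a joint reversal of the last two blocks, which
  \<open>flip (r - 1)\<close> undoes inside the target group. After that these blocks are fixed, and
  the blocks up to \<open>r - 2\<close> can be sorted.\<close>

lemma parabolic_mid:
  assumes c: "1 \<le> c" "2 \<le> c \<or> 2 \<le> i" "c \<le> r - 4"
    and g: "g \<in> par {c..r - 2}" "g \<in> par {..r - 3}"
    and outside: "\<And>x. (\<And>b l. l \<in> {c..r} \<Longrightarrow> x \<noteq> P b l) \<Longrightarrow> g x = x"
  shows "g \<in> par {c..r - 3}"
proof -
  interpret H: permutation_subgroup "par {c..r - 3}" n
    using r by (intro permutation_subgroup_par) auto
  have main: "g \<in> par {c..r - 3}"
    if g: "g \<in> par {c..r - 2}" "g \<in> par {..r - 3}" and fixed: "\<forall>b. \<forall>l\<in>{r - 1, r}. g (P b l) = P b l"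
      and outside: "\<And>x. (\<And>b l. l \<in> {c..r} \<Longrightarrow> x \<noteq> P b l) \<Longrightarrow> g x = x" for g
  proof -
    have "{c..r - 2} \<subseteq> {c..<r}" using r by auto
    then have gr: "g \<in> par {c..<r}" using g(1) par_mono by blast
    have diag: "diagonal P c (r - 2) g"
    proof (rule diagonal_if_blocks[OF c(1,2)])
      show "inj g" by (rule par_inj[OF gr]) auto
      show "blocks c g" using blocks_par[OF gr c(1,2)] .
      show "g (P b l) = P b l" if "l \<in> {c..r}" "r - 2 < l" for b l
      proof -
        have "l = r - 1 \<or> l = r" using that by auto
        then show ?thesis using fixed by blast
      qed
      show "g (P True l) \<le> i + r + 2" if "l \<in> {c..r - 2}" for l
      proof -
        have "P True l \<le> i + r" unfolding P_def using that r by auto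
        then have "g (P True l) \<le> i + r" by (rule par_link_side[OF g(2)])
        then show ?thesis by simp
      qed
    qed (use outside in auto)
    have sw: "swap_block k \<in> par {c..r - 3}" if "c \<le> k" "k < r - 2" for k
      by (rule swap_block_mem) (use that c r in auto)
    have "r - 2 \<le> r - 1" by simp
    then show ?thesis by (rule diagonal_P_mem[OF H.permutation_subgroup_axioms c(1,2) _ sw diag])
  qed
  obtain \<beta> where \<beta>: "\<forall>b. \<forall>l\<in>{r - 1, r}. g (P b l) = P (b \<noteq> \<beta>) l" using par_link_obtain[OF g(2)] .
  show ?thesis
  proof (cases \<beta>)
    case False
    then show ?thesis using \<beta> by (intro main[OF g _ outside]) simp_all
  next
    case True
    have f: "flip (r - 1) \<in> par {c..r - 3}" using c(3) r by (intro flip_mem) auto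
    have f': "flip (r - 1) \<in> par {c..r - 2}" using c(3) r by (intro flip_mem) auto
    have f'': "flip (r - 1) \<in> par {..r - 3}"
      using f par_mono[of "{c..r - 3}" "{..r - 3}"] by auto
    have v: "vert b l" if "l \<in> {r - 1, r}" for b l using that vert_r by auto
    have "flip (r - 1) \<circ> g \<in> par {c..r - 3}"
    proof (rule main)
      show "flip (r - 1) \<circ> g \<in> par {c..r - 2}"
        by (rule par_comp[OF f' g(1)])
      show "flip (r - 1) \<circ> g \<in> par {..r - 3}"
        by (rule par_comp[OF f'' g(2)])
      show "\<forall>b. \<forall>l\<in>{r - 1, r}. (flip (r - 1) \<circ> g) (P b l) = P b l"
      proof (intro allI ballI)
        fix b l assume l: "l \<in> {r - 1, r}"
        have "r - 1 < r" using r by simp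
        then have "flip (r - 1) (P (\<not> b) l) = P b l"
          using flip_P[OF vert_r(2) vert_r(2) _ v[OF l], of "\<not> b"] l by auto
        moreover have "g (P b l) = P (\<not> b) l" using bspec[OF spec[OF \<beta>, of b] l] True by simp
        ultimately show "(flip (r - 1) \<circ> g) (P b l) = P b l" by simp
      qed
      show "(flip (r - 1) \<circ> g) x = x" if x: "\<And>b l. l \<in> {c..r} \<Longrightarrow> x \<noteq> P b l" for x
      proof -
        have "r - 1 \<in> {c..r}" "r \<in> {c..r}" using c r by auto
        then have "x \<noteq> P True (r - 1)" "x \<noteq> P False (r - 1)" "x \<noteq> P True r" "x \<noteq> P False r"
          using x by blast+
        then have "flip (r - 1) x = x"
          unfolding flip_def by (simp only: o_apply transpose_apply_other simp_thms)
        then show ?thesis using outside[OF x] by simp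
      qed
    qed
    then show ?thesis using H.comp_cancel_left[OF f] by blast
  qed
qed

text \<open>Any block may now be reversed. Flips empty the set \<open>F\<close> of reversed blocks
  below \<open>r\<close>; each of them also toggles block \<open>r\<close>, whose final state is
  decided by parity.\<close>

lemma parabolic_high:
  assumes c: "1 \<le> c" "2 \<le> c \<or> 2 \<le> i" "c \<le> r - 4"
    and g: "g \<in> par {c..<r}" "g \<in> par {..r - 2}"
    and outside: "\<And>x. (\<And>b l. l \<in> {c..r} \<Longrightarrow> x \<noteq> P b l) \<Longrightarrow> g x = x"
  shows "g \<in> par {c..r - 2}"
proof -
  interpret H: permutation_subgroup "par {c..r - 2}" n
    using r by (intro permutation_subgroup_par) auto
  have J: "{c..<r} \<subseteq> {..<r}" by auto
  have v: "vert b l" if "l \<in> {c..r}" for b l using vert_from[OF c(1,2) that] .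
  have step: "g \<in> par {c..r - 2}"
    if "finite F" "F = {l \<in> {c..r - 1}. \<not> g (P True l) \<le> i + r + 2}" "g \<in> par {c..<r}"
      "\<exists>\<beta>. \<forall>b. g (P b r) = P (b \<noteq> \<beta>) r" "\<And>x. (\<And>b l. l \<in> {c..r} \<Longrightarrow> x \<noteq> P b l) \<Longrightarrow> g x = x"
    for F g
    using that
  proof (induction F arbitrary: g rule: finite_induct)
    case empty
    obtain \<beta> where \<beta>: "\<forall>b. g (P b r) = P (b \<noteq> \<beta>) r" using empty(3) by blast
    have side: "g (P True l) \<le> i + r + 2" if "l \<in> {c..r - 1}" for l using empty(1) that by blast
    have "\<not> \<beta>"
      by (rule no_reversal_if_even[OF c par_permutes[OF empty(2) J] par_even[OF empty(2) J]
            blocks_par[OF empty(2) c(1,2)] \<beta> side empty(4)]) 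
    have diag: "diagonal P c (r - 1) g"
    proof (rule diagonal_if_blocks[OF c(1,2) _ par_inj[OF empty(2) J] blocks_par[OF empty(2) c(1,2)]])
      show "g (P b l) = P b l" if "l \<in> {c..r}" "r - 1 < l" for b l
      proof -
        have "l = r" using that by auto
        then show ?thesis using \<beta> \<open>\<not> \<beta>\<close> by simp
      qed
    qed (use side empty(4) in auto)
    have sw: "swap_block k \<in> par {c..r - 2}" if "c \<le> k" "k < r - 1" for k
      by (rule swap_block_mem) (use that c r in auto)
    show ?case by (rule diagonal_P_mem[OF H.permutation_subgroup_axioms c(1,2) order_refl sw diag])
  next
    case (insert j F)
    then have j: "j \<in> {c..r - 1}" "\<not> g (P True j) \<le> i + r + 2" by blast+
    then have jr: "j \<in> {c..r}" "j < r" using r by auto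
    note fP = flip_P[OF v[OF jr(1)] v[OF jr(1)] jr(2)]
    have f: "flip j \<in> par {c..r - 2}" using flip_mem_all[OF c] j(1) by auto
    have "{c..r - 2} \<subseteq> {c..<r}" using r by auto
    then have f': "flip j \<in> par {c..<r}" using f par_mono by blast
    \<comment> \<open>The flip is multiplied on the right because \<open>F\<close> names the blocks
      by their place before \<open>g\<close> acts.\<close>
    have "g \<circ> flip j \<in> par {c..r - 2}"
    proof (rule insert.IH)
      show gf: "g \<circ> flip j \<in> par {c..<r}"
        by (rule par_comp[OF insert.prems(2) f'])
      have "\<not> g (P True l) \<le> i + r + 2 \<and> l \<noteq> j \<longleftrightarrow> \<not> (g \<circ> flip j) (P True l) \<le> i + r + 2"
        if l: "l \<in> {c..r - 1}" for l
      proof (cases "l = j")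
        case True
        obtain l' \<gamma> where g: "l' \<in> {c..r}" "\<forall>b. g (P b j) = P (b \<noteq> \<gamma>) l'"
          using blocks_obtain[OF blocks_par[OF insert.prems(2) c(1,2)] jr(1)] .
        have "\<gamma>" using j(2) g(2) P_le_iff[OF v[OF g(1)], of "True \<noteq> \<gamma>"] by simp
        then have "g (P False j) \<le> i + r + 2" using g(2) P_le_iff[OF v[OF g(1)], of True] by simp
        moreover have "flip j (P True j) = P False j" using fP[OF v[OF jr(1)], of True] by simp
        ultimately show ?thesis using True by simp
      next
        case False
        have "l \<in> {c..r}" "l \<noteq> r" using l r by auto
        then have "flip j (P True l) = P True l" using fP[OF v, of l True] False by simp
        then show ?thesis using False by simp
      qed
      moreover have "F = {l \<in> {c..r - 1}. \<not> g (P True l) \<le> i + r + 2 \<and> l \<noteq> j}"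
        using insert.prems(1) insert.hyps(2) by blast
      ultimately show "F = {l \<in> {c..r - 1}. \<not> (g \<circ> flip j) (P True l) \<le> i + r + 2}" by blast
      obtain \<beta> where \<beta>: "\<forall>b. g (P b r) = P (b \<noteq> \<beta>) r" using insert.prems(3) by blast
      have "flip j (P b r) = P (\<not> b) r" for b using fP[OF vert_r(1)] by simp
      then have "\<forall>b. (g \<circ> flip j) (P b r) = P (b \<noteq> (\<not> \<beta>)) r" using \<beta> by (cases \<beta>) simp_all
      then show "\<exists>\<beta>. \<forall>b. (g \<circ> flip j) (P b r) = P (b \<noteq> \<beta>) r" by blast
      show "(g \<circ> flip j) x = x" if x: "\<And>b l. l \<in> {c..r} \<Longrightarrow> x \<noteq> P b l" for x
      proof -
        have "r \<in> {c..r}" using c by auto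
        then have "x \<noteq> P True j" "x \<noteq> P False j" "x \<noteq> P True r" "x \<noteq> P False r"
          using x jr(1) by blast+
        then have "flip j x = x"
          unfolding flip_def by (simp only: o_apply transpose_apply_other simp_thms)
        then show ?thesis using insert.prems(4)[OF x] by simp
      qed
    qed
    then show ?case using H.comp_cancel_right[OF f] by blast
  qed
  show ?thesis
    by (rule step[OF _ refl g(1) par_last_block[OF g(2)] outside]) simp_all
qed

section \<open>Intervals starting at label 1 in the case i = 1\<close>

definition edge_swap :: "bool \<Rightarrow> nat \<Rightarrow> nat \<Rightarrow> nat" where
  "edge_swap b k = transpose (P b k) (P b (Suc k)) \<circ> transpose 2 3"

lemma P_ge_4: "vert b l \<Longrightarrow> 4 \<le> P b l"
  using i r unfolding P_def vert_def by (cases b) auto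

lemma P_i1:
  assumes "i = 1"
  shows "P True l = l + 3" "P False l = r + 2 + l"
  unfolding P_def using assms by simp_all

text \<open>For \<open>i = 1\<close> label 1 has only the edges {2, 3} and {4, 5}. The first becomes
  a tag: an exchange on one side alone is odd, so it occurs together with
  \<open>transpose 2 3\<close>.\<close>

lemma rho_1_eq_edge_swap: "i = 1 \<Longrightarrow> \<rho> 1 = edge_swap True 1"
proof
  fix x assume i1: "i = 1"
  have t: "edge_swap True 1 = transpose 4 5 \<circ> transpose 2 3"
    unfolding edge_swap_def P_i1[OF i1] by (simp add: eval_nat_numeral)
  have a: "i + 4 = 5" "i + r + 3 = r + 4" "2 * i + r + 2 = r + 4" "i + r + 2 = r + 3" using i1 by auto
  have p: "path_step 1 5 1 = 1" "path_step 1 5 2 = 3" "path_step 1 5 3 = 2" "path_step 1 5 4 = 5"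
    "path_step 1 5 5 = 4" "path_step 1 i 1 = 1"
    using i1 by (simp_all add: path_step_def)
  have rx: "\<rho> 1 x = (if 1 \<le> x \<and> x \<le> 5 then path_step 1 5 x else if r + 4 \<le> x \<and> x \<le> r + 4
      then r + 3 + path_step 1 i (x - (r + 3)) else x)"
    using rho_path[of 1 x] unfolding a by simp
  consider "x = 1" | "x = 2" | "x = 3" | "x = 4" | "x = 5" | "x = r + 4" | "x = 0 \<or> 6 \<le> x" "x \<noteq> r + 4"
    by linarith
  then show "\<rho> 1 x = edge_swap True 1 x"
  proof cases
    case 6
    then have "x - (r + 3) = 1" "\<not> x \<le> 5" using r by auto
    then show ?thesis unfolding rx t using 6 p r by (simp add: transpose_def)
  next
    case 7
    then have "\<not> (1 \<le> x \<and> x \<le> 5)" "\<not> (r + 4 \<le> x \<and> x \<le> r + 4)" by auto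
    then have "\<rho> 1 x = x" unfolding rx by (simp only: if_False)
    then show ?thesis unfolding t using 7 by (auto simp: transpose_def)
  qed (unfold rx t, simp_all only: p, simp_all add: transpose_def)
qed

text \<open>On the points 4, 5, 6 the product has order 3. The factor \<open>transpose 2 3\<close>
  of label 1 and the s-edge of label 2 are disjoint from these points and survive the cube, which
  separates the s-side from the t-side.\<close>

lemma cube_1_2_edge_swap: "i = 1 \<Longrightarrow> (\<rho> 1 \<circ> \<rho> 2) ^^ 3 = edge_swap False 2"
proof
  fix x assume i1: "i = 1"
  have "2 < r" "2 \<noteq> r - 3" using r by auto
  then have 2: "\<rho> 2 = transpose 5 6 \<circ> transpose (r + 4) (r + 5)"
    using rho_tail[of 2] i1 by (simp add: eval_nat_numeral)
  have 1: "\<rho> 1 = transpose 4 5 \<circ> transpose 2 3"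
    unfolding rho_1_eq_edge_swap[OF i1] edge_swap_def P_i1[OF i1] by (simp add: eval_nat_numeral)
  have t: "edge_swap False 2 = transpose (r + 4) (r + 5) \<circ> transpose 2 3"
    unfolding edge_swap_def P_i1[OF i1] by (simp add: eval_nat_numeral)
  consider "x = 2" | "x = 3" | "x = 4" | "x = 5" | "x = 6" | "x = r + 4" | "x = r + 5"
    | "x \<noteq> 2" "x \<noteq> 3" "x \<noteq> 4" "x \<noteq> 5" "x \<noteq> 6" "x \<noteq> r + 4" "x \<noteq> r + 5" by blast
  then show "((\<rho> 1 \<circ> \<rho> 2) ^^ 3) x = edge_swap False 2 x"
    unfolding 1 2 t using r by cases (simp_all add: funpow_3 transpose_def)
qed

lemma edge_swap_conj:
  assumes "f \<in> par {1..d}" "d < r" "f (P b k) = P b (Suc k)" "f (P b (Suc k)) = P b (Suc (Suc k))" "f 2 = 2" "f 3 = 3"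
    "edge_swap b k \<in> par {1..d}"
  shows "edge_swap b (Suc k) \<in> par {1..d}"
proof -
  interpret H: permutation_subgroup "par {1..d}" n
    using assms(2) by (intro permutation_subgroup_par) auto
  note bf = H.bij[OF assms(1)]
  have "f \<circ> edge_swap b k \<circ> inv' f = (f \<circ> transpose (P b k) (P b (Suc k)) \<circ> inv' f) \<circ> (f \<circ> transpose 2 3 \<circ> inv' f)"
    unfolding edge_swap_def using bf by (simp add: fun_eq_iff bij_is_inj)
  also have "\<dots> = edge_swap b (Suc k)"
    unfolding conj_transpose[OF bf] assms(3-6) edge_swap_def ..
  finally show ?thesis using H.conj_mem[OF assms(1,7)] by simp
qed

text \<open>The cube of the product of labels 1 and 2 is the first swap on the s-side, and
  multiplying it by \<open>\<rho> 2\<close> gives the one on the t-side. Conjugation with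
  \<open>\<rho> k \<circ> \<rho> (Suc k)\<close> moves either of them to the next edge.\<close>

lemma edge_swap_mem:
  assumes i1: "i = 1" and "2 \<le> d" "d \<le> r - 3"
  shows "2 \<le> k \<Longrightarrow> k \<le> d \<Longrightarrow> edge_swap b k \<in> par {1..d}"
proof (induction k rule: dec_induct)
  case base
  interpret H: permutation_subgroup "par {1..d}" n
    using assms r by (intro permutation_subgroup_par) auto
  have m: "\<rho> 1 \<in> par {1..d}" "\<rho> 2 \<in> par {1..d}" by (rule rho_mem_par, use assms in simp)+
  then have F: "edge_swap False 2 \<in> par {1..d}"
    unfolding cube_1_2_edge_swap[OF i1, symmetric] by (intro H.funpow_mem H.comp_mem)
  have "2 < r" "2 \<noteq> r - 3" using r by auto
  then have 2: "\<rho> 2 = transpose 5 6 \<circ> transpose (r + 4) (r + 5)"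
    using rho_tail[of 2] i1 by (simp add: eval_nat_numeral)
  have "edge_swap True 2 = transpose 5 6 \<circ> transpose 2 3" "edge_swap False 2 = transpose (r + 4) (r + 5) \<circ> transpose 2 3"
    unfolding edge_swap_def P_i1[OF i1] by (simp_all add: eval_nat_numeral)
  then have "edge_swap True 2 = \<rho> 2 \<circ> edge_swap False 2" unfolding 2 by (simp add: fun_eq_iff)
  then have "edge_swap True 2 \<in> par {1..d}" using H.comp_mem[OF m(2) F] by simp
  then show ?case using F by (cases b) simp_all
next
  case (step k)
  interpret H: permutation_subgroup "par {1..d}" n
    using assms r by (intro permutation_subgroup_par) auto
  have k: "2 \<le> k" "k < r" "2 \<le> Suc k" "Suc k < r" "k \<noteq> r - 3" "\<not> r - 1 \<le> k" "\<not> r - 1 \<le> Suc k"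
    "Suc (Suc k) \<le> r"
    using step assms(3) r by auto
  have m: "\<rho> k \<in> par {1..d}" "\<rho> (Suc k) \<in> par {1..d}" by (rule rho_mem_par, use step in simp)+
  have v: "vert b k" "vert b (Suc k)" "vert b (Suc (Suc k))" using k by (auto simp: vert_def)
  have f: "(\<rho> k \<circ> \<rho> (Suc k)) x = x" if "x < 4" for x
  proof -
    have "x \<noteq> P b l" if "2 \<le> l" "l \<le> r" for b l using P_ge_4[OF vertI[OF that], of b] \<open>x < 4\<close> by simp
    then have "\<rho> j x = x" if "2 \<le> j" "j < r" for j by (intro rho_fixes[OF that]) (use that in auto)
    then show ?thesis using k by simp
  qed
  show ?case
  proof (rule edge_swap_conj[OF H.comp_mem[OF m]])
    show "d < r" using assms r by auto
    show "(\<rho> k \<circ> \<rho> (Suc k)) (P b k) = P b (Suc k)"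
      using rho_P[OF k(3,4) v(1)] rho_P[OF k(1,2) v(1)] k by simp
    show "(\<rho> k \<circ> \<rho> (Suc k)) (P b (Suc k)) = P b (Suc (Suc k))"
      using rho_P[OF k(3,4) v(2)] rho_P[OF k(1,2) v(3)] k by simp
    show "edge_swap b k \<in> par {1..d}" using step by simp
  qed (use f in simp_all)
qed

lemma edge_swap_True_mem:
  assumes "i = 1" "1 \<le> k" "k \<le> d" "d \<le> r - 3"
  shows "edge_swap True k \<in> par {1..d}"
proof (cases "k = 1")
  case True
  have "\<rho> 1 \<in> par {1..d}" by (rule rho_mem_par) (use assms in simp)
  then show ?thesis using True rho_1_eq_edge_swap[OF assms(1)] by simp
next
  case False
  then show ?thesis using assms by (intro edge_swap_mem) auto
qed

lemma fixes_small:
  assumes "i = 1" "g \<in> par {1..<r}"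
  shows "g 1 = 1 \<and> {g 2, g 3} = {2, 3}"
proof -
  have J: "{1..<r} \<subseteq> {..<r}" by auto
  show ?thesis using assms(2) J
  proof (induction rule: par_induct)
    case (rho k)
    show ?case
    proof (cases "k = 1")
      case True
      have "P True 1 = 4" "P True (Suc 1) = 5" unfolding P_i1[OF assms(1)] by simp_all
      then have e: "\<rho> k = transpose 4 5 \<circ> transpose 2 3"
        using True rho_1_eq_edge_swap[OF assms(1)] by (simp add: edge_swap_def)
      show ?thesis unfolding e by (auto simp: transpose_def)
    next
      case False
      then have k: "2 \<le> k" "k < r" using rho by auto
      have "\<rho> k x = x" if "x < 4" for x
      proof (rule rho_fixes[OF k])
        show "x \<noteq> P b l" if "k \<le> l" "l \<le> r" for b l
          using P_ge_4[OF vertI[of l b]] that k \<open>x < 4\<close> by simp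
      qed
      then show ?thesis by simp
    qed
  next
    case (comp f g)
    have "f 2 = 2 \<and> f 3 = 3 \<or> f 2 = 3 \<and> f 3 = 2" "g 2 = 2 \<and> g 3 = 3 \<or> g 2 = 3 \<and> g 3 = 2"
      using comp by (simp_all add: doubleton_eq_iff)
    then have "{(f \<circ> g) 2, (f \<circ> g) 3} = {2, 3}" by (elim disjE) (simp_all add: insert_commute)
    then show ?case using comp by simp
  qed simp
qed

text \<open>Invariants that single out the products of edge swaps on both sides up to block
  \<open>m\<close>. For \<open>i = 1\<close> the t-side consists of the positive points up to
  \<open>r + 3\<close>.\<close>

definition split_type :: "nat \<Rightarrow> (nat \<Rightarrow> nat) \<Rightarrow> bool" where
  "split_type m q \<longleftrightarrow> q permutes {1..n} \<and> evenperm q \<and> q 1 = 1 \<and> {q 2, q 3} = {2, 3} \<and>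
     (\<forall>b l. m < l \<longrightarrow> l \<le> r \<longrightarrow> q (P b l) = P b l) \<and> (\<forall>x. x \<le> r + 3 \<longrightarrow> q x \<le> r + 3)"

lemma split_typeD:
  assumes "split_type m q"
  shows "q permutes {1..n}" "evenperm q" "q 1 = 1" "{q 2, q 3} = {2, 3}"
    "m < l \<Longrightarrow> l \<le> r \<Longrightarrow> q (P b l) = P b l" "x \<le> r + 3 \<Longrightarrow> q x \<le> r + 3"
  using assms unfolding split_type_def by blast+

lemma split_type_comp:
  assumes "split_type m f" "split_type m g"
  shows "split_type m (f \<circ> g)"
  unfolding split_type_def
proof (intro conjI allI impI)
  note f = split_typeD[OF assms(1)] and g = split_typeD[OF assms(2)]
  show "(f \<circ> g) permutes {1..n}" using g(1) f(1) by (rule permutes_compose)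
  have "permutation f" "permutation g" using f(1) g(1) permutation_permutes by blast+
  then show "evenperm (f \<circ> g)" using f(2) g(2) evenperm_comp by metis
  show "(f \<circ> g) 1 = 1" using f(3) g(3) by simp
  have "f 2 = 2 \<and> f 3 = 3 \<or> f 2 = 3 \<and> f 3 = 2" "g 2 = 2 \<and> g 3 = 3 \<or> g 2 = 3 \<and> g 3 = 2"
    using f(4) g(4) by (simp_all add: doubleton_eq_iff)
  then show "{(f \<circ> g) 2, (f \<circ> g) 3} = {2, 3}" by (elim disjE) (simp_all add: insert_commute)
  show "(f \<circ> g) (P b l) = P b l" if "m < l" "l \<le> r" for b l using f(5)[OF that] g(5)[OF that] by simp
  show "(f \<circ> g) x \<le> r + 3" if "x \<le> r + 3" for x using f(6)[OF g(6)[OF that]] by simp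
qed

lemma split_type_edge_swap:
  assumes i1: "i = 1" and "1 \<le> k" "k < m" "m \<le> r" "b \<or> 2 \<le> k"
  shows "split_type m (edge_swap b k)"
proof -
  have v: "vert b k" "vert b (Suc k)" unfolding vert_def using assms by auto
  have ne: "P b k \<noteq> P b (Suc k)" using P_eq_iff[OF v] by simp
  have ge: "4 \<le> P b k" "4 \<le> P b (Suc k)" using P_ge_4 v by auto
  have le: "P b k \<le> n" "P b (Suc k) \<le> n" using P_bounds v by auto
  have n3: "3 \<le> n" using r by simp
  show ?thesis
    unfolding split_type_def
  proof (intro conjI allI impI)
    show "edge_swap b k permutes {1..n}"
      unfolding edge_swap_def by (intro permutes_compose permutes_swap_id) (use ge le n3 in auto)
    show "evenperm (edge_swap b k)"
      unfolding edge_swap_def using ne by (simp add: evenperm_comp permutation_swap_id evenperm_swap)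
    have "edge_swap b k 2 = 3" "edge_swap b k 3 = 2"
      unfolding edge_swap_def using ge by (simp_all add: transpose_def)
    then show "{edge_swap b k 2, edge_swap b k 3} = {2, 3}" by (simp add: insert_commute)
    show "edge_swap b k 1 = 1"
      unfolding edge_swap_def using ge by (simp add: transpose_def)
    show "edge_swap b k (P b' l) = P b' l" if l: "m < l" "l \<le> r" for b' l
    proof -
      have w: "vert b' l" unfolding vert_def using l assms by auto
      have "P b' l \<noteq> P b k" "P b' l \<noteq> P b (Suc k)" "4 \<le> P b' l"
        using P_eq_iff[OF w v(1)] P_eq_iff[OF w v(2)] P_ge_4[OF w] l assms(3) by auto
      then show ?thesis unfolding edge_swap_def by (simp add: transpose_def)
    qed
    show "edge_swap b k x \<le> r + 3" if "x \<le> r + 3" for x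
    proof -
      have e: "i + r + 2 = r + 3" using i1 by simp
      have s: "P b l \<le> r + 3 \<longleftrightarrow> b" if "vert b l" for l using P_le_iff[OF that] unfolding e .
      show ?thesis
        unfolding edge_swap_def using that s[OF v(1)] s[OF v(2)] ge r by (auto simp: transpose_def)
    qed
  qed
qed

lemma points_i1 [consumes 2, case_names one two three left right]:
  assumes "i = 1" "x \<in> {1..n}"
  obtains "x = 1" | "x = 2" | "x = 3" | l where "l \<in> {1..r}" "x = P True l" | l where "l \<in> {2..r}" "x = P False l"
proof -
  have "x \<le> 2 * r + 2" "1 \<le> x" using assms by auto
  then consider "x = 1" | "x = 2" | "x = 3" | "4 \<le> x" "x \<le> r + 3" | "r + 4 \<le> x" "x \<le> 2 * r + 2" by linarith
  then show thesis
  proof cases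
    case 4
    then have "x - 3 \<in> {1..r}" "x = P True (x - 3)" unfolding P_i1[OF assms(1)] by auto
    then show thesis by (rule that(4))
  next
    case 5
    then have "x - (r + 2) \<in> {2..r}" "x = P False (x - (r + 2))" unfolding P_i1[OF assms(1)] by auto
    then show thesis by (rule that(5))
  qed (use that in blast)+
qed

text \<open>Two bubble sorts: the t-side first, then the s-side with the sorted t-side as part of
  the invariant. What is left can only exchange 2 and 3, which is odd.\<close>

lemma split_type_mem:
  assumes i1: "i = 1" and H: "permutation_subgroup H n"
    and T: "\<And>k. 1 \<le> k \<Longrightarrow> k < m \<Longrightarrow> edge_swap True k \<in> H"
    and F: "\<And>k. 2 \<le> k \<Longrightarrow> k < m \<Longrightarrow> edge_swap False k \<in> H"
    and m: "m \<le> r" and q: "split_type m q"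
  shows "q \<in> H"
proof -
  interpret H: permutation_subgroup H n by fact
  have inj: "inj q" if "split_type m q" for q using split_typeD(1)[OF that] by (rule permutes_inj)
  have vT: "vert True l" if "l \<in> {1..m}" for l using that m by (auto simp: vert_def)
  have vF: "vert False l" if "l \<in> {2..m}" for l using that m by (auto simp: vert_def)
  have swap: "edge_swap b k (P b k) = P b (Suc k)" "edge_swap b k (P b (Suc k)) = P b k"
    "\<And>j. vert b j \<Longrightarrow> j \<noteq> k \<Longrightarrow> j \<noteq> Suc k \<Longrightarrow> edge_swap b k (P b j) = P b j"
    if v: "vert b k" "vert b (Suc k)" for b k
  proof -
    have ge: "4 \<le> P b j" if "vert b j" for j using P_ge_4 that .
    show "edge_swap b k (P b k) = P b (Suc k)" "edge_swap b k (P b (Suc k)) = P b k"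
      unfolding edge_swap_def using ge[OF v(1)] ge[OF v(2)] by (simp_all add: transpose_def)
    fix j assume j: "vert b j" "j \<noteq> k" "j \<noteq> Suc k"
    have "P b j \<noteq> P b k" "P b j \<noteq> P b (Suc k)" using P_eq_iff[OF j(1) v(1)] P_eq_iff[OF j(1) v(2)] j by auto
    then show "edge_swap b k (P b j) = P b j" unfolding edge_swap_def using ge[OF j(1)] by (simp add: transpose_def)
  qed
  have in_image: "q x \<notin> {1, 2, 3}" if q: "split_type m q" and x: "4 \<le> x" for q x
  proof
    assume "q x \<in> {1, 2, 3}"
    moreover have "{1, 2, 3} = {q 1, q 2, q 3}" using split_typeD(3,4)[OF q] by simp
    ultimately have "q x = q 1 \<or> q x = q 2 \<or> q x = q 3" by auto
    then show False using injD[OF inj[OF q], of x] x by auto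
  qed
  have q_in: "q x \<in> {1..n}" if "split_type m q" "x \<in> {1..n}" for q x
    using permutes_in_image[OF split_typeD(1)[OF that(1)]] that(2) by blast
  have all: "q \<in> H" if q: "split_type m q" and T: "\<forall>l\<in>{1..m}. q (P True l) = P True l"
    and F: "\<forall>l\<in>{2..m}. q (P False l) = P False l" for q
  proof -
    have "q permutes {2, 3}"
    proof (rule permutes_superset[OF split_typeD(1)[OF q]])
      fix x assume x: "x \<in> {1..n} - {2, 3}"
      then have "x \<in> {1..n}" by blast
      then show "q x = x"
      proof (rule points_i1[OF i1])
        assume "x = 1"
        then show ?thesis using split_typeD(3)[OF q] by simp
      next
        fix l assume "l \<in> {1..r}" "x = P True l"
        then show ?thesis using T split_typeD(5)[OF q, of l True] by (cases "l \<le> m") auto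
      next
        fix l assume "l \<in> {2..r}" "x = P False l"
        then show ?thesis using F split_typeD(5)[OF q, of l False] by (cases "l \<le> m") auto
      qed (use x in simp_all)
    qed
    then have "q = id \<or> q = transpose 2 3" by (simp only: permutes_doubleton_iff)
    moreover have "\<not> evenperm (transpose 2 (3::nat))" by (simp add: evenperm_swap)
    ultimately have "q = id" using split_typeD(2)[OF q] by blast
    then show ?thesis using H.id_mem by simp
  qed
  have F_sort: "q \<in> H" if q: "split_type m q" and T: "\<forall>l\<in>{1..m}. q (P True l) = P True l" for q
  proof (rule adjacent_swaps_reduction[where x = "P False" and c = 2 and m = m and \<sigma> = "edge_swap False"
        and Q = "\<lambda>q. split_type m q \<and> (\<forall>l\<in>{1..m}. q (P True l) = P True l)"])
    show "inj_on (P False) {2..m}"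
      by (rule inj_onI) (use P_eq_iff[OF vF vF] in blast)
    show "edge_swap False k (P False k) = P False (Suc k)" "edge_swap False k (P False (Suc k)) = P False k"
      if "2 \<le> k" "k < m" for k using swap[of False k] vF[of k] vF[of "Suc k"] that by auto
    show "edge_swap False k (P False j) = P False j"
      if "2 \<le> k" "k < m" "2 \<le> j" "j \<le> m" "j \<noteq> k" "j \<noteq> Suc k" for k j
      using swap(3)[OF vF vF vF, of k j] that by auto
    show "split_type m (edge_swap False k \<circ> q) \<and> (\<forall>l\<in>{1..m}. (edge_swap False k \<circ> q) (P True l) = P True l)"
      if k: "2 \<le> k" "k < m" and q: "split_type m q \<and> (\<forall>l\<in>{1..m}. q (P True l) = P True l)" for k q
    proof
      show "split_type m (edge_swap False k \<circ> q)"
        using q k m by (intro split_type_comp split_type_edge_swap i1) auto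
      show "\<forall>l\<in>{1..m}. (edge_swap False k \<circ> q) (P True l) = P True l"
      proof
        fix l assume l: "l \<in> {1..m}"
        have v: "vert False k" "vert False (Suc k)" using vF k by auto
        have "P True l \<noteq> P False k" "P True l \<noteq> P False (Suc k)" "4 \<le> P True l"
          using P_eq_iff[OF vT[OF l] v(1)] P_eq_iff[OF vT[OF l] v(2)] P_ge_4[OF vT[OF l]] by auto
        then have "edge_swap False k (P True l) = P True l"
          unfolding edge_swap_def by (simp add: transpose_def)
        then show "(edge_swap False k \<circ> q) (P True l) = P True l" using q l by simp
      qed
    qed
    show "q \<in> H" if "2 \<le> k" "k < m" "edge_swap False k \<circ> q \<in> H" for k q
      using H.comp_cancel_left[OF F] that by blast
    show "q \<in> H" if "split_type m q \<and> (\<forall>l\<in>{1..m}. q (P True l) = P True l)" "\<forall>j\<in>{2..m}. q (P False j) = P False j" for q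
      using all that by blast
    show "inj q" if "split_type m q \<and> (\<forall>l\<in>{1..m}. q (P True l) = P True l)" for q using inj that by blast
    show "split_type m q \<and> (\<forall>l\<in>{1..m}. q (P True l) = P True l)" using q T by blast
    show "q ` P False ` {2..m} \<subseteq> P False ` {2..m}"
    proof (intro image_subsetI, elim imageE, clarify)
      fix l assume l: "l \<in> {2..m}"
      note v = vF[OF l]
      have "P False l \<in> {1..n}" using P_bounds[OF v] by simp
      then have "q (P False l) \<in> {1..n}" by (rule q_in[OF q])
      with i1 show "q (P False l) \<in> P False ` {2..m}"
      proof (cases rule: points_i1)
        case (left l')
        have w: "vert True l'" using left by (auto simp: vert_def)
        have "q (P True l') = P True l'" using T left(1) split_typeD(5)[OF q, of l' True] by (cases "l' \<le> m") auto
        then have "P False l = P True l'" using left(2) injD[OF inj[OF q], of "P False l" "P True l'"] by simp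
        then show ?thesis using P_eq_iff[OF v w] by simp
      next
        case (right l')
        have w: "vert False l'" using right by (auto simp: vert_def)
        have "l' \<le> m"
        proof (rule ccontr)
          assume "\<not> l' \<le> m"
          then have "q (P False l') = q (P False l)" using right split_typeD(5)[OF q, of l' False] by simp
          then have "P False l' = P False l" by (rule injD[OF inj[OF q]])
          then show False using P_eq_iff[OF w v] l \<open>\<not> l' \<le> m\<close> by simp
        qed
        then show ?thesis using right by auto
      qed (use in_image[OF q P_ge_4[OF v]] in auto)
    qed
  qed
  show ?thesis
  proof (rule adjacent_swaps_reduction[where x = "P True" and c = 1 and m = m and \<sigma> = "edge_swap True"
        and Q = "split_type m"])
    show "inj_on (P True) {1..m}"
      by (rule inj_onI) (use P_eq_iff[OF vT vT] in blast)
    show "edge_swap True k (P True k) = P True (Suc k)" "edge_swap True k (P True (Suc k)) = P True k"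
      if "1 \<le> k" "k < m" for k using swap[of True k] vT[of k] vT[of "Suc k"] that by auto
    show "edge_swap True k (P True j) = P True j"
      if "1 \<le> k" "k < m" "1 \<le> j" "j \<le> m" "j \<noteq> k" "j \<noteq> Suc k" for k j
      using swap(3)[OF vT vT vT, of k j] that by auto
    show "split_type m (edge_swap True k \<circ> q)" if "1 \<le> k" "k < m" "split_type m q" for k q
      using that m by (intro split_type_comp split_type_edge_swap i1) auto
    show "q \<in> H" if "1 \<le> k" "k < m" "edge_swap True k \<circ> q \<in> H" for k q
      using H.comp_cancel_left[OF T] that by blast
    show "q \<in> H" if "split_type m q" "\<forall>j\<in>{1..m}. q (P True j) = P True j" for q
      using F_sort that by blast
    show "inj q" if "split_type m q" for q using inj that .
    show "split_type m q" by fact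
    show "q ` P True ` {1..m} \<subseteq> P True ` {1..m}"
    proof (intro image_subsetI, elim imageE, clarify)
      fix l assume l: "l \<in> {1..m}"
      note v = vT[OF l]
      have "P True l \<le> r + 3" using P_le_iff[OF v] i1 by simp
      then have le: "q (P True l) \<le> r + 3" by (rule split_typeD(6)[OF q])
      have "P True l \<in> {1..n}" using P_bounds[OF v] by simp
      then have "q (P True l) \<in> {1..n}" by (rule q_in[OF q])
      with i1 show "q (P True l) \<in> P True ` {1..m}"
      proof (cases rule: points_i1)
        case (left l')
        have w: "vert True l'" using left by (auto simp: vert_def)
        have "l' \<le> m"
        proof (rule ccontr)
          assume "\<not> l' \<le> m"
          then have "q (P True l') = q (P True l)" using left split_typeD(5)[OF q, of l' True] by simp
          then have "P True l' = P True l" by (rule injD[OF inj[OF q]])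
          then show False using P_eq_iff[OF w v] l \<open>\<not> l' \<le> m\<close> by simp
        qed
        then show ?thesis using left by auto
      next
        case (right l')
        have w: "vert False l'" using right by (auto simp: vert_def)
        then show ?thesis using P_le_iff[OF w] le right i1 by simp
      qed (use in_image[OF q P_ge_4[OF v]] in auto)
    qed
  qed
qed

lemma parabolic_i1_low:
  assumes i1: "i = 1" and d: "1 \<le> d" "d \<le> r - 4" and g: "g \<in> par {1..<r}" "g \<in> par {..d}"
  shows "g \<in> par {1..d}"
proof (rule split_type_mem[OF i1, of _ "Suc d"])
  have J: "{1..<r} \<subseteq> {..<r}" by auto
  show "permutation_subgroup (par {1..d}) n" using d r by (intro permutation_subgroup_par) auto
  show "edge_swap True k \<in> par {1..d}" if "1 \<le> k" "k < Suc d" for k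
    by (rule edge_swap_True_mem[OF i1]) (use that d in auto)
  show "edge_swap False k \<in> par {1..d}" if "2 \<le> k" "k < Suc d" for k
    by (rule edge_swap_mem[OF i1]) (use that d in auto)
  show "split_type (Suc d) g"
    unfolding split_type_def
  proof (intro conjI allI impI)
    show "g permutes {1..n}" using par_permutes[OF g(1) J] .
    show "evenperm g" using par_even[OF g(1) J] .
    show "g 1 = 1" "{g 2, g 3} = {2, 3}" using fixes_small[OF i1 g(1)] by blast+
    show "g (P b l) = P b l" if "Suc d < l" "l \<le> r" for b l
      by (rule par_fixes_P[OF g(2) d]) (use that in auto)
    show "g x \<le> r + 3" if "x \<le> r + 3" for x using par_side[OF g(2) d(2), of x] that i1 by simp
  qed
qed (use d r in auto)

lemma parabolic_i1_mid:
  assumes i1: "i = 1" and g: "g \<in> par {1..<r}" "g \<in> par {..r - 3}"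
  shows "g \<in> par {1..r - 3}"
proof -
  interpret H: permutation_subgroup "par {1..r - 3}" n
    using r by (intro permutation_subgroup_par) auto
  have J: "{1..<r} \<subseteq> {..<r}" by auto
  have main: "g \<in> par {1..r - 3}"
    if g: "g \<in> par {1..<r}" "g \<in> par {..r - 3}" and fixed: "\<forall>b. \<forall>l\<in>{r - 1, r}. g (P b l) = P b l" for g
  proof (rule split_type_mem[OF i1 H.permutation_subgroup_axioms, of "r - 2"])
    show "edge_swap True k \<in> par {1..r - 3}" if "1 \<le> k" "k < r - 2" for k
      by (rule edge_swap_True_mem[OF i1]) (use that r in auto)
    show "edge_swap False k \<in> par {1..r - 3}" if "2 \<le> k" "k < r - 2" for k
      by (rule edge_swap_mem[OF i1]) (use that r in auto)
    show "split_type (r - 2) g"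
      unfolding split_type_def
    proof (intro conjI allI impI)
      show "g permutes {1..n}" using par_permutes[OF g(1) J] .
      show "evenperm g" using par_even[OF g(1) J] .
      show "g 1 = 1" "{g 2, g 3} = {2, 3}" using fixes_small[OF i1 g(1)] by blast+
      show "g (P b l) = P b l" if "r - 2 < l" "l \<le> r" for b l
      proof -
        have "l = r - 1 \<or> l = r" using that by auto
        then show ?thesis using fixed by blast
      qed
      show "g x \<le> r + 3" if x: "x \<le> r + 3" for x
      proof -
        have "x \<le> i + r \<or> x = P True (r - 1) \<or> x = P True r" unfolding P_i1[OF i1] using x i1 r by auto
        then consider "x \<le> i + r" | "x = P True (r - 1)" | "x = P True r" by blast
        then show ?thesis
        proof cases
          case 1
          then have "g x \<le> i + r" by (rule par_link_side[OF g(2)])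
          then show ?thesis using i1 by simp
        next
          case 2
          then show ?thesis using fixed x by simp
        next
          case 3
          then show ?thesis using fixed x by simp
        qed
      qed
    qed
  qed simp
  obtain \<beta> where \<beta>: "\<forall>b. \<forall>l\<in>{r - 1, r}. g (P b l) = P (b \<noteq> \<beta>) l" using par_link_obtain[OF g(2)] .
  show ?thesis
  proof (cases \<beta>)
    case False
    then show ?thesis using \<beta> by (intro main[OF g]) simp_all
  next
    case True
    have f: "flip (r - 1) \<in> par {1..r - 3}" using r by (intro flip_mem) auto
    have "{1..r - 3} \<subseteq> {1..<r}" "{1..r - 3} \<subseteq> {..r - 3}" using r by auto
    then have f': "flip (r - 1) \<in> par {1..<r}" "flip (r - 1) \<in> par {..r - 3}" using f par_mono by blast+
    have v: "vert b l" if "l \<in> {r - 1, r}" for b l using that vert_r by auto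
    have "flip (r - 1) \<circ> g \<in> par {1..r - 3}"
    proof (rule main)
      show "flip (r - 1) \<circ> g \<in> par {1..<r}"
        by (rule par_comp[OF f'(1) g(1)])
      show "flip (r - 1) \<circ> g \<in> par {..r - 3}"
        by (rule par_comp[OF f'(2) g(2)])
      show "\<forall>b. \<forall>l\<in>{r - 1, r}. (flip (r - 1) \<circ> g) (P b l) = P b l"
      proof (intro allI ballI)
        fix b l assume l: "l \<in> {r - 1, r}"
        have "r - 1 < r" using r by simp
        then have "flip (r - 1) (P (\<not> b) l) = P b l"
          using flip_P[OF vert_r(2) vert_r(2) _ v[OF l], of "\<not> b"] l by auto
        moreover have "g (P b l) = P (\<not> b) l" using bspec[OF spec[OF \<beta>, of b] l] True by simp
        ultimately show "(flip (r - 1) \<circ> g) (P b l) = P b l" by simp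
      qed
    qed
    then show ?thesis using H.comp_cancel_left[OF f] by blast
  qed
qed

text \<open>Beyond the bridge label the two sides mix. Sorting is replaced by 3-cycles: the group
  contains every even permutation of the points of the blocks below \<open>r\<close>, so
  \<open>g\<close> only has to be brought to fix 2, 3 and block \<open>r\<close>.\<close>

lemma parabolic_i1_high:
  assumes i1: "i = 1" and g: "g \<in> par {1..<r}" "g \<in> par {..r - 2}"
  shows "g \<in> par {1..r - 2}"
proof -
  interpret H: permutation_subgroup "par {1..r - 2}" n
    using r by (intro permutation_subgroup_par) auto
  have J: "{1..<r} \<subseteq> {..<r}" by auto
  have sub: "{1..r - 2} \<subseteq> {1..<r}" "{1..r - 2} \<subseteq> {..r - 2}" using r by auto
  have rho: "\<rho> k \<in> par {1..r - 2}" if "1 \<le> k" "k \<le> r - 2" for k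
    by (rule rho_mem_par) (use that in simp)
  have "{1..2} \<subseteq> {1..r - 2}" using r by auto
  then have s2: "par {1..2} \<subseteq> par {1..r - 2}" by (rule par_mono)
  have sw: "edge_swap True k \<in> par {1..r - 2}" if "1 \<le> k" "k \<le> 2" for k
    by (rule subsetD[OF s2 edge_swap_True_mem[OF i1 that]]) (use r in simp)
  \<comment> \<open>The two tags \<open>transpose 2 3\<close> cancel, and two adjacent
    transpositions leave a 3-cycle.\<close>
  have "edge_swap True 1 \<circ> edge_swap True 2 = cycle3 4 5 6"
    unfolding edge_swap_def P_i1[OF i1] by (simp add: fun_eq_iff transpose_def)
  then have "cycle3 4 5 6 \<in> par {1..r - 2}" using H.comp_mem[OF sw[of 1] sw[of 2]] by simp
  then have "cycle3 6 4 5 \<in> par {1..r - 2}"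
    using H.cycle3_rotate[of "4::nat" 5 6] H.cycle3_rotate[of "5::nat" 6 4] by simp
  then have hub: "H.linked 6 4"
    unfolding H.linked_def by (intro disjI2 exI[of _ 5] conjI) simp_all
  \<comment> \<open>The points 6 and 4 are \<open>P True 3\<close> and \<open>P True 1\<close>.
    Label 1 fixes the former, the larger labels fix the latter, so no generator of the interval
    moves both.\<close>
  have fix_hub: "\<rho> k 6 = 6 \<or> \<rho> k 4 = 4" if k: "1 \<le> k" "k \<le> r - 2" for k
  proof (cases "k = 1")
    case True
    have "\<rho> 1 (P True 3) = P True 3" using rho_1_P[of True 3] r by (simp add: vert_def)
    then show ?thesis using True unfolding P_i1[OF i1] by simp
  next
    case False
    have "\<rho> k 4 = 4"
    proof (rule rho_fixes)
      show "4 \<noteq> P b l" if "k \<le> l" "l \<le> r" for b l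
        using P_i1[OF i1, of l] that False k r by (cases b) simp_all
    qed (use False k r in auto)
    then show ?thesis by simp
  qed
  have move: "H.linked 6 (\<rho> k x)" if "1 \<le> k" "k \<le> r - 2" "H.linked 6 x" for k x
    by (rule H.linked_closed[OF rho[OF that(1,2)] hub fix_hub[OF that(1,2)] that(3)])
  have LT: "H.linked 6 (P True l)" if "1 \<le> l" "l \<le> r - 1" for l
    using that
  proof (induction l rule: dec_induct)
    case base
    show ?case unfolding P_i1[OF i1] using hub by simp
  next
    case (step l)
    have "l \<le> r - 2" "l < r" using step by auto
    then have "H.linked 6 (\<rho> l (P True l))"
      by (intro move) (use step in simp_all)
    then show ?case using rho_moves[of l] step by simp
  qed
  \<comment> \<open>The bridge leads from the t-point to the s-point of block \<open>r - 1\<close>;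
    from there the labels lead downwards.\<close>
  have LF: "H.linked 6 (P False l)" if "2 \<le> l" "l \<le> r - 1" for l
    using that(2,1)
  proof (induction l rule: inc_induct)
    case base
    have k: "2 \<le> r - 3" "r - 3 < r" "1 \<le> r - 3" "r - 3 \<le> r - 2" "r - 1 \<noteq> r - 3" "r - 1 \<noteq> Suc (r - 3)"
      "1 \<le> r - 1" using r by auto
    have "H.linked 6 (\<rho> (r - 3) (P True (r - 1)))" by (rule move[OF k(3,4) LT[OF k(7) order_refl]])
    then show ?case using rho_P[OF k(1,2) vert_r(2), of True] k(5,6) by simp
  next
    case (step l)
    have k: "2 \<le> l" "l < r" "1 \<le> l" "l \<le> r - 2" "\<not> (l = r - 3 \<and> r - 1 \<le> Suc l)" "vert False (Suc l)"
      using step r by (auto simp: vert_def)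
    have "H.linked 6 (\<rho> l (P False (Suc l)))"
      by (intro move) (use step k in simp_all)
    moreover have "(l = r - 3 \<and> r - 1 \<le> Suc l) = False" using k(5) by blast
    then have "\<rho> l (P False (Suc l)) = P False l" using rho_P[OF k(1,2,6)] by (simp only: transpose_apply_second simp_thms)
    ultimately show ?case by simp
  qed
  define B where "B = P True ` {1..r - 1} \<union> P False ` {2..r - 1}"
  have linked: "H.linked u v" if "u \<in> B" "v \<in> B" for u v
  proof -
    have "H.linked 6 u" "H.linked 6 v" using that LT LF unfolding B_def by auto
    then show ?thesis using H.linked_sym H.linked_trans by blast
  qed
  have main: "h \<in> par {1..r - 2}"
    if h: "h \<in> par {1..<r}" "h 2 = 2" "\<forall>b. h (P b r) = P b r" for h
  proof (rule H.even_mem_if_linked[OF _ linked])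
    show "finite B" unfolding B_def by simp
    show "evenperm h" using par_even[OF h(1) J] .
    show "h permutes B"
    proof (rule permutes_superset[OF par_permutes[OF h(1) J]])
      fix x assume x: "x \<in> {1..n} - B"
      have small: "h 1 = 1" "{h 2, h 3} = {2, 3}" using fixes_small[OF i1 h(1)] by blast+
      then have h3: "h 3 = 3" using h(2) by (auto simp: doubleton_eq_iff)
      from x have "x \<in> {1..n}" by blast
      with i1 show "h x = x"
      proof (cases rule: points_i1)
        case (left l)
        then have "l \<notin> {1..r - 1}" using x unfolding B_def by blast
        then have "l = r" using left(1) by auto
        then show ?thesis using h(3) left(2) by simp
      next
        case (right l)
        then have "l \<notin> {2..r - 1}" using x unfolding B_def by blast
        then have "l = r" using right(1) by auto
        then show ?thesis using h(3) right(2) by simp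
      qed (use small(1) h(2) h3 in \<open>simp_all only:\<close>)
    qed
  qed
  have reduce: "h \<in> par {1..r - 2}"
    if h: "h \<in> par {1..<r}" "\<forall>b. h (P b r) = P b r" for h
  proof (cases "h 2 = 2")
    case True
    then show ?thesis using main h by blast
  next
    case False
    have h2: "h 2 = 3" using fixes_small[OF i1 h(1)] False by (auto simp: doubleton_eq_iff)
    have r1: "\<rho> 1 \<in> par {1..r - 2}" using r by (intro rho) simp_all
    then have r1': "\<rho> 1 \<in> par {1..<r}" using par_mono[OF sub(1)] by blast
    have "\<rho> 1 \<circ> h \<in> par {1..r - 2}"
    proof (rule main[OF par_comp[OF r1' h(1)]])
      have "\<rho> 1 3 = 2"
        unfolding rho_1_eq_edge_swap[OF i1] edge_swap_def P_i1[OF i1] by (simp add: transpose_def)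
      then show "(\<rho> 1 \<circ> h) 2 = 2" using h2 by simp
      have "\<rho> 1 (P b r) = P b r" for b using rho_1_P[OF vert_r(1), of b] r by simp
      then show "\<forall>b. (\<rho> 1 \<circ> h) (P b r) = P b r" using h(2) by simp
    qed
    then show ?thesis by (rule H.comp_cancel_left[OF r1])
  qed
  obtain \<beta> where \<beta>: "\<forall>b. g (P b r) = P (b \<noteq> \<beta>) r" using par_last_block[OF g(2)] by blast
  show ?thesis
  proof (cases \<beta>)
    case False
    then show ?thesis using \<beta> by (intro reduce[OF g(1)]) simp
  next
    case True
    have f: "flip (r - 1) \<in> par {1..r - 2}" using r by (intro flip_mem) auto
    then have f': "flip (r - 1) \<in> par {1..<r}" using par_mono[OF sub(1)] by blast
    have "flip (r - 1) \<circ> g \<in> par {1..r - 2}"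
    proof (rule reduce[OF par_comp[OF f' g(1)]], rule allI)
      fix b
      have "g (P b r) = P (\<not> b) r" using spec[OF \<beta>, of b] True by simp
      moreover have "flip (r - 1) (P (\<not> b) r) = P b r"
        using flip_P[OF vert_r(2) vert_r(2) _ vert_r(1), of "\<not> b"] r by simp
      ultimately show "(flip (r - 1) \<circ> g) (P b r) = P b r" by simp
    qed
    then show ?thesis by (rule H.comp_cancel_left[OF f])
  qed
qed

lemma par_singleton:
  assumes "g \<in> par {k}" "k < r"
  shows "g = id \<or> g = \<rho> k"
proof -
  have "{k} \<subseteq> {..<r}" using assms(2) by simp
  with assms(1) show ?thesis
  proof (induction rule: par_induct)
    case (comp f g)
    then show ?case
      by (elim disjE) (simp_all only: id_o o_id rho_comp_self[OF assms(2)] simp_thms)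
  qed simp_all
qed

lemma rho_neq_Suc:
  assumes "Suc k < r"
  shows "\<rho> k \<noteq> \<rho> (Suc k)"
proof
  assume e: "\<rho> k = \<rho> (Suc k)"
  have up: "\<rho> (Suc k) (P True (Suc k)) = P True (Suc (Suc k))" using assms by (intro rho_moves) simp_all
  have v: "vert True j" if "1 \<le> j" "j \<le> r" for j using that by (simp add: vert_def)
  show False
  proof (cases "k = 0")
    case True
    have "\<rho> 0 (P True (Suc (Suc 0))) = P True (Suc (Suc 0))" using rho_0_P[of 2 True] r by (simp add: numeral_2_eq_2)
    moreover have "\<rho> (Suc 0) (P True (Suc (Suc 0))) = P True (Suc 0)"
      using up rho_involution[of "Suc 0" "P True (Suc 0)"] assms True by simp
    ultimately have "P True (Suc (Suc 0)) = P True (Suc 0)" using e True by simp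
    then show False by (simp add: P_def)
  next
    case False
    then have "\<rho> k (P True (Suc k)) = P True k"
      using rho_moves[of k] rho_involution[of k "P True k"] assms by simp
    then show False using up e by (simp add: P_def)
  qed
qed

section \<open>Intervals within the last three labels\<close>

definition twist :: "bool \<Rightarrow> nat \<Rightarrow> nat" where
  "twist b l = P (b \<noteq> (l = r - 3)) l"

lemma vert_high: "r - 3 \<le> l \<Longrightarrow> l \<le> r \<Longrightarrow> vert b l"
  using r by (intro vertI) auto

lemma twist_eq_iff:
  assumes "l \<in> {r - 3..r}" "l' \<in> {r - 3..r}"
  shows "twist b l = twist b' l' \<longleftrightarrow> b = b' \<and> l = l'"
  using P_eq_iff[OF vert_high vert_high] assms unfolding twist_def by auto

text \<open>Renaming the points of block \<open>r - 3\<close> makes label \<open>r - 3\<close>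
  reverse all of the last four blocks: it exchanges the renamed block with an ordinary one and
  reverses the other two. Labels \<open>r - 2\<close> and \<open>r - 1\<close> do not move the
  renamed block and reverse nothing.\<close>

lemma rho_twist:
  assumes k: "r - 3 \<le> k" "k < r" and l: "l \<in> {r - 3..r}"
  shows "\<rho> k (twist b l) = twist (b \<noteq> (k = r - 3)) (transpose k (Suc k) l)"
proof -
  have "2 \<le> k" using k r by simp
  then have rP: "\<rho> k (twist b l) = P ((b \<noteq> (l = r - 3)) \<noteq> (k = r - 3 \<and> r - 1 \<le> l)) (transpose k (Suc k) l)"
    unfolding twist_def using rho_P[OF _ k(2) vert_high] l by simp
  define A1 A2 where "A1 \<longleftrightarrow> l = r - 3" and "A2 \<longleftrightarrow> transpose k (Suc k) l = r - 3"
  show ?thesis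
  proof (cases "k = r - 3")
    case True
    have "Suc (r - 3) = r - 2" "r - 2 \<noteq> r - 3" "r - 1 \<noteq> r - 3" "\<not> r - 1 \<le> r - 2" "\<not> r - 1 \<le> r - 3"
      "r - 2 \<noteq> r - 1" "r \<noteq> r - 3" "r \<noteq> r - 2" "r - 3 \<noteq> r - 2" "r - 1 \<noteq> r - 2"
      using r by auto
    moreover have "l = r - 3 \<or> l = r - 2 \<or> l = r - 1 \<or> l = r" using l r by auto
    ultimately have "((b \<noteq> (l = r - 3)) \<noteq> (r - 1 \<le> l)) = ((\<not> b) \<noteq> (transpose k (Suc k) l = r - 3))"
      unfolding True by (elim disjE) simp_all
    then show ?thesis using rP True unfolding twist_def by simp
  next
    case False
    then have "l = r - 3 \<longleftrightarrow> transpose k (Suc k) l = r - 3" using k by (auto simp: transpose_def)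
    then show ?thesis using rP False unfolding twist_def by simp
  qed
qed

lemma transpose_range_high:
  assumes "r - 3 \<le> k" "k < r" "l \<in> {r - 3..r}"
  shows "transpose k (Suc k) l \<in> {r - 3..r}"
  using transpose_range[of "r - 3" k r l] assms by simp

text \<open>One sign \<open>\<beta>\<close> serves all blocks: in these coordinates the group acts
  through permutations of four blocks and a single global reversal commuting with them.\<close>

lemma twist_par:
  assumes "g \<in> par {r - 3..<r}"
  shows "\<exists>\<beta>. \<forall>l\<in>{r - 3..r}. \<exists>l'\<in>{r - 3..r}. \<forall>b. g (twist b l) = twist (b \<noteq> \<beta>) l'"
proof -
  have "{r - 3..<r} \<subseteq> {..<r}" by auto
  with assms show ?thesis
  proof (induction rule: par_induct)
    case id
    show ?case by (intro exI[of _ False] ballI) auto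
  next
    case (rho k)
    then have k: "r - 3 \<le> k" "k < r" by auto
    show ?case
      by (intro exI[of _ "k = r - 3"] ballI, rule bexI[OF _ transpose_range_high[OF k]])
        (use rho_twist[OF k] in auto)
  next
    case (comp f g)
    obtain \<beta> where f: "\<forall>l\<in>{r - 3..r}. \<exists>l'\<in>{r - 3..r}. \<forall>b. f (twist b l) = twist (b \<noteq> \<beta>) l'" using comp by blast
    obtain \<gamma> where g: "\<forall>l\<in>{r - 3..r}. \<exists>l'\<in>{r - 3..r}. \<forall>b. g (twist b l) = twist (b \<noteq> \<gamma>) l'" using comp by blast
    show ?case
    proof (intro exI[of _ "\<gamma> \<noteq> \<beta>"] ballI)
      fix l assume "l \<in> {r - 3..r}"
      then obtain l1 where 1: "l1 \<in> {r - 3..r}" "\<forall>b. g (twist b l) = twist (b \<noteq> \<gamma>) l1" using g by blast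
      then obtain l2 where 2: "l2 \<in> {r - 3..r}" "\<forall>b. f (twist b l1) = twist (b \<noteq> \<beta>) l2" using f by blast
      have "(f \<circ> g) (twist b l) = twist (b \<noteq> (\<gamma> \<noteq> \<beta>)) l2" for b
        using 1 2 by (cases \<beta>; cases \<gamma>) simp_all
      then show "\<exists>l'\<in>{r - 3..r}. \<forall>b. (f \<circ> g) (twist b l) = twist (b \<noteq> (\<gamma> \<noteq> \<beta>)) l'" using 2(1) by blast
    qed
  qed
qed

text \<open>\<open>\<rho> (r - 3)\<close> lies in all three groups and carries the global reversal,
  so a multiplication by it makes the sign trivial.\<close>

lemma twist_normalize:
  assumes g: "g \<in> par {r - 3..<r}" "g \<in> par {..d}" and d: "r - 3 \<le> d" "d < r"
    and main: "\<And>g. g \<in> par {r - 3..<r} \<Longrightarrow> g \<in> par {..d} \<Longrightarrow>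
      \<forall>l\<in>{r - 3..r}. \<exists>l'\<in>{r - 3..r}. \<forall>b. g (twist b l) = twist b l' \<Longrightarrow> g \<in> par {r - 3..d}"
  shows "g \<in> par {r - 3..d}"
proof -
  have k: "r - 3 \<le> r - 3" "r - 3 < r" using r by auto
  obtain \<beta> where \<beta>: "\<forall>l\<in>{r - 3..r}. \<exists>l'\<in>{r - 3..r}. \<forall>b. g (twist b l) = twist (b \<noteq> \<beta>) l'"
    using twist_par[OF g(1)] by blast
  show ?thesis
  proof (cases \<beta>)
    case False
    then show ?thesis using \<beta> by (intro main[OF g]) simp
  next
    case True
    have m: "\<rho> (r - 3) \<in> par {r - 3..<r}" "\<rho> (r - 3) \<in> par {..d}" "\<rho> (r - 3) \<in> par {r - 3..d}"
      by (rule rho_mem_par, use d r in simp)+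
    have J: "{r - 3..<r} \<subseteq> {..<r}" "{..d} \<subseteq> {..<r}" "{r - 3..d} \<subseteq> {..<r}" using d by auto
    have "\<rho> (r - 3) \<circ> g \<in> par {r - 3..d}"
    proof (rule main)
      show "\<rho> (r - 3) \<circ> g \<in> par {r - 3..<r}"
        by (rule par_comp[OF m(1) g(1)])
      show "\<rho> (r - 3) \<circ> g \<in> par {..d}"
        by (rule par_comp[OF m(2) g(2)])
      show "\<forall>l\<in>{r - 3..r}. \<exists>l'\<in>{r - 3..r}. \<forall>b. (\<rho> (r - 3) \<circ> g) (twist b l) = twist b l'"
      proof
        fix l assume "l \<in> {r - 3..r}"
        then obtain l1 where 1: "l1 \<in> {r - 3..r}" "\<forall>b. g (twist b l) = twist (b \<noteq> \<beta>) l1" using \<beta> by blast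
        have "(\<rho> (r - 3) \<circ> g) (twist b l) = twist b (transpose (r - 3) (Suc (r - 3)) l1)" for b
          using 1(2) True rho_twist[OF k 1(1), of "\<not> b"] by simp
        then show "\<exists>l'\<in>{r - 3..r}. \<forall>b. (\<rho> (r - 3) \<circ> g) (twist b l) = twist b l'"
          using transpose_range_high[OF k 1(1)] by blast
      qed
    qed
    then show ?thesis
      using permutation_subgroup.comp_cancel_left[OF permutation_subgroup_par[OF J(3)] m(3)] by blast
  qed
qed

lemma P_as_twist: "P b l = twist (b \<noteq> (l = r - 3)) l"
  unfolding twist_def by (cases "l = r - 3") simp_all

text \<open>The labels up to \<open>r - 3\<close> keep the last two blocks in place, so at most the
  blocks \<open>r - 3\<close> and \<open>r - 2\<close> are exchanged. Without the global reversal
  this exchange would, because of the renaming, carry a t-point to the s-side.\<close>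

lemma parabolic_top_2:
  assumes g: "g \<in> par {r - 3..<r}" "g \<in> par {..r - 3}"
  shows "g \<in> par {r - 3..r - 3}"
proof (rule twist_normalize[OF g])
  fix g assume g: "g \<in> par {r - 3..<r}" "g \<in> par {..r - 3}"
    and tw: "\<forall>l\<in>{r - 3..r}. \<exists>l'\<in>{r - 3..r}. \<forall>b. g (twist b l) = twist b l'"
  have J: "{r - 3..<r} \<subseteq> {..<r}" by auto
  note inj = par_inj[OF g(1) J]
  obtain \<beta> where \<beta>: "\<forall>b. \<forall>l\<in>{r - 1, r}. g (P b l) = P (b \<noteq> \<beta>) l"
    using par_link_obtain[OF g(2)] .
  note side = par_link_side[OF g(2)]
  have mem: "r - 3 \<in> {r - 3..r}" "r - 2 \<in> {r - 3..r}" "r - 1 \<in> {r - 3..r}" "r \<in> {r - 3..r}" using r by auto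
  have ne: "r - 2 \<noteq> r - 3" "r - 1 \<noteq> r - 3" "r \<noteq> r - 3" "r - 2 \<noteq> r - 1" "r - 2 \<noteq> r" using r by auto
  have fixed: "g (twist b l) = twist b l" if l: "l \<in> {r - 1, r}" for b l
  proof -
    have lm: "l \<in> {r - 3..r}" "l \<noteq> r - 3" using l mem ne by auto
    then obtain l' where l': "l' \<in> {r - 3..r}" "\<forall>b. g (twist b l) = twist b l'" using tw by blast
    have "g (twist b l) = twist (b \<noteq> \<beta>) l" 
      using bspec[OF spec[OF \<beta>, of b] l] lm(2) unfolding twist_def by simp
    then have "twist b l' = twist (b \<noteq> \<beta>) l" using l'(2) by simp
    then have "l' = l" using twist_eq_iff[OF l'(1) lm(1)] by blast
    then show ?thesis using l'(2) by simp
  qed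
  have uniq: "l' \<noteq> l''" if "l \<in> {r - 3..r}" "g (twist b l) = twist b l'" "g (twist b l'') = twist b l''" "l'' \<in> {r - 3..r}" "l \<noteq> l''" for b l l' l''
  proof
    assume "l' = l''"
    then have "g (twist b l) = g (twist b l'')" using that by simp
    then have "twist b l = twist b l''" by (rule injD[OF inj])
    then show False using twist_eq_iff[OF that(1,4)] that(5) by blast
  qed
  have split: "l = r - 3 \<or> l = r - 2 \<or> l = r - 1 \<or> l = r" if "l \<in> {r - 3..r}" for l using that r by auto
  have f3: "g (twist b (r - 3)) = twist b (r - 3)" for b
  proof -
    obtain l' where l': "l' \<in> {r - 3..r}" "\<forall>b. g (twist b (r - 3)) = twist b l'" using tw mem(1) by blast
    have "l' \<noteq> r - 1" using uniq[OF mem(1) _ fixed mem(3), of False l'] l'(2) ne by auto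
    moreover have "l' \<noteq> r" using uniq[OF mem(1) _ fixed mem(4), of False l'] l'(2) ne by auto
    moreover have "l' \<noteq> r - 2"
    proof
      assume e: "l' = r - 2"
      have "P True (r - 3) \<le> i + r" by (simp add: P_def) (use r in simp)
      then have "g (P True (r - 3)) \<le> i + r" by (rule side)
      moreover have "g (P True (r - 3)) = P False (r - 2)"
        using l'(2) e ne by (simp add: P_as_twist[of True] P_as_twist[of False])
      ultimately show False using P_le_iff[of False "r - 2"] vert_high[of "r - 2" False] r by simp
    qed
    ultimately have "l' = r - 3" using split[OF l'(1)] by blast
    then show ?thesis using l'(2) by simp
  qed
  have f2: "g (twist b (r - 2)) = twist b (r - 2)" for b
  proof -
    obtain l' where l': "l' \<in> {r - 3..r}" "\<forall>b. g (twist b (r - 2)) = twist b l'" using tw mem(2) by blast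
    have "l' \<noteq> r - 1" using uniq[OF mem(2) _ fixed mem(3), of False l'] l'(2) ne by auto
    moreover have "l' \<noteq> r" using uniq[OF mem(2) _ fixed mem(4), of False l'] l'(2) ne by auto
    moreover have "l' \<noteq> r - 3" using uniq[OF mem(2) _ f3 mem(1), of False l'] l'(2) ne by auto
    ultimately have "l' = r - 2" using split[OF l'(1)] by blast
    then show ?thesis using l'(2) by simp
  qed
  have "g x = x" for x
  proof (cases "\<exists>b l. l \<in> {r - 3..r} \<and> x = P b l")
    case True
    then obtain b l where l: "l \<in> {r - 3..r}" "x = twist b l" using P_as_twist by metis
    then show ?thesis using split[OF l(1)] f3 f2 fixed by auto
  next
    case False
    then show ?thesis by (intro par_outside[OF g(1)]) (use r in auto)
  qed
  then have "g = id" by auto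
  then show "g \<in> par {r - 3..r - 3}"
    using permutation_subgroup.id_mem[OF permutation_subgroup_par[of "{r - 3..r - 3}"]] r by auto
qed (use r in auto)

lemma parabolic_top_3:
  assumes g: "g \<in> par {r - 3..<r}" "g \<in> par {..r - 2}"
  shows "g \<in> par {r - 3..r - 2}"
proof (rule twist_normalize[OF g])
  fix g assume g: "g \<in> par {r - 3..<r}" "g \<in> par {..r - 2}"
    and tw: "\<forall>l\<in>{r - 3..r}. \<exists>l'\<in>{r - 3..r}. \<forall>b. g (twist b l) = twist b l'"
  interpret H: permutation_subgroup "par {r - 3..r - 2}" n
    using r by (intro permutation_subgroup_par) auto
  have J: "{r - 3..<r} \<subseteq> {..<r}" by auto
  note inj = par_inj[OF g(1) J]
  have rr: "r \<in> {r - 3..r}" "r \<noteq> r - 3" using r by auto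
  obtain \<beta> where \<beta>: "\<forall>b. g (P b r) = P (b \<noteq> \<beta>) r" using par_last_block[OF g(2)] by blast
  have fixed: "g (twist b r) = twist b r" for b
  proof -
    obtain l' where l': "l' \<in> {r - 3..r}" "\<forall>b. g (twist b r) = twist b l'" using tw rr by blast
    have "g (twist b r) = twist (b \<noteq> \<beta>) r" using \<beta> rr(2) unfolding twist_def by simp
    then have "twist b l' = twist (b \<noteq> \<beta>) r" using l'(2) by simp
    then have "l' = r" using twist_eq_iff[OF l'(1) rr(1)] by blast
    then show ?thesis using l'(2) by simp
  qed
  have small: "l \<in> {r - 3..r}" if "l \<in> {r - 3..r - 1}" for l using that by auto
  have eq: "r - 3 \<le> k \<Longrightarrow> k < r - 1 \<Longrightarrow> k = r - 3 \<or> k = r - 2" for k by linarith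
  \<comment> \<open>The cube contains label \<open>r - 3\<close> three times while its block
    permutations cancel, so it is the global reversal; multiplied by \<open>\<rho> (r - 3)\<close>
    it leaves the pure exchange of two blocks.\<close>
  define \<sigma> where "\<sigma> k = (if k = r - 3 then (\<rho> (r - 3) \<circ> \<rho> (r - 2)) ^^ 3 \<circ> \<rho> (r - 3) else \<rho> k)" for k
  have m: "\<rho> (r - 3) \<in> par {r - 3..r - 2}" "\<rho> (r - 2) \<in> par {r - 3..r - 2}"
    by (rule rho_mem_par, use r in simp)+
  define k3 k2 k1 where k_def: "k3 = r - 3" "k2 = r - 2" "k1 = r - 1"
  have k: "k3 \<le> k3" "k3 < r" "k3 \<le> k2" "k2 < r" "Suc k3 = k2" "Suc k2 = k1" "k2 \<noteq> k3" "k1 \<noteq> k3" "k1 \<noteq> k2" "r \<noteq> k3" "r \<noteq> k2" "r \<noteq> k1" "k1 \<le> r" "k2 \<le> r" "k3 \<le> k1"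
    using r unfolding k_def by auto
  note tw3 = rho_twist[OF k(1,2)[unfolded k_def], folded k_def, unfolded k(5)]
    and tw2 = rho_twist[OF k(3,4)[unfolded k_def], folded k_def, unfolded k(6)]
  have in4: "k3 \<in> {k3..r}" "k2 \<in> {k3..r}" "k1 \<in> {k3..r}" "r \<in> {k3..r}" using k by auto
  have \<sigma>3: "((\<rho> k3 \<circ> \<rho> k2) ^^ 3 \<circ> \<rho> k3) (twist b l) = twist b (transpose k3 k2 l)" if l: "l \<in> {k3..r}" for b l
  proof -
    have "l = k3 \<or> l = k2 \<or> l = k1 \<or> l = r" using l unfolding k_def by auto
    then consider "l = k3" | "l = k2" | "l = k1" | "l = r" by blast
    then show ?thesis
      using in4 k(7-12) k(7-12)[symmetric] by cases (simp_all add: funpow_3 tw3 tw2)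
  qed
  show "g \<in> par {r - 3..r - 2}"
  proof (rule H.diagonal_mem[of "r - 3" "r - 1" twist \<sigma>])
    show "b = b' \<and> l = l'" if "l \<in> {r - 3..r - 1}" "l' \<in> {r - 3..r - 1}" "twist b l = twist b' l'" for b b' l l'
      using twist_eq_iff[OF small[OF that(1)] small[OF that(2)]] that(3) by blast
    show "\<sigma> k \<in> par {r - 3..r - 2}" if "r - 3 \<le> k" "k < r - 1" for k
    proof (cases "k = r - 3")
      case True
      have "(\<rho> (r - 3) \<circ> \<rho> (r - 2)) ^^ 3 \<circ> \<rho> (r - 3) \<in> par {r - 3..r - 2}"
        by (intro H.comp_mem H.funpow_mem m)
      then show ?thesis unfolding \<sigma>_def if_P[OF True] .
    next
      case False
      then show ?thesis using eq[OF that] m(2) unfolding \<sigma>_def if_not_P[OF False] by blast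
    qed
    show "\<sigma> k (twist b l) = twist b (transpose k (Suc k) l)"
      if "r - 3 \<le> k" "k < r - 1" "l \<in> {r - 3..r - 1}" for k b l
    proof (cases "k = r - 3")
      case True
      show ?thesis unfolding \<sigma>_def if_P[OF True] True
        using \<sigma>3[of l b] small[OF that(3)] k(5) unfolding k_def by simp
    next
      case False
      have "k < r" using that by simp
      then show ?thesis unfolding \<sigma>_def if_not_P[OF False]
        using rho_twist[OF that(1) _ small[OF that(3)]] False by simp
    qed
    show "\<sigma> k x = x" if "r - 3 \<le> k" "k < r - 1" "\<forall>b. \<forall>l\<in>{r - 3..r - 1}. x \<noteq> twist b l" for k x
    proof (cases "\<exists>b. x = twist b r")
      case True
      then obtain b where x: "x = twist b r" by blast
      show ?thesis
      proof (cases "k = r - 3")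
        case True
        show ?thesis unfolding \<sigma>_def if_P[OF True] x
          using \<sigma>3[OF in4(4), of b] k(10,11) unfolding k_def by simp
      next
        case False
        have "k < r" "r \<noteq> k" "r \<noteq> Suc k" using that by auto
        then show ?thesis unfolding \<sigma>_def if_not_P[OF False] x
          using rho_twist[OF that(1) _ rr(1)] False by simp
      qed
    next
      case False
      have x: "x \<noteq> P b l" if "r - 3 \<le> l" "l \<le> r" for b l
      proof -
        have "l = r \<or> l \<in> {r - 3..r - 1}" using that by auto
        then show ?thesis using False \<open>\<forall>b. \<forall>l\<in>{r - 3..r - 1}. x \<noteq> twist b l\<close> P_as_twist by metis
      qed
      have rx: "\<rho> j x = x" if "r - 3 \<le> j" "j < r" for j
        by (rule rho_fixes) (use that x r in auto)
      have "\<rho> (r - 3) x = x" "\<rho> (r - 2) x = x" using rx r by auto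
      then have "\<sigma> (r - 3) x = x" unfolding \<sigma>_def by (simp add: funpow_3)
      moreover have "\<sigma> (r - 2) x = x" unfolding \<sigma>_def using \<open>\<rho> (r - 2) x = x\<close> k(7) unfolding k_def by simp
      ultimately show ?thesis using eq[OF that(1,2)] by auto
    qed
    show "diagonal twist (r - 3) (r - 1) g"
    proof (rule diagonalI[OF inj])
      show "\<exists>l'\<in>{r - 3..r - 1}. \<forall>b. g (twist b l) = twist b l'" if l: "l \<in> {r - 3..r - 1}" for l
      proof -
        obtain l' where l': "l' \<in> {r - 3..r}" "\<forall>b. g (twist b l) = twist b l'" using tw small[OF l] by blast
        have "l' \<noteq> r"
        proof
          assume "l' = r"
          then have "g (twist True l) = g (twist True r)" using l'(2) fixed by simp
          then have "twist True l = twist True r" by (rule injD[OF inj])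
          then show False using twist_eq_iff[OF small[OF l] rr(1)] l r by auto
        qed
        then have "l' \<in> {r - 3..r - 1}" using l'(1) by auto
        then show ?thesis using l'(2) by blast
      qed
      show "g x = x" if x: "\<And>b l. l \<in> {r - 3..r - 1} \<Longrightarrow> x \<noteq> twist b l" for x
      proof (cases "\<exists>b. x = twist b r")
        case True
        then show ?thesis using fixed by blast
      next
        case False
        show ?thesis
        proof (rule par_outside[OF g(1)])
          show "x \<noteq> P b l" if "l \<in> {r - 3..r}" for b l
          proof -
            have "l = r \<or> l \<in> {r - 3..r - 1}" using that by auto
            then show ?thesis using False x P_as_twist by metis
          qed
        qed (use r in simp)
      qed
    qed
  qed
qed (use r in auto)

text \<open>Labels \<open>r - 2\<close> and \<open>r - 1\<close> reverse no block at all. Only the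
  place of block \<open>r\<close> has to be controlled, and the labels up to \<open>r - 2\<close> do
  not change it.\<close>

lemma parabolic_top_1:
  assumes g: "g \<in> par {r - 2..<r}" "g \<in> par {..r - 2}"
  shows "g \<in> par {r - 2..r - 2}"
proof -
  interpret H: permutation_subgroup "par {r - 2..r - 2}" n
    using r by (intro permutation_subgroup_par) auto
  have J: "{r - 2..<r} \<subseteq> {..<r}" by auto
  have v: "vert b l" if "l \<in> {r - 2..r}" for b l using that r by (intro vertI) auto
  have c: "1 \<le> r - 2" "2 \<le> r - 2" using r by auto
  have "diagonal P (r - 2) r g"
    using g(1) J
  proof (induction rule: par_induct)
    case id
    show ?case by (rule diagonalI) auto
  next
    case (rho k)
    then have k: "r - 2 \<le> k" "k < r" "2 \<le> k" "k \<noteq> r - 3" using r by auto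
    show ?case
    proof (rule diagonalI)
      show "inj (\<rho> k)" using rho_permutes[OF k(2)] by (rule permutes_inj)
      show "\<exists>l'\<in>{r - 2..r}. \<forall>b. \<rho> k (P b l) = P b l'" if l: "l \<in> {r - 2..r}" for l
        by (rule bexI[of _ "transpose k (Suc k) l"])
          (use rho_P[OF k(3,2) v[OF l]] k(4) transpose_range[of "r - 2" k r l] k l in simp_all)
      show "\<rho> k x = x" if "\<And>b l. l \<in> {r - 2..r} \<Longrightarrow> x \<noteq> P b l" for x
        by (rule rho_fixes[OF k(3,2)]) (use that k(1) in simp)
    qed
  next
    case (comp f g)
    then show ?case by (rule diagonal_comp)
  qed
  then have dg: "\<exists>l'\<in>{r - 2..r}. \<forall>b. g (P b l) = P b l'" if "l \<in> {r - 2..r}" for l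
    using diagonal_obtain[of P "r - 2" r g l] that by metis
  have rr: "r \<in> {r - 2..r}" using r by simp
  obtain \<beta> where \<beta>: "\<forall>b. g (P b r) = P (b \<noteq> \<beta>) r" using par_last_block[OF g(2)] by blast
  have fixed: "g (P b r) = P b r" for b
  proof -
    obtain l' where l': "l' \<in> {r - 2..r}" "\<forall>b. g (P b r) = P b l'" using dg[OF rr] by blast
    then have "P b l' = P (b \<noteq> \<beta>) r" using \<beta> by metis
    then have "l' = r" using P_eq_iff[OF v[OF l'(1)] v[OF rr]] by blast
    then show ?thesis using l'(2) by simp
  qed
  have "diagonal P (r - 2) (r - 1) g"
  proof (rule diagonal_if_blocks)
    show "inj g" by (rule par_inj[OF g(1) J])
    show "blocks (r - 2) g" by (rule blocks_par[OF g(1)]) (use c in auto)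
    show "g (P b l) = P b l" if "l \<in> {r - 2..r}" "r - 1 < l" for b l
    proof -
      have "l = r" using that by auto
      then show ?thesis using fixed by simp
    qed
    show "g (P True l) \<le> i + r + 2" if "l \<in> {r - 2..r - 1}" for l
    proof -
      have "l \<in> {r - 2..r}" using that by auto
      then obtain l' where "l' \<in> {r - 2..r}" "\<forall>b. g (P b l) = P b l'" using dg by blast
      then show ?thesis using P_le_iff[OF v] by simp
    qed
    show "g x = x" if "\<And>b l. l \<in> {r - 2..r} \<Longrightarrow> x \<noteq> P b l" for x
      by (rule par_outside[OF g(1) c(2) that])
  qed (use c r in auto)
  then show ?thesis
  proof (rule diagonal_P_mem[OF H.permutation_subgroup_axioms, rotated -1])
    show "swap_block k \<in> par {r - 2..r - 2}" if "r - 2 \<le> k" "k < r - 1" for k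
    proof -
      have "k = r - 2" "k \<noteq> 1" "k \<noteq> r - 3" using that r by auto
      then show ?thesis using rho_mem_par[of k "{r - 2..r - 2}"] by (simp add: swap_block_def)
    qed
  qed (use c r in auto)
qed

text \<open>Label 1 is the only label of the interval that moves points outside the blocks, and it
  maps the set of these points to itself; only the two powers of this involution can occur.\<close>

lemma outside_par_1:
  assumes "2 \<le> i" "g \<in> par {1..<r}"
  shows "(\<forall>x. (\<forall>b. \<forall>l\<in>{1..r}. x \<noteq> P b l) \<longrightarrow> g x = x) \<or> (\<forall>x. (\<forall>b. \<forall>l\<in>{1..r}. x \<noteq> P b l) \<longrightarrow> g x = \<rho> 1 x)"
proof -
  define O1 where "O1 = {x. \<forall>b. \<forall>l\<in>{1..r}. x \<noteq> P b l}"
  have O1: "\<rho> 1 x \<in> O1" if "x \<in> O1" for x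
    using cube_1_2_outside(2)[OF assms(1), of x] that unfolding O1_def by blast
  have inv: "\<rho> 1 (\<rho> 1 x) = x" for x using rho_involution[of 1] r by simp
  have "{1..<r} \<subseteq> {..<r}" by auto
  with assms(2) have "(\<forall>x\<in>O1. g x = x) \<or> (\<forall>x\<in>O1. g x = \<rho> 1 x)"
  proof (induction rule: par_induct)
    case (rho k)
    show ?case
    proof (cases "k = 1")
      case False
      then have k: "2 \<le> k" "k < r" using rho by auto
      have "\<rho> k x = x" if "x \<in> O1" for x
        by (rule rho_fixes[OF k]) (use that k in \<open>auto simp: O1_def\<close>)
      then show ?thesis by blast
    qed simp
  next
    case (comp f g)
    then show ?case using O1 inv by (elim disjE) simp_all
  qed simp
  then show ?thesis unfolding O1_def by blast
qed

text \<open>Rotations of the dihedral group of labels 0 and 1 commute with the product of the two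
  generators, reflections invert it.\<close>

lemma dihedral_relation:
  assumes "g \<in> par {..1}"
  shows "(\<forall>x. g (\<rho> 0 (\<rho> 1 x)) = \<rho> 0 (\<rho> 1 (g x)) \<and> g (\<rho> 1 (\<rho> 0 x)) = \<rho> 1 (\<rho> 0 (g x))) \<or>
    (\<forall>x. g (\<rho> 0 (\<rho> 1 x)) = \<rho> 1 (\<rho> 0 (g x)) \<and> g (\<rho> 1 (\<rho> 0 x)) = \<rho> 0 (\<rho> 1 (g x)))"
proof -
  have "{..1} \<subseteq> {..<r}" using r by auto
  with assms show ?thesis
  proof (induction rule: par_induct)
    case (rho k)
    then have "k = 0 \<or> k = 1" by auto
    moreover have "\<rho> 0 (\<rho> 0 x) = x" "\<rho> 1 (\<rho> 1 x) = x" for x using rho_involution r by auto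
    ultimately show ?case by (elim disjE) simp_all
  next
    case (comp f g)
    then show ?case by (elim disjE) simp_all
  qed simp
qed

text \<open>The target contains label 1 only, so the cube of the product of labels 1 and 2 cannot
  correct the action outside the blocks; the dihedral group of labels 0 and 1 has to control
  it.\<close>

lemma parabolic_1_1:
  assumes i2: "2 \<le> i" and g: "g \<in> par {1..2}" "g \<in> par {..1}"
  shows "g \<in> par {1..1}"
proof -
  interpret H: permutation_subgroup "par {1..1}" n
    using r by (intro permutation_subgroup_par) auto
  have r1: "\<rho> 1 \<in> par {1..2}" "\<rho> 1 \<in> par {..1}" "\<rho> 1 \<in> par {1..1}" by (rule rho_mem_par, simp)+
  have J: "{1..<r} \<subseteq> {..<r}" by auto
  have "{1..2} \<subseteq> {1..<r}" using r by auto
  then have sub: "par {1..2} \<subseteq> par {1..<r}" by (rule par_mono)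
  have v: "vert b l" if "l \<in> {1..r}" for b l using that i2 by (auto simp: vert_def)
  have mem: "1 \<in> {1..r}" "2 \<in> {1..r}" using r by auto
  have P1: "P True 1 = i + 3" and P2: "P True 2 = i + 4" by (simp_all add: P_def)
  have "\<rho> 1 (P True 2) = P True 1" "\<rho> 1 (P True 1) = P True 2"
    using rho_1_P[OF v[OF mem(2)], of True] rho_1_P[OF v[OF mem(1)], of True] by simp_all
  then have r1v: "\<rho> 1 (i + 4) = i + 3" "\<rho> 1 (i + 3) = i + 4" by (simp_all only: P1 P2)
  have r0v: "\<rho> 0 (i + 4) = i + 4" "\<rho> 0 (i + 3) = i + 2"
    using rho_path[of 0 "i + 4"] rho_path[of 0 "i + 3"] by (simp_all add: path_step_def)
  have r1u: "\<rho> 1 (i + 2) = i + 1" using rho_path[of 1 "i + 2"] i2 by (simp add: path_step_def)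
  have main: "g = id" if g: "g \<in> par {1..2}" "g \<in> par {..1}" and fx0: "g (P True 1) = P True 1" "g (P True 2) = P True 2" for g
  proof -
    have gr: "g \<in> par {1..<r}" using g(1) sub by blast
    have fx: "g (i + 3) = i + 3" "g (i + 4) = i + 4" using that(3,4) by (simp_all only: P1 P2)
    have u: "i + 2 \<noteq> P b l" if "l \<in> {1..r}" for b l using that r by (auto simp: P_def)
    \<comment> \<open>The product of labels 0 and 1 takes \<open>i + 4\<close> to
      \<open>i + 2\<close>. By the dihedral relation an element fixing \<open>i + 4\<close> sends
      \<open>i + 2\<close> to \<open>i + 2\<close> or to
      \<open>\<rho> 1 (\<rho> 0 (i + 4)) = i + 3\<close>, never to
      \<open>\<rho> 1 (i + 2) = i + 1\<close>.\<close>
    have "g (i + 2) \<noteq> \<rho> 1 (i + 2)"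
    proof
      assume a: "g (i + 2) = \<rho> 1 (i + 2)"
      have "g (\<rho> 0 (\<rho> 1 (i + 4))) = \<rho> 0 (\<rho> 1 (g (i + 4))) \<or> g (\<rho> 0 (\<rho> 1 (i + 4))) = \<rho> 1 (\<rho> 0 (g (i + 4)))"
        using dihedral_relation[OF g(2)] by blast
      then show False using a unfolding fx r1v r0v r1u by simp
    qed
    then have out: "g x = x" if "\<And>b l. l \<in> {1..r} \<Longrightarrow> x \<noteq> P b l" for x
      using outside_par_1[OF i2 gr] u that by blast
    have "g (P b l) = P b l" if l: "l \<in> {1..r}" for b l
    proof (cases "l \<le> 2")
      case True
      then have "g (P True l) = P True l" using that(1) fx0 by (cases "l = 1"; cases "l = 2") auto
      moreover obtain l' \<gamma> where l': "l' \<in> {1..r}" "\<forall>b. g (P b l) = P (b \<noteq> \<gamma>) l'"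
        using blocks_obtain[OF blocks_par[OF gr] l] i2 by auto
      ultimately have "P (True \<noteq> \<gamma>) l' = P True l" by simp
      then have "\<not> \<gamma>" "l' = l" using P_eq_iff[OF v[OF l'(1)] v[OF l]] by auto
      then show ?thesis using l'(2) by simp
    next
      case False
      then show ?thesis by (intro par_fixes_P[OF g(2)]) (use l r in auto)
    qed
    then have "g x = x" for x
      using out[of x] by (cases "\<exists>b l. l \<in> {1..r} \<and> x = P b l") auto
    then show "g = id" by auto
  qed
  have gr: "g \<in> par {1..<r}" using g(1) sub by blast
  obtain l' \<gamma> where l': "l' \<in> {1..r}" "\<forall>b. g (P b 1) = P (b \<noteq> \<gamma>) l'"
    using blocks_obtain[OF blocks_par[OF gr] mem(1)] i2 by auto
  obtain l2 \<gamma>2 where l2: "l2 \<in> {1..r}" "\<forall>b. g (P b 2) = P (b \<noteq> \<gamma>2) l2"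
    using blocks_obtain[OF blocks_par[OF gr] mem(2)] i2 by auto
  have J1: "{..1} \<subseteq> {..<r}" "{1..2} \<subseteq> {..<r}" using r by auto
  have d1: "1 \<le> r - 4" using r by simp
  have side: "b" if "g (P True l) = P b l'" "l \<in> {1..r}" "l' \<in> {1..r}" for b l l'
    using par_side[OF g(2) d1, of "P True l"] P_le_iff[OF v[OF that(2)], of True] P_le_iff[OF v[OF that(3)], of b] that(1) by simp
  have le: "l' \<le> 2" if "g (P True l) = P b l'" "l \<in> {1..2}" "l' \<in> {1..r}" for b l l'
  proof (rule ccontr)
    assume "\<not> l' \<le> 2"
    then have "g (P b l') = P b l'" by (intro par_fixes_P[OF g(2)]) (use that r in auto)
    then have "g (P b l') = g (P True l)" using that by simp
    then have "P b l' = P True l" by (rule injD[OF par_inj[OF gr J]])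
    moreover have "l \<in> {1..r}" using that(2) r by auto
    ultimately show False using P_eq_iff[OF v[OF that(3)] v] that(2) \<open>\<not> l' \<le> 2\<close> by auto
  qed
  have "\<not> \<gamma>" "\<not> \<gamma>2" using side[of 1 "True \<noteq> \<gamma>" l'] side[of 2 "True \<noteq> \<gamma>2" l2] l' l2 mem by auto
  then have e1: "g (P True 1) = P True l'" and e2: "g (P True 2) = P True l2" using l' l2 by simp_all
  have "l' \<le> 2" "l2 \<le> 2" using le[of 1 True l'] le[of 2 True l2] e1 e2 l'(1) l2(1) by auto
  moreover have "l' \<noteq> l2"
  proof
    assume "l' = l2"
    then have "g (P True 1) = g (P True 2)" using e1 e2 by simp
    then have "P True 1 = P True 2" by (rule injD[OF par_inj[OF gr J]])
    then show False by (simp add: P_def)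
  qed
  ultimately consider "l' = 1" "l2 = 2" | "l' = 2" "l2 = 1" using l'(1) l2(1) by (auto simp: le_Suc_eq numeral_2_eq_2)
  then show ?thesis
  proof cases
    case 1
    then show ?thesis using main[OF g] e1 e2 H.id_mem by simp
  next
    case 2
    have "\<rho> 1 \<circ> g = id"
    proof (rule main)
      show "\<rho> 1 \<circ> g \<in> par {1..2}"
        by (rule par_comp[OF r1(1) g(1)])
      show "\<rho> 1 \<circ> g \<in> par {..1}"
        by (rule par_comp[OF r1(2) g(2)])
      show "(\<rho> 1 \<circ> g) (P True 1) = P True 1" "(\<rho> 1 \<circ> g) (P True 2) = P True 2"
        unfolding o_apply e1 e2 2 unfolding P1 P2 by (simp_all only: r1v)
    qed
    then show ?thesis using H.comp_cancel_left[OF r1(3)] H.id_mem by metis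
  qed
qed

section \<open>The intersection property\<close>

lemma par_id: "id \<in> par J"
  using generate.one[of "sym_group n" "\<rho> ` J"] by (simp only: sym_group_one)

text \<open>\<open>\<tau>\<close> is trivial on the blocks and acts as label 1 elsewhere.
  Multiplying by it removes the action outside the blocks, as the condition \<open>outside\<close>
  of the general lemmas demands.\<close>

lemma parabolic_c_1:
  assumes i2: "2 \<le> i" and d: "2 \<le> d" "d \<le> r - 2" and g: "g \<in> par {1..Suc d}" "g \<in> par {..d}"
  shows "g \<in> par {1..d}"
proof -
  interpret H: permutation_subgroup "par {1..d}" n
    using d r by (intro permutation_subgroup_par) auto
  define \<tau> where "\<tau> = (\<rho> 1 \<circ> \<rho> 2) ^^ 3"
  have "\<rho> 1 \<in> par {1..d}" "\<rho> 2 \<in> par {1..d}" by (rule rho_mem_par, use d in simp)+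
  then have t: "\<tau> \<in> par {1..d}" unfolding \<tau>_def by (intro H.funpow_mem H.comp_mem)
  have sub: "{1..d} \<subseteq> {1..Suc d}" "{1..d} \<subseteq> {..d}" "{1..Suc d} \<subseteq> {1..<r}" using d r by auto
  have t': "\<tau> \<in> par {1..Suc d}" "\<tau> \<in> par {..d}" using t par_mono[OF sub(1)] par_mono[OF sub(2)] by blast+
  have main: "g \<in> par {1..d}"
    if g: "g \<in> par {1..Suc d}" "g \<in> par {..d}" and out: "\<And>x. (\<And>b l. l \<in> {1..r} \<Longrightarrow> x \<noteq> P b l) \<Longrightarrow> g x = x" for g
  proof -
    consider "d \<le> r - 4" | "d = r - 3" | "d = r - 2" using d by linarith
    then show ?thesis
    proof cases
      case 1
      show ?thesis by (rule parabolic_low[OF _ _ _ _ 1 g out]) (use i2 d in simp_all)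
    next
      case 2
      have e: "Suc (r - 3) = r - 2" using r by simp
      show ?thesis using parabolic_mid[of 1 g] g out i2 r unfolding 2 e by simp
    next
      case 3
      have "g \<in> par {1..<r}" using g(1) par_mono[OF sub(3)] by blast
      then show ?thesis using parabolic_high[of 1 g] g(2) out i2 r unfolding 3 by simp
    qed
  qed
  have gr: "g \<in> par {1..<r}" using g(1) par_mono[OF sub(3)] by blast
  from outside_par_1[OF i2 gr] show ?thesis
  proof
    assume "\<forall>x. (\<forall>b. \<forall>l\<in>{1..r}. x \<noteq> P b l) \<longrightarrow> g x = x"
    then show ?thesis by (intro main[OF g]) blast
  next
    assume a: "\<forall>x. (\<forall>b. \<forall>l\<in>{1..r}. x \<noteq> P b l) \<longrightarrow> g x = \<rho> 1 x"
    have "\<tau> \<circ> g \<in> par {1..d}"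
    proof (rule main[OF par_comp[OF t'(1) g(1)] par_comp[OF t'(2) g(2)]])
      fix x assume x: "\<And>b l. l \<in> {1..r} \<Longrightarrow> x \<noteq> P b l"
      then have "g x = \<rho> 1 x" using a by blast
      moreover have "\<tau> (\<rho> 1 x) = \<rho> 1 (\<rho> 1 x)"
        unfolding \<tau>_def by (rule cube_1_2_outside(1)[OF i2 cube_1_2_outside(2)[OF i2 x]])
      ultimately show "(\<tau> \<circ> g) x = x" using rho_involution[of 1 x] r by simp
    qed
    then show ?thesis by (rule H.comp_cancel_left[OF t])
  qed
qed

text \<open>The cases follow the available corrections: \<open>c = 1\<close> has to deal with the
  rest of the paths, and from \<open>c = r - 3\<close> on the label \<open>r - 4\<close> for the
  flip is missing. In between nothing outside the blocks \<open>c\<close> to \<open>r\<close>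
  moves.\<close>

lemma parabolic_all:
  assumes c: "1 \<le> c" "c \<le> d" and d: "d \<le> r - 2" and g: "g \<in> par {c..Suc d}" "g \<in> par {..d}"
  shows "g \<in> par {c..d}"
proof -
  have sub: "{c..Suc d} \<subseteq> {c..<r}" using d r by auto
  have gr: "g \<in> par {c..<r}" using g(1) par_mono[OF sub] by blast
  have dc: "d \<le> r - 4 \<or> d = r - 3 \<or> d = r - 2" using d by linarith
  consider "c = 1" "i = 1" | "c = 1" "2 \<le> i" "d = 1" | "c = 1" "2 \<le> i" "2 \<le> d"
    | "2 \<le> c" "c \<le> r - 4" | "c = r - 3" | "c = r - 2"
    using c d i by linarith
  then show ?thesis
  proof cases
    case 1
    show ?thesis
      using dc parabolic_i1_low[OF 1(2), of d g] parabolic_i1_mid[OF 1(2), of g] parabolic_i1_high[OF 1(2), of g]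
        c gr g(2) unfolding 1(1) by (elim disjE) simp_all
  next
    case 2
    have "Suc 1 = 2" by simp
    show ?thesis using parabolic_1_1[OF 2(2), of g] g unfolding 2(1,3) \<open>Suc 1 = 2\<close> by blast
  next
    case 3
    show ?thesis using parabolic_c_1[OF 3(2,3) d] g unfolding 3(1) by blast
  next
    case 4
    have out: "g x = x" if "\<And>b l. l \<in> {c..r} \<Longrightarrow> x \<noteq> P b l" for x
      by (rule par_outside[OF gr 4(1) that])
    from dc show ?thesis
    proof (elim disjE)
      assume d: "d \<le> r - 4"
      show ?thesis by (rule parabolic_low[OF c(1) disjI1[OF 4(1)] c(2) _ d g out]) (use 4 in simp)
    next
      assume d: "d = r - 3"
      have e: "Suc (r - 3) = r - 2" using r by simp
      show ?thesis
        using parabolic_mid[OF c(1) disjI1[OF 4(1)] 4(2) _ _ out] g unfolding d e by blast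
    next
      assume d: "d = r - 2"
      show ?thesis
        using parabolic_high[OF c(1) disjI1[OF 4(1)] 4(2) gr _ out] g(2) unfolding d by blast
    qed
  next
    case 5
    then have "d = r - 3 \<or> d = r - 2" using c(2) d by linarith
    then show ?thesis
      using parabolic_top_2[of g] parabolic_top_3[of g] gr g(2) unfolding 5 by (elim disjE) simp_all
  next
    case 6
    then have "d = r - 2" using c(2) d by linarith
    then show ?thesis using parabolic_top_1[of g] gr g(2) unfolding 6 by simp
  qed
qed

text \<open>The first group is enlarged to all labels up to \<open>b - 2\<close>, since only
  invariants of that larger group are used. Two single labels form a separate case, with two groups
  generated by distinct involutions.\<close>

lemma interval_condition:
  assumes "a + 1 < b" "b \<le> r"
  shows "par {a..<b - 1} \<inter> par {a + 1..<b} \<subseteq> par {a + 1..<b - 1}"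
proof
  fix g assume "g \<in> par {a..<b - 1} \<inter> par {a + 1..<b}"
  then have g: "g \<in> par {a..<b - 1}" "g \<in> par {a + 1..<b}" by blast+
  show "g \<in> par {a + 1..<b - 1}"
  proof (cases "b = a + 2")
    case True
    have "{a..<b - 1} = {a}" "{a + 1..<b} = {Suc a}" using True by auto
    then have "g \<in> par {a}" "g \<in> par {Suc a}" using g by simp_all
    then have "(g = id \<or> g = \<rho> a) \<and> (g = id \<or> g = \<rho> (Suc a))"
      using par_singleton assms True by simp
    moreover have "\<rho> a \<noteq> \<rho> (Suc a)" using rho_neq_Suc[of a] assms True by simp
    ultimately have "g = id" by metis
    then show ?thesis using par_id by simp
  next
    case False
    define d where "d = b - 2"
    have e: "{a..<b - 1} \<subseteq> {..d}" "{a + 1..<b} = {a + 1..Suc d}" "{a + 1..<b - 1} = {a + 1..d}" "a + 1 \<le> d" "d \<le> r - 2"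
      using assms False unfolding d_def by auto
    have "g \<in> par {..d}" using g(1) par_mono[OF e(1)] by blast
    then show ?thesis using parabolic_all[of "a + 1" d g] g(2) e(4,5) unfolding e(2,3) by simp
  qed
qed

lemma rho_intersection_property: "intersection_property (sym_group n) \<rho> r"
  by (rule intersection_propertyI) (rule interval_condition)

end

section \<open>The product of labels 0 and 1, and the alternating group\<close>

definition zigzag_pos :: "nat \<Rightarrow> nat \<Rightarrow> nat" where
  "zigzag_pos a z = a - (if 2 * z < a then 2 * z else 2 * a - 1 - 2 * z)"

text \<open>\<open>zigzag_pos\<close> lists the cycle of the product on a path, starting at the
  terminal end: away from it over every second vertex, and back over the vertices left out.\<close>

lemma path_rotation_Suc:
  assumes "z < a"
  shows "path_step 0 a (path_step 1 a (zigzag_pos a z)) = zigzag_pos a (Suc z mod a)"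
proof -
  have s1: "path_step 1 a (a - y) = a - (if even y then (if Suc y < a then Suc y else y) else y - 1)" if "y < a" for y
    using path_step_diff[OF that, of 1] by simp
  have s0: "path_step 0 a (a - y) = a - (if odd y then (if Suc y < a then Suc y else y) else y - 1)" if "y < a" for y
    using path_step_diff[OF that, of 0] by simp
  \<comment> \<open>Way out, turning at the far end for even and for odd \<open>a\<close>, and way
    back.\<close>
  consider "2 * z + 2 < a" | "a = 2 * z + 2" | "a = 2 * z + 1" | "a \<le> 2 * z" by linarith
  then show ?thesis
  proof cases
    case 1
    then have "Suc z mod a = Suc z" by simp
    then show ?thesis using 1 s1[of "2 * z"] s0[of "2 * z + 1"] by (simp add: zigzag_pos_def)
  next
    case 2
    then have "Suc z mod a = Suc z" by simp
    then show ?thesis using 2 s1[of "2 * z"] s0[of "2 * z + 1"] by (simp add: zigzag_pos_def)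
  next
    case 3
    show ?thesis
    proof (cases "z = 0")
      case True
      then show ?thesis using 3 s1[of 0] s0[of 0] by (simp add: zigzag_pos_def)
    next
      case False
      then have "Suc z mod a = Suc z" using 3 by simp
      moreover have "2 * a - 1 - 2 * Suc z = 2 * z - 1" "\<not> 2 * Suc z < a" "2 * z < a" "\<not> Suc (2 * z) < a" using 3 by auto
      ultimately show ?thesis using 3 s1[of "2 * z"] s0[of "2 * z"] by (simp only: zigzag_pos_def if_True if_False) simp
    qed
  next
    case 4
    define u where "u = a - 1 - z"
    have u: "2 * a - 1 - 2 * z = 2 * u + 1" "2 * u + 1 < a" using 4 assms by (auto simp: u_def)
    have l: "path_step 0 a (path_step 1 a (zigzag_pos a z)) = a - (2 * u - 1)"
      using 4 u s1[of "2 * u + 1"] s0[of "2 * u"] by (simp add: zigzag_pos_def)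
    show ?thesis
    proof (cases "u = 0")
      case True
      then have "Suc z = a" using assms by (simp add: u_def)
      then show ?thesis using l True by (simp add: zigzag_pos_def)
    next
      case False
      then have "Suc z < a" "2 * a - 1 - 2 * Suc z = 2 * u - 1" "\<not> 2 * Suc z < a" using u 4 by (auto simp: u_def)
      then show ?thesis using l by (simp only: zigzag_pos_def mod_less if_False)
    qed
  qed
qed

lemma path_rotation_funpow:
  assumes "1 \<le> a"
  shows "((path_step 0 a \<circ> path_step 1 a) ^^ m) (zigzag_pos a (z mod a)) = zigzag_pos a ((z + m) mod a)"
proof (induction m)
  case (Suc m)
  have "(z + m) mod a < a" using assms by simp
  then show ?case using Suc path_rotation_Suc[of "(z + m) mod a" a] by (simp add: mod_Suc_eq)
qed simp

lemma zigzag_pos_surj: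
  assumes "1 \<le> x" "x \<le> a"
  obtains z where "z < a" "x = zigzag_pos a z"
proof (cases "even (a - x)")
  case True
  then obtain z where z: "a - x = 2 * z" by (rule evenE)
  have "2 * z < a" "x = a - 2 * z" using z assms by linarith+
  then show thesis by (intro that[of z]) (simp_all add: zigzag_pos_def)
next
  case False
  then obtain u where u: "a - x = 2 * u + 1" by (rule oddE)
  have x: "2 * u + 1 < a" "x = a - (2 * u + 1)" using u assms by linarith+
  have "a - 1 - u < a" "\<not> 2 * (a - 1 - u) < a" "2 * a - 1 - 2 * (a - 1 - u) = 2 * u + 1" using x(1) by auto
  then show thesis using x(2) by (intro that[of "a - 1 - u"]) (simp_all only: zigzag_pos_def if_False)
qed

lemma path_rotation_id:
  assumes "1 \<le> x" "x \<le> a" "a dvd m"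
  shows "((path_step 0 a \<circ> path_step 1 a) ^^ m) x = x"
proof -
  obtain z where z: "z < a" "x = zigzag_pos a z" using zigzag_pos_surj[OF assms(1,2)] .
  have "1 \<le> a" "(z + m) mod a = z" using z assms(3) by (auto simp: mod_add_eq[symmetric] dvd_eq_mod_eq_0)
  then show ?thesis using path_rotation_funpow[of a m z] z by simp
qed

text \<open>The product is a single cycle on the path, so one fixed point of a power determines
  divisibility by the length.\<close>

lemma path_rotation_fixes_end:
  assumes "1 \<le> a" "((path_step 0 a \<circ> path_step 1 a) ^^ m) a = a"
  shows "a dvd m"
proof -
  have "zigzag_pos a (m mod a) = a"
    using path_rotation_funpow[OF assms(1), of m 0] assms by (simp add: zigzag_pos_def)
  moreover have "m mod a < a" using assms(1) by simp
  ultimately have "m mod a = 0" unfolding zigzag_pos_def by (simp split: if_splits) 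
  then show ?thesis by (simp add: dvd_eq_mod_eq_0)
qed

context thm41
begin

abbreviation rotation :: "nat \<Rightarrow> nat" where "rotation \<equiv> \<rho> 0 \<circ> \<rho> 1"

lemma rotation_t:
  assumes "1 \<le> x" "x \<le> i + 4"
  shows "(rotation ^^ m) x = ((path_step 0 (i + 4) \<circ> path_step 1 (i + 4)) ^^ m) x \<and>
    1 \<le> (rotation ^^ m) x \<and> (rotation ^^ m) x \<le> i + 4"
proof (induction m)
  case (Suc m)
  define y where "y = (rotation ^^ m) x"
  have y: "1 \<le> y" "y \<le> i + 4" using Suc unfolding y_def by blast+
  note p1 = path_step_range[OF y, of 1]
  note p0 = path_step_range[OF conjunct1[OF p1] conjunct2[OF p1], of 0]
  define f where "f = path_step 0 (i + 4) \<circ> path_step 1 (i + 4)"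
  have ym: "y = (f ^^ m) x" using Suc unfolding y_def f_def by blast
  have "rotation y = f y" using y p1 unfolding f_def by (simp add: rho_path)
  moreover have "(rotation ^^ Suc m) x = rotation y" by (simp only: y_def funpow.simps o_apply)
  moreover have "(f ^^ Suc m) x = f y" by (simp only: ym funpow.simps o_apply)
  moreover have "1 \<le> f y \<and> f y \<le> i + 4" using p0 by (simp only: f_def o_apply)
  ultimately show ?case unfolding f_def[symmetric] by (simp only: simp_thms)
qed (use assms in simp)

lemma rotation_s:
  assumes "1 \<le> x" "x \<le> i"
  shows "(rotation ^^ m) (i + r + 2 + x) = i + r + 2 + ((path_step 0 i \<circ> path_step 1 i) ^^ m) x \<and>
    1 \<le> ((path_step 0 i \<circ> path_step 1 i) ^^ m) x \<and> ((path_step 0 i \<circ> path_step 1 i) ^^ m) x \<le> i"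
proof (induction m)
  case (Suc m)
  define y where "y = ((path_step 0 i \<circ> path_step 1 i) ^^ m) x"
  have y: "1 \<le> y" "y \<le> i" using Suc unfolding y_def by blast+
  have s: "\<rho> k (i + r + 2 + y) = i + r + 2 + path_step k i y" if "k < 2" "1 \<le> y" "y \<le> i" for k y
    using rho_path[OF that(1), of "i + r + 2 + y"] that r by simp
  note p1 = path_step_range[OF y, of 1]
  note p0 = path_step_range[OF conjunct1[OF p1] conjunct2[OF p1], of 0]
  define f where "f = path_step 0 i \<circ> path_step 1 i"
  have ym: "y = (f ^^ m) x" unfolding y_def f_def ..
  have x: "(rotation ^^ m) (i + r + 2 + x) = i + r + 2 + y" using Suc unfolding y_def by blast
  have "rotation (i + r + 2 + y) = i + r + 2 + f y"
    using s[of 1 y] s[of 0 "path_step 1 i y"] y p1 unfolding f_def by simp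
  moreover have "(rotation ^^ Suc m) (i + r + 2 + x) = rotation (i + r + 2 + y)"
    by (simp only: x[symmetric] funpow.simps o_apply)
  moreover have "(f ^^ Suc m) x = f y" by (simp only: ym funpow.simps o_apply)
  moreover have "1 \<le> f y \<and> f y \<le> i" using p0 by (simp only: f_def o_apply)
  ultimately show ?case unfolding f_def[symmetric] by (simp only: simp_thms)
qed (use assms in simp)

lemma rotation_fixes:
  assumes "\<not> (1 \<le> x \<and> x \<le> i + 4)" "\<not> (i + r + 3 \<le> x \<and> x \<le> 2 * i + r + 2)"
  shows "(rotation ^^ m) x = x"
proof (induction m)
  case (Suc m)
  have "\<rho> k x = x" if "k < 2" for k
    using assms by (simp only: rho_path[OF that] if_False)
  then show ?case using Suc by simp
qed simp

text \<open>The product has one cycle of length \<open>i + 4\<close>, one of length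
  \<open>i\<close>, and fixes everything else.\<close>

lemma rotation_eq_id_iff: "rotation ^^ m = id \<longleftrightarrow> lcm (i + 4) i dvd m"
proof
  assume a: "rotation ^^ m = id"
  have "((path_step 0 (i + 4) \<circ> path_step 1 (i + 4)) ^^ m) (i + 4) = i + 4"
    using rotation_t[of "i + 4" m] a by simp
  then have "i + 4 dvd m" by (intro path_rotation_fixes_end) simp_all
  moreover have "((path_step 0 i \<circ> path_step 1 i) ^^ m) i = i"
    using rotation_s[of i m] a i by simp
  then have "i dvd m" using i by (intro path_rotation_fixes_end) simp_all
  ultimately show "lcm (i + 4) i dvd m" by (rule lcm_least)
next
  assume "lcm (i + 4) i dvd m"
  then have d: "i + 4 dvd m" "i dvd m" by (auto intro: dvd_trans[OF dvd_lcm1] dvd_trans[OF dvd_lcm2])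
  show "rotation ^^ m = id"
  proof
    fix x
    consider "1 \<le> x \<and> x \<le> i + 4" | "i + r + 3 \<le> x \<and> x \<le> 2 * i + r + 2"
      | "\<not> (1 \<le> x \<and> x \<le> i + 4)" "\<not> (i + r + 3 \<le> x \<and> x \<le> 2 * i + r + 2)" by blast
    then show "(rotation ^^ m) x = id x"
    proof cases
      case 1
      then show ?thesis using rotation_t[of x m] path_rotation_id[of x "i + 4" m] d(1) by simp
    next
      case 2
      define y where "y = x - (i + r + 2)"
      have y: "x = i + r + 2 + y" "1 \<le> y" "y \<le> i" using 2 by (auto simp: y_def)
      then show ?thesis using rotation_s[of y m] path_rotation_id[of y i m] d(2) by simp
    next
      case 3
      then show ?thesis using rotation_fixes by simp
    qed
  qed
qed

text \<open>The i-th power w of the rotation is trivial on the path of the s-vertices, but not on that of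
  the t-vertices, so the commutator of w and the second generator is a 3-cycle.\<close>

lemma three_cycle:
  obtains h where "1 \<le> h" "h \<le> i + 3" "cycle3 h (i + 5) (i + 4) \<in> par {..<r}"
proof -
  interpret H: permutation_subgroup "par {..<r}" n by (intro permutation_subgroup_par) auto
  define w where "w = rotation ^^ i"
  have r2: "\<rho> 0 \<in> par {..<r}" "\<rho> 1 \<in> par {..<r}" "\<rho> 2 \<in> par {..<r}"
    by (rule rho_mem_par, use r in simp)+
  have w: "w \<in> par {..<r}" unfolding w_def by (intro H.funpow_mem H.comp_mem r2)
  have P: "P False 2 = i + r + 2 + i" by (simp add: P_def)
  have wf: "w (P False 2) = P False 2"
    unfolding w_def P using rotation_s[of i i] path_rotation_id[of i i i] i by simp
  have w5: "w (i + 5) = i + 5" unfolding w_def by (rule rotation_fixes) (use r in auto)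
  have w3: "w (P False 3) = P False 3" unfolding w_def by (rule rotation_fixes) (use i r in \<open>auto simp: P_def\<close>)
  have range: "1 \<le> w (i + 4)" "w (i + 4) \<le> i + 4" using rotation_t[of "i + 4" i] by (simp_all add: w_def)
  have "w (i + 4) \<noteq> i + 4"
  proof
    assume "w (i + 4) = i + 4"
    then have "i + 4 dvd i"
      unfolding w_def using rotation_t[of "i + 4" i] by (intro path_rotation_fixes_end) simp_all
    then show False using i dvd_imp_le[of "i + 4" i] by simp
  qed
  then have le: "w (i + 4) \<le> i + 3" using range by linarith
  have "2 < r" "2 \<noteq> r - 3" using r by auto
  then have e2: "\<rho> 2 = transpose (i + 4) (i + 5) \<circ> transpose (P False 2) (P False 3)"
    using rho_tail[of 2] by (simp add: P_def eval_nat_numeral)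
  note bw = H.bij[OF w]
  have v: "vert True 2" "vert True 3" "vert False 2" "vert False 3" using r by (auto simp: vert_def)
  have "i + 4 = P True 2" "i + 5 = P True 3" by (simp_all add: P_def)
  then have ne: "i + 4 \<noteq> P False 2" "i + 4 \<noteq> P False 3" "i + 5 \<noteq> P False 2" "i + 5 \<noteq> P False 3"
    using P_eq_iff[OF v(1,3)] P_eq_iff[OF v(1,4)] P_eq_iff[OF v(2,3)] P_eq_iff[OF v(2,4)] by simp_all
  have "w \<circ> \<rho> 2 \<circ> inv' w = (w \<circ> transpose (i + 4) (i + 5) \<circ> inv' w) \<circ> (w \<circ> transpose (P False 2) (P False 3) \<circ> inv' w)"
    unfolding e2 using bw by (simp add: fun_eq_iff bij_is_inj)
  also have "\<dots> = transpose (w (i + 4)) (i + 5) \<circ> transpose (P False 2) (P False 3)"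
    unfolding conj_transpose[OF bw] w5 wf w3 ..
  finally have "w \<circ> \<rho> 2 \<circ> inv' w \<circ> \<rho> 2 = transpose (w (i + 4)) (i + 5) \<circ> (transpose (P False 2) (P False 3) \<circ> \<rho> 2)"
    by (simp add: comp_assoc)
  also have "transpose (P False 2) (P False 3) \<circ> \<rho> 2 = transpose (i + 5) (i + 4)"
    unfolding e2 using ne by (auto simp: fun_eq_iff transpose_def)
  finally have "cycle3 (w (i + 4)) (i + 5) (i + 4) \<in> par {..<r}"
    using H.comp_mem[OF H.conj_mem[OF w r2(3)] r2(3)] by (simp only:)
  then show thesis using that range(1) le by blast
qed

text \<open>The class of the hub \<open>i + 5\<close> is everything. Its partner \<open>h\<close>
  from the 3-cycle satisfies \<open>h \<le> i + 3\<close>: labels 0 and 1 fix \<open>i + 5\<close>,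
  all others fix \<open>h\<close>, so the class is closed under each generator and spreads along the
  edges of the connected graph.\<close>

lemma par_eq_alternating: "par {..<r} = carrier (alt_group n)"
proof
  show "par {..<r} \<subseteq> carrier (alt_group n)"
    using par_permutes[of _ "{..<r}"] par_even[of _ "{..<r}"] by (auto simp only: alt_group_carrier)
  interpret H: permutation_subgroup "par {..<r}" n by (intro permutation_subgroup_par) auto
  obtain h where h: "1 \<le> h" "h \<le> i + 3" "cycle3 h (i + 5) (i + 4) \<in> par {..<r}" using three_cycle .
  have rho: "\<rho> k \<in> par {..<r}" if "k < r" for k by (rule rho_mem_par) (use that in simp)
  have "distinct [h, i + 5, i + 4]" using h(2) by simp
  then have "H.linked h (i + 5)" unfolding H.linked_def using h(3) by blast
  then have hub: "H.linked (i + 5) h" by (rule H.linked_sym)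
  have P3: "i + 5 = P True 3" by (simp add: P_def)
  have fixes_hub: "\<rho> k (i + 5) = i + 5 \<or> \<rho> k h = h" if k: "k < r" for k
  proof -
    consider "k = 0" | "k = 1" | "2 \<le> k" by linarith
    then show ?thesis
    proof cases
      case 1
      then show ?thesis unfolding P3 using rho_0_P[of 3 True] r by simp
    next
      case 2
      then show ?thesis unfolding P3 using rho_1_P[of True 3] r by (simp add: vert_def)
    next
      case 3
      have "\<rho> k h = h" by (rule rho_fixes[OF 3 k]) (use 3 h(2) r in \<open>auto simp: P_def\<close>)
      then show ?thesis by simp
    qed
  qed
  have move: "H.linked (i + 5) (\<rho> k x)" if "k < r" "H.linked (i + 5) x" for k x
    by (rule H.linked_closed[OF rho[OF that(1)] hub fixes_hub[OF that(1)] that(2)])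
  have up: "H.linked (i + 5) (P True l)" if "3 \<le> l" "l \<le> r" for l
    using that
  proof (induction l rule: dec_induct)
    case base
    show ?case unfolding P3 H.linked_def by simp
  next
    case (step l)
    then have "H.linked (i + 5) (\<rho> l (P True l))" by (intro move) simp_all
    then show ?case using rho_moves[of l] step by simp
  qed
  have "H.linked (i + 5) (\<rho> 2 (P True 3))" using r by (intro move up) simp_all
  moreover have "\<rho> 2 (P True 3) = P True 2"
    using rho_moves[of 2] rho_involution[of 2 "P True 2"] r by (simp add: eval_nat_numeral)
  moreover have "P True 2 = i + 4" by (simp add: P_def)
  ultimately have P2: "H.linked (i + 5) (i + 4)" by (simp only:)
  have t: "H.linked (i + 5) x" if "1 \<le> x" "x \<le> i + 4" for x
    using that(2,1)
  proof (induction x rule: inc_induct)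
    case base
    show ?case by (rule P2)
  next
    case (step x)
    define k :: nat where "k = (if odd (i + 4 - x) then 1 else 0)"
    have "i + 4 - x = Suc (i + 4 - Suc x)" using step by simp
    then have "even (i + 4 - Suc x) \<longleftrightarrow> k = 1" by (simp add: k_def)
    then have "path_step k (i + 4) (Suc x) = x" using step by (simp add: path_step_def)
    moreover have "k < 2" by (simp add: k_def)
    ultimately have "\<rho> k (Suc x) = x" using step by (simp add: rho_path)
    then show ?case using move[of k "Suc x"] step \<open>k < 2\<close> r by simp
  qed
  \<comment> \<open>A connecting edge of the bridge takes the class to the s-side.\<close>
  have "H.linked (i + 5) (\<rho> (r - 3) (P True r))" using r by (intro move up) simp_all
  moreover have "\<rho> (r - 3) (P True r) = P False r"
  proof -
    have "2 \<le> r - 3" "r - 3 < r" "r \<noteq> r - 3" "r \<noteq> Suc (r - 3)" using r by auto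
    then show ?thesis using rho_P[OF _ _ vert_r(1), of "r - 3" True] by simp
  qed
  ultimately have Fr: "H.linked (i + 5) (P False r)" by simp
  have down: "H.linked (i + 5) (P False l)" if "2 \<le> l" "l \<le> r" for l
    using that(2,1)
  proof (induction l rule: inc_induct)
    case base
    show ?case by (rule Fr)
  next
    case (step l)
    have "vert False (Suc l)" using step by (intro vertI) simp_all
    then have "\<rho> l (P False (Suc l)) = P (False \<noteq> (l = r - 3 \<and> r - 1 \<le> Suc l)) (transpose l (Suc l) (Suc l))"
      using step by (intro rho_P) simp_all
    moreover have "(l = r - 3 \<and> r - 1 \<le> Suc l) = False" using r by auto
    ultimately have "\<rho> l (P False (Suc l)) = P False l" by (simp only: transpose_apply_second simp_thms)
    then show ?case using move[of l "P False (Suc l)"] step by simp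
  qed
  have s: "H.linked (i + 5) (i + r + 2 + x)" if "1 \<le> x" "x \<le> i" for x
    using that(2,1)
  proof (induction x rule: inc_induct)
    case base
    have "i + r + 2 + i = P False 2" by (simp add: P_def)
    then show ?case using down[of 2] r by simp
  next
    case (step x)
    define k :: nat where "k = (if odd (i - x) then 1 else 0)"
    have "i - x = Suc (i - Suc x)" using step by simp
    then have "even (i - Suc x) \<longleftrightarrow> k = 1" by (simp add: k_def)
    then have "path_step k i (Suc x) = x" using step by (simp add: path_step_def)
    moreover have k2: "k < 2" by (simp add: k_def)
    ultimately have "\<rho> k (i + r + 2 + Suc x) = i + r + 2 + x"
      using rho_path[OF k2, of "i + r + 2 + Suc x"] step r by simp
    then show ?case using move[of k "i + r + 2 + Suc x"] step k2 r by simp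
  qed
  have all: "H.linked (i + 5) x" if "x \<in> {1..n}" for x
  proof -
    have "1 \<le> x" "x \<le> 2 * i + 2 * r" using that by auto
    then consider "x \<le> i + 4" | "i + 5 \<le> x" "x \<le> i + r + 2" | "i + r + 3 \<le> x" "x \<le> 2 * i + r + 2"
      | "2 * i + r + 3 \<le> x" by linarith
    then show ?thesis
    proof cases
      case 1
      then show ?thesis using t that by simp
    next
      case 2
      then have "x = P True (x - (i + 2))" "3 \<le> x - (i + 2)" "x - (i + 2) \<le> r" by (auto simp: P_def)
      then show ?thesis using up by metis
    next
      case 3
      then have "x = i + r + 2 + (x - (i + r + 2))" "1 \<le> x - (i + r + 2)" "x - (i + r + 2) \<le> i" by auto
      then show ?thesis using s by metis
    next
      case 4
      then have "x = P False (x - (2 * i + r))" "2 \<le> x - (2 * i + r)" "x - (2 * i + r) \<le> r"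
        using \<open>x \<le> 2 * i + 2 * r\<close> by (auto simp: P_def)
      then show ?thesis using down by metis
    qed
  qed
  show "carrier (alt_group n) \<subseteq> par {..<r}"
  proof
    fix p assume "p \<in> carrier (alt_group n)"
    then have p: "p permutes {1..n}" "evenperm p" by (simp_all only: alt_group_carrier)
    show "p \<in> par {..<r}"
    proof (rule H.even_mem_if_linked[OF _ _ p])
      show "H.linked u v" if "u \<in> {1..n}" "v \<in> {1..n}" for u v
        using all that H.linked_sym H.linked_trans by blast
    qed simp
  qed
qed

end

section \<open>Orders of products of generators\<close>

lemma alt_group_pow: "x [^]\<^bsub>alt_group n\<^esub> (m::nat) = x ^^ m"
proof (induction m)
  case 0
  then show ?case by (simp add: alt_group_one)
next
  case (Suc m)
  then show ?case by (simp add: alt_group_mult funpow_swap1 fun_eq_iff)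
qed

lemma alt_group_ord_eqI:
  assumes "x \<in> carrier (alt_group n)" "\<And>m. x ^^ m = id \<longleftrightarrow> d dvd m"
  shows "group.ord (alt_group n) x = d"
  using assms(2) group.ord_unique[OF alt_group_is_group assms(1), of d]
  by (simp only: alt_group_pow alt_group_one simp_thms)

lemma alt_group_ord_dvd_iff:
  assumes "x \<in> carrier (alt_group n)"
  shows "x ^^ m = id \<longleftrightarrow> group.ord (alt_group n) x dvd m"
  using group.pow_eq_id[OF alt_group_is_group assms, of m] by (simp only: alt_group_pow alt_group_one)

lemma alt_group_ord_3:
  assumes "x \<in> carrier (alt_group n)" "x ^^ 3 = id" "x \<noteq> id"
  shows "group.ord (alt_group n) x = 3"
proof -
  define d where "d = group.ord (alt_group n) x"
  have "d dvd 3" "\<not> d dvd 1"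
    using alt_group_ord_dvd_iff[OF assms(1), of 3] alt_group_ord_dvd_iff[OF assms(1), of 1] assms(2,3)
    unfolding d_def by simp_all
  moreover have "d \<le> 3" using \<open>d dvd 3\<close> by (rule dvd_imp_le) simp
  then have "d = 0 \<or> d = 1 \<or> d = 2 \<or> d = 3" by linarith
  ultimately show ?thesis unfolding d_def[symmetric] by auto
qed

lemma alt_group_ord_6:
  assumes "x \<in> carrier (alt_group n)" "x ^^ 3 \<circ> x ^^ 3 = id" "x ^^ 2 \<noteq> id" "x ^^ 3 \<noteq> id"
  shows "group.ord (alt_group n) x = 6"
proof -
  define d where "d = group.ord (alt_group n) x"
  have "x ^^ 6 = id" using assms(2) funpow_add[of 3 3 x] by simp
  then have "d dvd 6" "\<not> d dvd 2" "\<not> d dvd 3"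
    using alt_group_ord_dvd_iff[OF assms(1)] assms(3,4) unfolding d_def by simp_all
  moreover have "d \<le> 6" using \<open>d dvd 6\<close> by (rule dvd_imp_le) simp
  then have "d = 0 \<or> d = 1 \<or> d = 2 \<or> d = 3 \<or> d = 4 \<or> d = 5 \<or> d = 6" by linarith
  ultimately show ?thesis unfolding d_def[symmetric] by (elim disjE) simp_all
qed

context thm41
begin

lemma rho_moves_back: "1 \<le> k \<Longrightarrow> k < r \<Longrightarrow> \<rho> k (P True (Suc k)) = P True k"
  using rho_moves[of k] rho_involution[of k "P True k"] by simp

lemma rho_moves_first: "Suc k < r \<Longrightarrow> 1 \<le> k \<Longrightarrow> \<rho> (Suc k) (P True k) = P True k"
proof -
  assume k: "Suc k < r" "1 \<le> k"
  have "vert True k" using k by (simp add: vert_def)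
  moreover have "(Suc k = r - 3 \<and> r - 1 \<le> k) = False" by auto
  ultimately show ?thesis using rho_P[of "Suc k" True k] k by simp
qed

text \<open>Two steps are followed on the t-points of three consecutive blocks, which are far enough
  from any reversal to be cycled.\<close>

lemma product_neq_id:
  assumes "1 \<le> k" "Suc k < r"
  shows "\<rho> k \<circ> \<rho> (Suc k) \<noteq> id" "(\<rho> k \<circ> \<rho> (Suc k)) ^^ 2 \<noteq> id"
proof -
  have 1: "(\<rho> k \<circ> \<rho> (Suc k)) (P True (Suc (Suc k))) = P True k"
    using assms rho_moves_back[of "Suc k"] rho_moves_back[of k] by simp
  have 2: "(\<rho> k \<circ> \<rho> (Suc k)) (P True k) = P True (Suc k)"
    using assms rho_moves_first[of k] rho_moves[of k] by simp
  show "\<rho> k \<circ> \<rho> (Suc k) \<noteq> id"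
  proof
    assume "\<rho> k \<circ> \<rho> (Suc k) = id"
    then show False using 1 by (simp add: P_def)
  qed
  have "((\<rho> k \<circ> \<rho> (Suc k)) ^^ 2) (P True (Suc (Suc k))) = P True (Suc k)"
    using 1 2 by (simp add: numeral_2_eq_2)
  then show "(\<rho> k \<circ> \<rho> (Suc k)) ^^ 2 \<noteq> id" by (auto simp: P_def)
qed

lemma product_cube:
  assumes k: "2 \<le> k" "Suc k < r" "k \<noteq> r - 3" "Suc k \<noteq> r - 3"
  shows "(\<rho> k \<circ> \<rho> (Suc k)) ^^ 3 = id"
proof
  fix x
  show "((\<rho> k \<circ> \<rho> (Suc k)) ^^ 3) x = id x"
  proof (cases "\<exists>b l. 2 \<le> l \<and> l \<le> r \<and> x = P b l")
    case True
    then obtain b l where l: "2 \<le> l" "l \<le> r" "x = P b l" by blast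
    have 1: "\<rho> k (P b l) = P b (transpose k (Suc k) l)" if "vert b l" for l
      using rho_P[of k b l] that k by simp
    have 2: "\<rho> (Suc k) (P b l) = P b (transpose (Suc k) (Suc (Suc k)) l)" if "vert b l" for l
      using rho_P[of "Suc k" b l] that k by simp
    have v: "vert b k" "vert b (Suc k)" "vert b (Suc (Suc k))" "vert b l" using k l by (auto simp: vert_def)
    consider "l = k" | "l = Suc k" | "l = Suc (Suc k)" | "l \<noteq> k" "l \<noteq> Suc k" "l \<noteq> Suc (Suc k)" by blast
    then show ?thesis unfolding l(3) using v by cases (simp_all add: funpow_3 1 2)
  next
    case False
    then have "\<rho> j x = x" if "2 \<le> j" "j < r" for j by (intro rho_fixes[OF that]) (use that in auto)
    then show ?thesis using k by (simp add: funpow_3)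
  qed
qed

lemma product_mem_alt:
  assumes "j < r" "k < r"
  shows "\<rho> j \<circ> \<rho> k \<in> carrier (alt_group n)"
proof -
  have "\<rho> j \<in> par {..<r}" "\<rho> k \<in> par {..<r}" by (rule rho_mem_par, use assms in simp)+
  then show ?thesis using par_comp unfolding par_eq_alternating[symmetric] by blast
qed

lemma ord_0_1: "group.ord (alt_group n) (\<rho> 0 \<circ> \<rho> 1) = lcm (i + 4) i"
  using r by (intro alt_group_ord_eqI product_mem_alt rotation_eq_id_iff) simp_all

text \<open>The cube is the involution that served as correction before: an edge swap for
  \<open>i = 1\<close>, label 1 restricted to the points outside the blocks for
  \<open>2 \<le> i\<close>. The points 2 and \<open>i + 2\<close>, respectively, show that it is not
  trivial.\<close>

lemma ord_1_2: "group.ord (alt_group n) (\<rho> 1 \<circ> \<rho> 2) = 6"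
proof (rule alt_group_ord_6[OF product_mem_alt])
  have "Suc 1 < r" "(1::nat) \<le> 1" using r by auto
  from product_neq_id(2)[OF this(2,1)] show "(\<rho> 1 \<circ> \<rho> 2) ^^ 2 \<noteq> id" by (simp add: numeral_2_eq_2)
  define f where "f = (\<rho> 1 \<circ> \<rho> 2) ^^ 3"
  have "f \<circ> f = id \<and> f \<noteq> id"
  proof (cases "i = 1")
    case True
    have v: "vert False 2" "vert False 3" using r by (auto simp: vert_def)
    have ge: "4 \<le> P False 2" "4 \<le> P False 3" using P_ge_4 v by auto
    have f: "f = transpose (P False 2) (P False 3) \<circ> transpose 2 3"
      unfolding f_def cube_1_2_edge_swap[OF True] edge_swap_def by (simp add: eval_nat_numeral)
    have "f 2 = 3" unfolding f using ge by (simp add: transpose_def)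
    then have "f \<noteq> id" by auto
    moreover have "f (f x) = x" for x unfolding f using ge by (simp add: transpose_def)
    ultimately show ?thesis by (simp add: fun_eq_iff)
  next
    case False
    then have i2: "2 \<le> i" using i by simp
    have r1u: "\<rho> 1 (i + 2) = i + 1" using rho_path[of 1 "i + 2"] i2 by (simp add: path_step_def)
    have "f (i + 2) = \<rho> 1 (i + 2)"
      unfolding f_def by (rule cube_1_2_outside(1)[OF i2]) (use r in \<open>auto simp: P_def\<close>)
    then have "f \<noteq> id" using r1u by auto
    moreover have "f (f x) = x" for x
    proof (cases "\<exists>b l. l \<in> {1..r} \<and> x = P b l")
      case True
      then obtain b l where l: "l \<in> {1..r}" "x = P b l" by blast
      have "vert b l" using l(1) i2 by (auto simp: vert_def)
      then show ?thesis unfolding f_def l(2) using cube_1_2_P[OF i2] by simp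
    next
      case False
      then have x: "x \<noteq> P b l" if "l \<in> {1..r}" for b l using that by blast
      have "f (\<rho> 1 x) = \<rho> 1 (\<rho> 1 x)"
        unfolding f_def by (rule cube_1_2_outside(1)[OF i2 cube_1_2_outside(2)[OF i2 x]])
      moreover have "f x = \<rho> 1 x" unfolding f_def by (rule cube_1_2_outside(1)[OF i2 x])
      ultimately show ?thesis using rho_involution[of 1 x] r by simp
    qed
    ultimately show ?thesis by (simp add: fun_eq_iff)
  qed
  then show "(\<rho> 1 \<circ> \<rho> 2) ^^ 3 \<circ> (\<rho> 1 \<circ> \<rho> 2) ^^ 3 = id" "(\<rho> 1 \<circ> \<rho> 2) ^^ 3 \<noteq> id"
    unfolding f_def by blast+
qed (use r in simp_all)

lemma ord_3:
  assumes "2 \<le> k" "Suc k < r" "k \<noteq> r - 3" "Suc k \<noteq> r - 3"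
  shows "group.ord (alt_group n) (\<rho> k \<circ> \<rho> (Suc k)) = 3"
  using assms by (intro alt_group_ord_3 product_mem_alt product_cube product_neq_id) simp_all

lemma ord_before_bridge: "group.ord (alt_group n) (\<rho> (r - 4) \<circ> \<rho> (r - 3)) = 6"
proof (rule alt_group_ord_6[OF product_mem_alt])
  have e: "Suc (r - 4) = r - 3" "1 \<le> r - 4" "r - 3 < r" using r by auto
  show "(\<rho> (r - 4) \<circ> \<rho> (r - 3)) ^^ 2 \<noteq> id" using product_neq_id(2)[OF e(2)] e by simp
  show "(\<rho> (r - 4) \<circ> \<rho> (r - 3)) ^^ 3 \<circ> (\<rho> (r - 4) \<circ> \<rho> (r - 3)) ^^ 3 = id"
    unfolding flip_eq using flip_involution[OF vert_r(2) vert_r(2)] r by (simp add: fun_eq_iff)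
  have "flip (r - 1) (P True r) = P False r"
    using flip_P[OF vert_r(2) vert_r(2) _ vert_r(1), of True] r by simp
  moreover have "P False r \<noteq> P True r" using P_eq_iff[OF vert_r(1) vert_r(1)] by simp
  ultimately show "(\<rho> (r - 4) \<circ> \<rho> (r - 3)) ^^ 3 \<noteq> id" unfolding flip_eq by auto
qed (use r in simp_all)

text \<open>In the twisted coordinates the cube is the global reversal of the last four blocks, so
  the order is 6 and not 3.\<close>

lemma ord_after_bridge: "group.ord (alt_group n) (\<rho> (r - 3) \<circ> \<rho> (r - 2)) = 6"
proof (rule alt_group_ord_6[OF product_mem_alt])
  have e: "Suc (r - 3) = r - 2" "1 \<le> r - 3" "r - 2 < r" using r by auto
  show "(\<rho> (r - 3) \<circ> \<rho> (r - 2)) ^^ 2 \<noteq> id" using product_neq_id(2)[OF e(2)] e by simp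
  define k3 k2 k1 where k_def: "k3 = r - 3" "k2 = r - 2" "k1 = r - 1"
  have k: "k3 \<le> k3" "k3 < r" "k3 \<le> k2" "k2 < r" "Suc k3 = k2" "Suc k2 = k1" "k2 \<noteq> k3" "k1 \<noteq> k3" "k1 \<noteq> k2" "r \<noteq> k3" "r \<noteq> k2" "r \<noteq> k1" "k1 \<le> r" "k2 \<le> r" "k3 \<le> k1"
    using r unfolding k_def by auto
  note tw3 = rho_twist[OF k(1,2)[unfolded k_def], folded k_def, unfolded k(5)]
    and tw2 = rho_twist[OF k(3,4)[unfolded k_def], folded k_def, unfolded k(6)]
  have in4: "k3 \<in> {k3..r}" "k2 \<in> {k3..r}" "k1 \<in> {k3..r}" "r \<in> {k3..r}" using k by auto
  define f where "f = (\<rho> k3 \<circ> \<rho> k2) ^^ 3"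
  have f: "f (twist b l) = twist (\<not> b) l" if l: "l \<in> {k3..r}" for b l
  proof -
    have "l = k3 \<or> l = k2 \<or> l = k1 \<or> l = r" using l unfolding k_def by auto
    then consider "l = k3" | "l = k2" | "l = k1" | "l = r" by blast
    then show ?thesis
      unfolding f_def using in4 k(7-12) k(7-12)[symmetric] by cases (simp_all add: funpow_3 tw3 tw2)
  qed
  have "twist False r \<noteq> twist True r"
    using twist_eq_iff[of r r False True] in4(4) unfolding k_def by simp
  then have ne: "f \<noteq> id" using f[OF in4(4), of True] by auto
  have "f (f x) = x" for x
  proof (cases "\<exists>b l. l \<in> {k3..r} \<and> x = P b l")
    case True
    then obtain b l where "l \<in> {k3..r}" "x = twist b l" using P_as_twist by metis
    then show ?thesis using f by simp
  next
    case False
    have "\<rho> j x = x" if "k3 \<le> j" "j < r" for j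
      by (rule rho_fixes) (use that False r in \<open>auto simp: k_def\<close>)
    then have "f x = x" unfolding f_def using k by (simp add: funpow_3)
    then show ?thesis by simp
  qed
  then have "f \<circ> f = id" by (simp add: fun_eq_iff)
  then show "(\<rho> (r - 3) \<circ> \<rho> (r - 2)) ^^ 3 \<circ> (\<rho> (r - 3) \<circ> \<rho> (r - 2)) ^^ 3 = id"
    "(\<rho> (r - 3) \<circ> \<rho> (r - 2)) ^^ 3 \<noteq> id"
    using ne unfolding f_def k_def by blast+
qed (use r in simp_all)

lemma rho_neq_id:
  assumes "k < r"
  shows "\<rho> k \<noteq> id"
proof (cases "k = 0")
  case True
  then show ?thesis using rho_0_moves by auto
next
  case False
  then have "\<rho> k (P True k) \<noteq> P True k" using rho_moves[of k] assms by (simp add: P_def)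
  then show ?thesis by auto
qed

section \<open>Transfer to the alternating group and conclusion\<close>

lemma alt_generate:
  assumes "J \<subseteq> {..<r}"
  shows "generate (alt_group n) (\<rho> ` J) = par J"
proof -
  have "\<rho> ` J \<subseteq> carrier (alt_group n)"
    using rho_mem_par[of _ "{..<r}"] assms unfolding par_eq_alternating by blast
  then show ?thesis
    unfolding alt_group_def
    using sym.generate_consistent[OF _ alt_group_is_subgroup, of "\<rho> ` J"] by (simp add: alt_group_def)
qed

text \<open>Both groups are \<open>sym_group n\<close> with the carrier replaced, so equal carriers
  give equal groups and not merely isomorphic ones.\<close>

lemma thm41_group_eq: "thm41_group n r = alt_group n"
proof -
  have "generate (sym_group n) (thm41_rho n r ` {..<r}) = {p. p permutes {1..n} \<and> evenperm p}"
    using par_eq_alternating unfolding rho_def alt_group_def by simp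
  then show ?thesis unfolding thm41_group_def alt_group_def by (simp only:)
qed

lemma string_C_group_rho: "string_C_group (alt_group n) \<rho> r"
proof -
  have mem: "\<rho> j \<in> carrier (alt_group n)" if "j < r" for j
    using rho_mem_par[of j "{..<r}"] that unfolding par_eq_alternating by simp
  have sq: "(\<rho> j \<circ> \<rho> k) ^^ 2 = id" if "j + 2 \<le> k" "k < r" for j k
  proof -
    have "\<rho> j (\<rho> k x) = \<rho> k (\<rho> j x)" for x using rho_commute[OF that] by (metis o_apply)
    moreover have "\<rho> j (\<rho> j x) = x" "\<rho> k (\<rho> k x) = x" for x using rho_involution that by simp_all
    ultimately show ?thesis by (simp add: fun_eq_iff numeral_2_eq_2)
  qed
  have "sggi (alt_group n) \<rho> r"
    unfolding sggi_def
  proof (intro conjI allI impI)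
    show "group (alt_group n)" by (rule alt_group_is_group)
    show "\<rho> j \<in> carrier (alt_group n)" if "j < r" for j by (rule mem[OF that])
    show "\<rho> j \<noteq> \<one>\<^bsub>alt_group n\<^esub>" if "j < r" for j unfolding alt_group_one by (rule rho_neq_id[OF that])
    show "\<rho> j \<otimes>\<^bsub>alt_group n\<^esub> \<rho> j = \<one>\<^bsub>alt_group n\<^esub>" if "j < r" for j
      using rho_comp_self[OF that] by (simp only: alt_group_one alt_group_mult)
    show "(\<rho> j \<otimes>\<^bsub>alt_group n\<^esub> \<rho> k) [^]\<^bsub>alt_group n\<^esub> (2::nat) = \<one>\<^bsub>alt_group n\<^esub>"
      if "j < r" "k < r" "j + 2 \<le> k" for j k
      unfolding alt_group_pow alt_group_mult alt_group_one by (rule sq[OF that(3,2)])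
    show "carrier (alt_group n) = generate (alt_group n) (\<rho> ` {..<r})"
      using alt_generate[of "{..<r}"] par_eq_alternating by simp
  qed
  moreover have "intersection_property (alt_group n) \<rho> r"
    using rho_intersection_property unfolding intersection_property_def
  proof (intro allI impI)
    fix J K assume H: "\<forall>J K. J \<subseteq> {..<r} \<longrightarrow> K \<subseteq> {..<r} \<longrightarrow> par J \<inter> par K = par (J \<inter> K)"
      and JK: "J \<subseteq> {..<r}" "K \<subseteq> {..<r}"
    have "J \<inter> K \<subseteq> {..<r}" using JK by blast
    then show "generate (alt_group n) (\<rho> ` J) \<inter> generate (alt_group n) (\<rho> ` K) = generate (alt_group n) (\<rho> ` (J \<inter> K))"
      using H JK by (simp only: alt_generate)
  qed
  ultimately show ?thesis unfolding string_C_group_def ..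
qed

lemma schlafli_type_rho:
  "schlafli_type (alt_group n) \<rho> r = [lcm (i + 4) i, 6] @ replicate (r - 6) 3 @ [6, 6, 3]"
proof (rule nth_equalityI)
  show "length (schlafli_type (alt_group n) \<rho> r) = length ([lcm (i + 4) i, 6] @ replicate (r - 6) 3 @ [6, 6, 3])"
    using r by (simp add: schlafli_type_def)
  fix k assume "k < length (schlafli_type (alt_group n) \<rho> r)"
  then have k: "k < r - 1" by (simp add: schlafli_type_def)
  have l: "schlafli_type (alt_group n) \<rho> r ! k = group.ord (alt_group n) (\<rho> k \<circ> \<rho> (Suc k))"
    using k by (simp add: schlafli_type_def alt_group_mult)
  \<comment> \<open>Entry \<open>k\<close> belongs to the labels \<open>k\<close> and
    \<open>Suc k\<close>. The two late entries 6, at \<open>r - 4\<close> and \<open>r - 3\<close>,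
    are those that involve the bridge label.\<close>
  consider "k = 0" | "k = 1" | "2 \<le> k" "k < r - 4" | "k = r - 4" | "k = r - 3" | "k = r - 2"
    using k by linarith
  then show "schlafli_type (alt_group n) \<rho> r ! k = ([lcm (i + 4) i, 6] @ replicate (r - 6) 3 @ [6, 6, 3]) ! k"
  proof cases
    case 1
    then show ?thesis unfolding l using ord_0_1 by simp
  next
    case 2
    then show ?thesis unfolding l using ord_1_2 by (simp add: numeral_2_eq_2)
  next
    case 3
    have "group.ord (alt_group n) (\<rho> k \<circ> \<rho> (Suc k)) = 3" by (rule ord_3) (use 3 in auto)
    moreover have "([lcm (i + 4) i, 6] @ replicate (r - 6) 3 @ [6, 6, 3]) ! k = 3"
      using 3 by (simp add: nth_append nth_Cons')
    ultimately show ?thesis unfolding l by simp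
  next
    case 4
    have "Suc k = r - 3" using 4 r by simp
    then have "group.ord (alt_group n) (\<rho> k \<circ> \<rho> (Suc k)) = 6" using ord_before_bridge 4 by simp
    moreover have "([lcm (i + 4) i, 6] @ replicate (r - 6) 3 @ [6, 6, 3]) ! k = 6"
      using 4 r by (simp add: nth_append nth_Cons')
    ultimately show ?thesis unfolding l by simp
  next
    case 5
    have "Suc k = r - 2" using 5 r by simp
    then have "group.ord (alt_group n) (\<rho> k \<circ> \<rho> (Suc k)) = 6" using ord_after_bridge 5 by simp
    moreover have "([lcm (i + 4) i, 6] @ replicate (r - 6) 3 @ [6, 6, 3]) ! k = 6"
    proof -
      have "\<not> r - 5 < r - 6" using r by linarith
      then show ?thesis using 5 r by (simp add: nth_append nth_Cons')
    qed
    ultimately show ?thesis unfolding l by simp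
  next
    case 6
    have "group.ord (alt_group n) (\<rho> k \<circ> \<rho> (Suc k)) = 3" by (rule ord_3) (use 6 r in auto)
    moreover have "([lcm (i + 4) i, 6] @ replicate (r - 6) 3 @ [6, 6, 3]) ! k = 3"
    proof -
      have "\<not> r - 4 < r - 6" using r by linarith
      then show ?thesis using 6 r by (simp add: nth_append nth_Cons')
    qed
    ultimately show ?thesis unfolding l by simp
  qed
qed

end

theorem theorem4p1:
  fixes n r :: nat
  assumes "even n" and "n \<ge> 14" and "6 \<le> r" and "r \<le> (n - 2) div 2"
  shows "thm41_group n r \<cong> alt_group n
       \<and> string_C_group (thm41_group n r) (thm41_rho n r) r
       \<and> schlafli_type (thm41_group n r) (thm41_rho n r) r
           = [lcm (n div 2 - r + 4) (n div 2 - r), 6] @ replicate (r - 6) 3 @ [6, 6, 3]"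
proof -
  define i where "i = n div 2 - r"
  have n: "n = 2 * (i + r)" and i: "1 \<le> i" using assms unfolding i_def by auto
  interpret thm41 i r using i assms(3) by unfold_locales
  have "thm41_group n r \<cong> alt_group n" unfolding n thm41_group_eq by (rule iso_refl)
  moreover have "string_C_group (thm41_group n r) (thm41_rho n r) r"
    using string_C_group_rho unfolding n thm41_group_eq rho_def .
  moreover have "schlafli_type (thm41_group n r) (thm41_rho n r) r
      = [lcm (i + 4) i, 6] @ replicate (r - 6) 3 @ [6, 6, 3]"
    using schlafli_type_rho unfolding n thm41_group_eq rho_def .
  ultimately show ?thesis unfolding i_def by blast
qed

end
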